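(* Let $n\ge1$, let $x$ be real, and let $|\phi_{\rm D}\rangle\in(\mathbb C^3)^{\otimes N}$ be the zero-energy state for the diagonal twist, with the normalisation given in the context. Then $$(\phi_{\rm D})_{\Uparrow\Downarrow\cdots\Uparrow\Downarrow}=A_{\rm V}(2n+1;x^2)\quad\text{for }N=2n,\qquad(\phi_{\rm D})_{0\cdots0}=x^nA_{\rm V}(2n+1;x^2)\quad\text{for }N=2n+1,$$ where $$A_{\rm V}(2n+1;t)=\det_{0\le i,j\le n-1}\left(\sum_{k=0}^{n-1}\binom{i+j+1}{i+k+1}\binom{i+k+1}{2k+1}t^k\right).$$
   Context: Alternating sign matrices (ASMs): square matrices with entries in $\{-1,0,1\}$, all row and column sums equal to $1$, and non-zero entries alternating in sign along each row and column. $A_{\rm V}(2n+1;t)$ is the generating function $\sum t^k$ over $(2n+1)\times(2n+1)$ ASMs invariant under reflection about the vertical symmetry axis, with $k$ the number of $-1$ entries in the $(2n+1)\times n$ submatrix to the left of the symmetry axis. Notation: $[z]=z-z^{-1}$; $x=q+q^{-1}$ with $q\in\mathbb C^\times$; $\mathbb C^2$ has basis $|{\uparrow}\rangle,|{\downarrow}\rangle$ and $\mathbb C^3$ has basis $|{\Uparrow}\rangle,|0\rangle,|{\Downarrow}\rangle$; $\phi_{\sigma_1\cdots\sigma_N}$ denotes the component of $|\phi\rangle$ along $|\sigma_1\cdots\sigma_N\rangle$. $R(z)$ is the operator on $\mathbb C^2\otimes\mathbb C^3$ with diagonal entries $[q^2z],[qz],[z],[z],[qz],[q^2z]$ on $|{\uparrow\Uparrow}\rangle,|{\uparrow}0\rangle,|{\uparrow\Downarrow}\rangle,|{\downarrow\Uparrow}\rangle,|{\downarrow}0\rangle,|{\downarrow\Downarrow}\rangle$,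 and whose only non-zero off-diagonal entries are those between $|{\uparrow}0\rangle$ and $|{\downarrow\Uparrow}\rangle$ and between $|{\uparrow\Downarrow}\rangle$ and $|{\downarrow}0\rangle$ (both directions), all equal to $\sqrt{[q][q^2]}$ (a fixed root). With auxiliary space $a\simeq\mathbb C^2$, $$R_{a,N}(q^{-1}z)\cdots R_{a,1}(q^{-1}z)=\begin{pmatrix}\mathcal A(z)&\mathcal B(z)\\ \mathcal C(z)&\mathcal D(z)\end{pmatrix}_a .$$ Then $|\phi_{\rm D}\rangle=([q][q^2])^{-N/2}[q]^{-N(N-1)}\,\mathcal B(1)^N|{\Uparrow\cdots\Uparrow}\rangle$ (where $([q][q^2])^{1/2}$ is the same root as in $R$). Its components are polynomials in $x$, which defines it also at $q^4=1$ by continuity. (It is annihilated by the integrable spin-one XXZ Hamiltonian with diagonal twist.) *)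

theory Defs
  imports Complex_Main "Jordan_Normal_Form.Determinant"
begin

definition alternating_sign_matrix :: "nat \<Rightarrow> int mat \<Rightarrow> bool" where
  "alternating_sign_matrix m M \<longleftrightarrow>
     M \<in> carrier_mat m m \<and>
     (\<forall>i<m. \<forall>j<m. M $$ (i,j) \<in> {-1, 0, 1}) \<and>
     (\<forall>i<m. (\<Sum>j<m. M $$ (i,j)) = 1) \<and>
     (\<forall>j<m. (\<Sum>i<m. M $$ (i,j)) = 1) \<and>
     (\<forall>i<m. \<forall>j<m. \<forall>j'<m. j < j' \<and> M $$ (i,j) \<noteq> 0 \<and> M $$ (i,j') \<noteq> 0 \<and>
        (\<forall>l. j < l \<and> l < j' \<longrightarrow> M $$ (i,l) = 0) \<longrightarrow> M $$ (i,j') = - M $$ (i,j)) \<and>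
     (\<forall>j<m. \<forall>i<m. \<forall>i'<m. i < i' \<and> M $$ (i,j) \<noteq> 0 \<and> M $$ (i',j) \<noteq> 0 \<and>
        (\<forall>l. i < l \<and> l < i' \<longrightarrow> M $$ (l,j) = 0) \<longrightarrow> M $$ (i',j) = - M $$ (i,j))"

definition vertically_symmetric :: "nat \<Rightarrow> int mat \<Rightarrow> bool" where
  "vertically_symmetric m M \<longleftrightarrow> (\<forall>i<m. \<forall>j<m. M $$ (i, m - 1 - j) = M $$ (i,j))"

text \<open>The size \<open>m\<close> is meant to be odd; for \<open>m = 2n+1\<close> the columns with index
  below \<open>m div 2 = n\<close> are those to the left of the symmetry axis.\<close>

definition num_neg_left :: "nat \<Rightarrow> int mat \<Rightarrow> nat" where
  "num_neg_left m M = card {(i,j). i < m \<and> j < m div 2 \<and> M $$ (i,j) = -1}"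

definition A_V :: "nat \<Rightarrow> 'a::comm_ring_1 \<Rightarrow> 'a" where
  "A_V m t = (\<Sum>M \<in> {M. alternating_sign_matrix m M \<and> vertically_symmetric m M}.
                t ^ num_neg_left m M)"

datatype spin_half = Up | Dn

datatype spin_one = UUp | Zero | DDn

instance spin_half :: finite
proof
  have "(UNIV :: spin_half set) = {Up, Dn}"
    using spin_half.exhaust by blast
  then show "finite (UNIV :: spin_half set)"
    by (metis finite.emptyI finite.insertI)
qed

instance spin_one :: finite
proof
  have "(UNIV :: spin_one set) = {UUp, Zero, DDn}"
    using spin_one.exhaust by blast
  then show "finite (UNIV :: spin_one set)"
    by (metis finite.emptyI finite.insertI)
qed

definition qbr :: "complex \<Rightarrow> complex" where
  "qbr z = z - inverse z"

fun R_diag :: "complex \<Rightarrow> complex \<Rightarrow> spin_half \<times> spin_one \<Rightarrow> complex" where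
  "R_diag q z (Up, UUp)  = qbr (q^2 * z)"
| "R_diag q z (Up, Zero) = qbr (q * z)"
| "R_diag q z (Up, DDn)  = qbr z"
| "R_diag q z (Dn, UUp)  = qbr z"
| "R_diag q z (Dn, Zero) = qbr (q * z)"
| "R_diag q z (Dn, DDn)  = qbr (q^2 * z)"

text \<open>Matrix elements of \<open>R(z)\<close> on \<open>\<complex>\<^sup>2 \<otimes> \<complex>\<^sup>3\<close>, row index first; \<open>s\<close> is the
  chosen square root of \<open>[q][q\<^sup>2]\<close>.\<close>

definition R_mat :: "complex \<Rightarrow> complex \<Rightarrow> complex
    \<Rightarrow> spin_half \<times> spin_one \<Rightarrow> spin_half \<times> spin_one \<Rightarrow> complex" where
  "R_mat q s z v w =
     (if v = w then R_diag q z v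
      else if {v, w} = {(Up, Zero), (Dn, UUp)} \<or> {v, w} = {(Up, DDn), (Dn, Zero)} then s
      else 0)"

text \<open>A vector of \<open>(\<complex>\<^sup>3)\<^sup>\<otimes>\<^sup>N\<close> is given by its components along the basis vectors
  \<open>|\<sigma>\<^sub>1 \<dots> \<sigma>\<^sub>N\<rangle>\<close>, i.e. by a function on lists, of which only the values on lists of
  length \<open>N\<close> are meaningful (all operators below preserve the length). Site \<open>i\<close> of the chain
  is position \<open>i - 1\<close> of the list.\<close>

type_synonym qstate = "spin_one list \<Rightarrow> complex"

type_synonym aux_qstate = "spin_half \<times> spin_one list \<Rightarrow> complex"

definition R_site :: "complex \<Rightarrow> complex \<Rightarrow> complex \<Rightarrow> nat \<Rightarrow> aux_qstate \<Rightarrow> aux_qstate" where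
  "R_site q s z i \<psi> =
     (\<lambda>(\<alpha>, \<sigma>). \<Sum>\<beta>\<in>UNIV. \<Sum>\<tau>\<in>UNIV. R_mat q s z (\<alpha>, \<sigma> ! i) (\<beta>, \<tau>) * \<psi> (\<beta>, \<sigma>[i := \<tau>]))"

text \<open>\<open>monodromy q s z N\<close> is \<open>R\<^sub>a\<^sub>,\<^sub>N(q\<^sup>-\<^sup>1z) \<cdots> R\<^sub>a\<^sub>,\<^sub>1(q\<^sup>-\<^sup>1z)\<close>.\<close>

primrec monodromy :: "complex \<Rightarrow> complex \<Rightarrow> complex \<Rightarrow> nat \<Rightarrow> aux_qstate \<Rightarrow> aux_qstate" where
  "monodromy q s z 0 \<psi> = \<psi>"
| "monodromy q s z (Suc k) \<psi> = R_site q s (inverse q * z) k (monodromy q s z k \<psi>)"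

text \<open>The upper right block of the monodromy matrix maps the auxiliary \<open>|\<down>\<rangle>\<close> to \<open>|\<up>\<rangle>\<close>.\<close>

definition B_op :: "complex \<Rightarrow> complex \<Rightarrow> nat \<Rightarrow> complex \<Rightarrow> qstate \<Rightarrow> qstate" where
  "B_op q s N z \<psi> =
     (\<lambda>\<sigma>. monodromy q s z N (\<lambda>(\<alpha>, \<tau>). if \<alpha> = Dn then \<psi> \<tau> else 0) (Up, \<sigma>))"

definition all_up :: "nat \<Rightarrow> qstate" where
  "all_up N = (\<lambda>\<sigma>. if \<sigma> = replicate N UUp then 1 else 0)"

definition phi_D_generic :: "complex \<Rightarrow> complex \<Rightarrow> nat \<Rightarrow> qstate" where
  "phi_D_generic q s N =
     (\<lambda>\<sigma>. inverse (s ^ N) * inverse (qbr q ^ (N * (N - 1)))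
           * ((B_op q s N 1 ^^ N) (all_up N)) \<sigma>)"

text \<open>The function \<open>r\<close> selects, for each \<open>q\<close>, the square root of \<open>[q][q\<^sup>2]\<close>. Where the
  normalisation is singular, namely at \<open>q\<^sup>4 = 1\<close>, the components are defined by continuity.\<close>

definition phi_D :: "(complex \<Rightarrow> complex) \<Rightarrow> complex \<Rightarrow> nat \<Rightarrow> qstate" where
  "phi_D r q N =
     (\<lambda>\<sigma>. if q ^ 4 \<noteq> 1 then phi_D_generic q (r q) N \<sigma>
           else Lim (at q) (\<lambda>p. phi_D_generic p (r p) N \<sigma>))"

end

theory Submission
imports Defs "HOL-Computational_Algebra.Polynomial_FPS"
begin

text \<open>Both sides are partition functions of rows acting on the all-up state, and both are evaluated by
  the coordinate Bethe ansatz. Give each row its own rapidity. The components of the resulting vector then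
  satisfy a recursion that peels off one site: \<open>Zero\<close> removes one rapidity, \<open>DDn\<close> two.
  Compatibility with adding a further row amounts to rational identities in the rapidity of that row and
  at most three others.

  For \<open>Zero \<dots> Zero\<close>, the recursion \<open>r(S) = \<Sum>\<^sub>i r(S - {i}) \<Prod>\<^sub>k (x\<^sub>k - y\<^sub>i) / (s\<^sub>k - s\<^sub>i)\<close> is solved by the quotient
  of \<open>det h\<^sub>j(x\<^sub>i, y\<^sub>i)\<close>, \<open>h\<^sub>j\<close> complete homogeneous, by the Vandermonde determinant of the \<open>s\<^sub>i\<close>: modulo the
  span of the columns, \<open>\<Prod>\<^sub>k (x\<^sub>k - y\<^sub>i)\<close> is the last column, so the recursion is its Laplace expansion.
  The component \<open>UUp DDn \<dots> UUp DDn\<close> differs from \<open>Zero \<dots> Zero\<close> by an explicit factor, since the two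
  recursions agree after symmetrisation over pairs of rapidities. Letting the rapidities coincide
  replaces the quotient by a determinant of Taylor coefficients, of size about \<open>2n\<close>. It becomes a
  determinant of coefficients of powers of \<open>X\<^sup>2 / (1 + \<tau>X + X\<^sup>2)\<close> and of \<open>1 + \<tau>X + X\<^sup>2\<close>, and the splitting into the series in
  \<open>X\<^sup>2 / (1 + \<tau>X)\<close> and \<open>X\<close> times such series makes it block triangular with an \<open>n \<times> n\<close> block left.

  The left half of a vertically symmetric alternating sign matrix is read outwards from the middle column,
  which is \<open>1, -1, \<dots>, 1\<close>. Its partial row sums form a six-vertex configuration with \<open>n\<close> rows, which is the
  case of two site states of the same Bethe ansatz and leads to the same determinant.\<close>


subsection \<open>Row operators and Bethe vectors\<close>

text \<open>Both sides involve rows with equal rapidities, where the Bethe coefficients have poles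
  \<open>1 / (z - j)\<close>; this forces the detour through distinct rapidities and a limit. The
  recursion becomes solvable by a choice of variable. Each model has an involution of the rapidity,
  \<open>u \<mapsto> - u / (1 + \<tau> u)\<close> for spin one and \<open>u \<mapsto> 1 / u\<close>
  for six vertices. The variable \<open>s\<close> is invariant under it and \<open>y\<close> is the
  image of \<open>x\<close>, so \<open>h_j(x, y)\<close> is a function of \<open>s\<close> alone, as
  merging nodes require. The limit is taken at a fixed point, \<open>0\<close> or \<open>1\<close>,
  where \<open>s\<close> vanishes to second order. The sums of
  \<open>binomial(i + k + 1, 2 k + 1) z^k\<close> are Chebyshev polynomials of the second kind in
  \<open>1 + z / 2\<close>. The six-vertex model yields them as \<open>h_j(u, 1 / u)\<close>, the
  spin-one model through powers of \<open>1 + \<tau> X\<close>, whose image under the involution is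
  its inverse; hence the common determinant. Divisions by \<open>\<tau>\<close> and by
  \<open>t\<close> exclude \<open>q^2 = -1\<close> and \<open>t = 0\<close>, which continuity
  restores.\<close>

lemma UNIV_spin_half: "(UNIV :: spin_half set) = {Up, Dn}"
  using spin_half.exhaust by blast

lemma UNIV_spin_one: "(UNIV :: spin_one set) = {UUp, Zero, DDn}"
  using spin_one.exhaust by blast

lemma sum_spin_half: "(\<Sum>\<beta>\<in>UNIV. F \<beta>) = F Up + F Dn"
  by (simp add: UNIV_spin_half)

lemma sum_spin_one: "(\<Sum>\<tau>\<in>UNIV. F \<tau>) = F UUp + F Zero + (F DDn :: 'a::comm_monoid_add)"
  by (simp add: UNIV_spin_one add.assoc)

text \<open>The component along \<open>(\<gamma>, \<sigma>)\<close> of a row of vertices \<open>W\<close>, entered with auxiliary state \<open>\<alpha>\<close> at the head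
  of \<open>\<sigma>\<close>, applied to \<open>R\<close>.\<close>

primrec rowop :: "(spin_half \<times> spin_one \<Rightarrow> spin_half \<times> spin_one \<Rightarrow> 'a::comm_semiring_1) \<Rightarrow> spin_half
    \<Rightarrow> spin_one list \<Rightarrow> spin_half \<Rightarrow> (spin_one list \<Rightarrow> 'a) \<Rightarrow> 'a" where
  "rowop W \<gamma> [] \<alpha> R = (if \<alpha> = \<gamma> then R [] else 0)"
| "rowop W \<gamma> (x # \<sigma>) \<alpha> R =
     (\<Sum>\<beta>\<in>UNIV. \<Sum>\<tau>\<in>UNIV. W (\<beta>, x) (\<alpha>, \<tau>) * rowop W \<gamma> \<sigma> \<beta> (\<lambda>\<rho>. R (\<tau> # \<rho>)))"

lemma rowop_cmult: "rowop W \<gamma> \<sigma> \<alpha> (\<lambda>\<rho>. c * R \<rho>) = c * rowop W \<gamma> \<sigma> \<alpha> R"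
  by (induction \<sigma> arbitrary: \<alpha> R) (simp_all add: sum_distrib_left mult.left_commute)

lemma rowop_add: "rowop W \<gamma> \<sigma> \<alpha> (\<lambda>\<rho>. R \<rho> + R' \<rho>) = rowop W \<gamma> \<sigma> \<alpha> R + rowop W \<gamma> \<sigma> \<alpha> R'"
  by (induction \<sigma> arbitrary: \<alpha> R R') (simp_all add: sum.distrib distrib_left)

lemma rowop_zero: "rowop W \<gamma> \<sigma> \<alpha> (\<lambda>\<rho>. 0) = 0"
  by (induction \<sigma> arbitrary: \<alpha>) simp_all

lemma rowop_sum: "finite I \<Longrightarrow> rowop W \<gamma> \<sigma> \<alpha> (\<lambda>\<rho>. \<Sum>i\<in>I. R i \<rho>) = (\<Sum>i\<in>I. rowop W \<gamma> \<sigma> \<alpha> (R i))"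
  by (induction I rule: finite_induct) (simp_all add: rowop_add rowop_zero)

text \<open>\<open>v\<close> is the outgoing pair and \<open>w\<close> the incoming one, as in
  \<open>R_mat\<close>. The two entries that raise the auxiliary spin are normalised to
  \<open>1\<close> and \<open>h\<close>, so the square root in \<open>R_mat\<close> enters only
  squared, through \<open>r1\<close> and \<open>r2\<close>.\<close>

definition wts :: "'a \<Rightarrow> 'a \<Rightarrow> 'a \<Rightarrow> 'a \<Rightarrow> 'a \<Rightarrow> 'a \<Rightarrow> 'a \<Rightarrow> 'a
    \<Rightarrow> spin_half \<times> spin_one \<Rightarrow> spin_half \<times> spin_one \<Rightarrow> 'a::comm_semiring_1" where
  "wts x m d x' e h r1 r2 v w =
     (if v = w then (case v of (Up, UUp) \<Rightarrow> 1 | (Up, Zero) \<Rightarrow> m | (Up, DDn) \<Rightarrow> x'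
                     | (Dn, UUp) \<Rightarrow> x | (Dn, Zero) \<Rightarrow> d | (Dn, DDn) \<Rightarrow> e)
      else if v = (Up, Zero) \<and> w = (Dn, UUp) then 1
      else if v = (Up, DDn) \<and> w = (Dn, Zero) then h
      else if v = (Dn, UUp) \<and> w = (Up, Zero) then r1
      else if v = (Dn, Zero) \<and> w = (Up, DDn) then r2
      else 0)"

section \<open>Symmetrisation of sums over pairs and triples of rapidities\<close>

lemma sum_pairs_swap:
  assumes "finite S"
  shows "(\<Sum>i\<in>S. \<Sum>j\<in>S-{i}. u i j) = (\<Sum>i\<in>S. \<Sum>j\<in>S-{i}. (u j i :: 'a::comm_monoid_add))"
proof -
  have *: "(\<Sum>j\<in>S-{i}. v j) = (\<Sum>j\<in>S. if i = j then 0 else v j)" if "i \<in> S" for i and v :: "_ \<Rightarrow> 'a"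
    using assms by (intro sum.mono_neutral_cong_left) auto
  have "(\<Sum>i\<in>S. \<Sum>j\<in>S-{i}. u i j) = (\<Sum>i\<in>S. \<Sum>j\<in>S. if i = j then 0 else u i j)"
    by (intro sum.cong refl *)
  also have "\<dots> = (\<Sum>j\<in>S. \<Sum>i\<in>S. if i = j then 0 else u i j)" by (rule sum.swap)
  also have "\<dots> = (\<Sum>i\<in>S. \<Sum>j\<in>S-{i}. u j i)"
  proof (rule sum.cong[OF refl])
    fix j assume "j \<in> S"
    have "(\<Sum>i\<in>S. if i = j then 0 else u i j) = (\<Sum>i\<in>S. if j = i then 0 else u i j)"
      by (intro sum.cong) auto
    then show "(\<Sum>i\<in>S. if i = j then 0 else u i j) = (\<Sum>i\<in>S-{j}. u i j)"
      using *[OF \<open>j \<in> S\<close>, of "\<lambda>i. u i j"] by simp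
  qed
  finally show ?thesis .
qed

text \<open>The Bethe identities hold only after symmetrisation over the peeled rapidities. Adding
  the sum to its own swap compares the summands in that form; characteristic 0 allows the division
  by 2.\<close>

lemma sum_pairs_eqI:
  fixes u v :: "'b \<Rightarrow> 'b \<Rightarrow> 'a::field_char_0"
  assumes "finite S" and "\<And>i j. i \<in> S \<Longrightarrow> j \<in> S \<Longrightarrow> i \<noteq> j \<Longrightarrow> u i j + u j i = v i j + v j i"
  shows "(\<Sum>i\<in>S. \<Sum>j\<in>S-{i}. u i j) = (\<Sum>i\<in>S. \<Sum>j\<in>S-{i}. v i j)" (is "?U = ?V")
proof -
  have "?U + ?U = (\<Sum>i\<in>S. \<Sum>j\<in>S-{i}. u i j + u j i)"
    using sum_pairs_swap[OF assms(1), of u] by (simp add: sum.distrib)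
  also have "\<dots> = (\<Sum>i\<in>S. \<Sum>j\<in>S-{i}. v i j + v j i)"
    using assms(2) by (intro sum.cong refl) auto
  also have "\<dots> = ?V + ?V"
    using sum_pairs_swap[OF assms(1), of v] by (simp add: sum.distrib)
  finally show ?thesis by (simp flip: mult_2)
qed

text \<open>The six reorderings of the sum are generated by the transpositions \<open>s12\<close>
  and \<open>s23\<close>.\<close>

lemma sum_triples_eqI:
  fixes u v :: "'b \<Rightarrow> 'b \<Rightarrow> 'b \<Rightarrow> 'a::field_char_0"
  assumes "finite S"
    and "\<And>i j l. i \<in> S \<Longrightarrow> j \<in> S \<Longrightarrow> l \<in> S \<Longrightarrow> i \<noteq> j \<Longrightarrow> i \<noteq> l \<Longrightarrow> j \<noteq> l \<Longrightarrow>
      u i j l + u i l j + u j i l + u j l i + u l i j + u l j i =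
      v i j l + v i l j + v j i l + v j l i + v l i j + v l j i"
  shows "(\<Sum>i\<in>S. \<Sum>j\<in>S-{i}. \<Sum>l\<in>S-{i}-{j}. u i j l) = (\<Sum>i\<in>S. \<Sum>j\<in>S-{i}. \<Sum>l\<in>S-{i}-{j}. v i j l)"
proof -
  define T where "T u = (\<Sum>i\<in>S. \<Sum>j\<in>S-{i}. \<Sum>l\<in>S-{i}-{j}. u i j l)" for u :: "'b \<Rightarrow> 'b \<Rightarrow> 'b \<Rightarrow> 'a"
  have s12: "T u = T (\<lambda>i j l. u j i l)" for u
    unfolding T_def
    by (subst sum_pairs_swap[OF assms(1)]) (simp add: Diff_insert2[symmetric] insert_commute)
  have s23: "T u = T (\<lambda>i j l. u i l j)" for u
    unfolding T_def using assms(1) by (intro sum.cong refl sum_pairs_swap) auto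
  have "T u + T u + T u + T u + T u + T u
    = T u + T (\<lambda>i j l. u i l j) + T (\<lambda>i j l. u j i l) + T (\<lambda>i j l. u j l i) + T (\<lambda>i j l. u l i j) + T (\<lambda>i j l. u l j i)" for u
    using s12[of u] s23[of u] s23[of "\<lambda>i j l. u j i l"] s12[of "\<lambda>i j l. u i l j"] s23[of "\<lambda>i j l. u j l i"] by metis
  moreover have "T u1 + T u2 = T (\<lambda>i j l. u1 i j l + u2 i j l)" for u1 u2
    by (simp add: T_def sum.distrib)
  ultimately have 6: "T u + T u + T u + T u + T u + T u
    = T (\<lambda>i j l. u i j l + u i l j + u j i l + u j l i + u l i j + u l j i)" for u
    by simp
  have "T (\<lambda>i j l. u i j l + u i l j + u j i l + u j l i + u l i j + u l j i)
      = T (\<lambda>i j l. v i j l + v i l j + v j i l + v j l i + v l i j + v l j i)"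
    unfolding T_def by (intro sum.cong refl assms(2)) auto
  with 6[of u] 6[of v] have "6 * T u = 6 * T v" by (simp add: algebra_simps)
  then show ?thesis by (simp add: T_def)
qed

lemma sum_pairs_insert:
  assumes "finite S" "z \<notin> S"
  shows "(\<Sum>i\<in>insert z S. \<Sum>j\<in>insert z S-{i}. u i j)
    = (\<Sum>i\<in>S. u z i + u i z) + (\<Sum>i\<in>S. \<Sum>j\<in>S-{i}. (u i j :: 'a::comm_monoid_add))"
proof -
  have "(\<Sum>j\<in>insert z S-{i}. u i j) = u i z + (\<Sum>j\<in>S-{i}. u i j)" if "i \<in> S" for i
    using assms that by (subst insert_Diff_if) auto
  then show ?thesis using assms by (simp add: sum.distrib ac_simps)
qed

text \<open>The parameters other than \<open>f\<close> and \<open>g\<close> are the vertex weights, as functions of the rapidity; \<open>f\<close> and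
  \<open>g\<close> are the coefficients of the wanted and unwanted terms of the Bethe ansatz.\<close>

locale bethe =
  fixes X m d x' e r1 r2 :: "'b \<Rightarrow> 'a::field_char_0" and f g :: "'b \<Rightarrow> 'b \<Rightarrow> 'a" and h :: 'a
  assumes B_Zero: "\<And>z i. z \<noteq> i \<Longrightarrow> X i * g z i + d z = X z * f i z"
    and A_UUp: "\<And>z i. z \<noteq> i \<Longrightarrow> X i * g z i + r1 z = X z * g z i"
    and A_Zero1: "\<And>z i. z \<noteq> i \<Longrightarrow> m z = f z i + g z i"
    and A_Zero2: "\<And>z i j. z \<noteq> i \<Longrightarrow> z \<noteq> j \<Longrightarrow> i \<noteq> j \<Longrightarrow>
       m z * (X j * f i j * g z j + X i * f j i * g z i) + r2 z * h
       = X z * (g z i * f i j * f j z + g z j * f j i * f i z)"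
    and B_DDn: "\<And>z i j. z \<noteq> i \<Longrightarrow> z \<noteq> j \<Longrightarrow> i \<noteq> j \<Longrightarrow>
       h * (X j * f i j * g z j + X i * f j i * g z i + e z) = h * (X z * f i z * f j z)"
    and A_DDn1: "\<And>z i j. z \<noteq> i \<Longrightarrow> z \<noteq> j \<Longrightarrow> i \<noteq> j \<Longrightarrow>
       h * x' z = h * (f z i * f z j + g z i * f i j + g z j * f j i)"
    and A_DDn2: "\<And>z i j l. z \<noteq> i \<Longrightarrow> z \<noteq> j \<Longrightarrow> z \<noteq> l \<Longrightarrow> i \<noteq> j \<Longrightarrow> i \<noteq> l \<Longrightarrow> j \<noteq> l \<Longrightarrow>
       h * x' z * (X l * f i l * f j l * g z l + X j * f i j * f l j * g z j + X i * f j i * f l i * g z i)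
       = h * X z * (g z l * f l i * f l j * f i z * f j z + g z j * f j i * f j l * f i z * f l z
            + g z i * f i j * f i l * f j z * f l z)"
begin

abbreviation Xs :: "'b set \<Rightarrow> 'a" where "Xs S \<equiv> \<Prod>k\<in>S. X k"
abbreviation fs :: "'b \<Rightarrow> 'b set \<Rightarrow> 'a" where "fs i S \<equiv> \<Prod>k\<in>S. f i k"
abbreviation Xf :: "'b \<Rightarrow> 'b set \<Rightarrow> 'a" where "Xf i S \<equiv> \<Prod>k\<in>S. X k * f i k"
abbreviation Xff :: "'b \<Rightarrow> 'b \<Rightarrow> 'b set \<Rightarrow> 'a" where "Xff i j S \<equiv> \<Prod>k\<in>S. X k * f i k * f j k"

text \<open>A \<open>Zero\<close> carries one rapidity and a \<open>DDn\<close> two; the sum over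
  ordered pairs counts each pair twice, hence \<open>h / 2\<close>. A set of rapidities suffices as
  argument because the order of the rows does not matter, as \<open>bw_rows\<close>
  confirms.\<close>

primrec bw :: "spin_one list \<Rightarrow> 'b set \<Rightarrow> 'a" where
  "bw [] S = (if S = {} then 1 else 0)"
| "bw (x # \<sigma>) S = (case x of
      UUp \<Rightarrow> Xs S * bw \<sigma> S
    | Zero \<Rightarrow> (\<Sum>i\<in>S. Xf i (S-{i}) * bw \<sigma> (S-{i}))
    | DDn \<Rightarrow> h / 2 * (\<Sum>i\<in>S. \<Sum>j\<in>S-{i}. Xff i j (S-{i}-{j}) * bw \<sigma> (S-{i}-{j})))"

abbreviation wt :: "'b \<Rightarrow> spin_half \<times> spin_one \<Rightarrow> spin_half \<times> spin_one \<Rightarrow> 'a" where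
  "wt z \<equiv> wts (X z) (m z) (d z) (x' z) (e z) h (r1 z) (r2 z)"

lemma bw_Zero_insert:
  assumes "finite S" "z \<notin> S"
  shows "bw (Zero # \<sigma>) (insert z S) = Xf z S * bw \<sigma> S
    + (\<Sum>i\<in>S. X z * f i z * Xf i (S-{i}) * bw \<sigma> (insert z (S-{i})))"
proof -
  have "Xf i (insert z S-{i}) = X z * f i z * Xf i (S-{i})"
    "insert z S - {i} = insert z (S-{i})" if "i \<in> S" for i
    using assms that by (auto simp: insert_Diff_if)
  then show ?thesis using assms by simp
qed

text \<open>\<open>z\<close> can be either member of the ordered pair, which doubles
  \<open>h / 2\<close> to \<open>h\<close> in the first sum.\<close>

lemma bw_DDn_insert:
  assumes "finite S" "z \<notin> S"
  shows "bw (DDn # \<sigma>) (insert z S) = h * (\<Sum>i\<in>S. Xff i z (S-{i}) * bw \<sigma> (S-{i}))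
    + h / 2 * (\<Sum>i\<in>S. \<Sum>j\<in>S-{i}. X z * f i z * f j z * Xff i j (S-{i}-{j})
         * bw \<sigma> (insert z (S-{i}-{j})))"
proof -
  define u where "u i j = Xff i j (insert z S-{i}-{j}) * bw \<sigma> (insert z S-{i}-{j})" for i j
  have zi: "u z i = Xff i z (S-{i}) * bw \<sigma> (S-{i})"
    "u i z = Xff i z (S-{i}) * bw \<sigma> (S-{i})" if "i \<in> S" for i
  proof -
    have "insert z S - {z} - {i} = S - {i}" "insert z S - {i} - {z} = S - {i}" using assms by auto
    then show "u z i = Xff i z (S-{i}) * bw \<sigma> (S-{i})"
    "u i z = Xff i z (S-{i}) * bw \<sigma> (S-{i})"
      unfolding u_def by (auto simp: ac_simps)
  qed
  have ij: "u i j = X z * f i z * f j z * Xff i j (S-{i}-{j}) * bw \<sigma> (insert z (S-{i}-{j}))"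
    if "i \<in> S" "j \<in> S - {i}" for i j
  proof -
    have "insert z S - {i} - {j} = insert z (S-{i}-{j})" using assms that by auto
    then show ?thesis using assms by (simp add: u_def)
  qed
  have "bw (DDn # \<sigma>) (insert z S) = h / 2 * (\<Sum>i\<in>insert z S. \<Sum>j\<in>insert z S-{i}. u i j)"
    by (simp add: u_def)
  also have "\<dots> = h / 2 * ((\<Sum>i\<in>S. u z i + u i z) + (\<Sum>i\<in>S. \<Sum>j\<in>S-{i}. u i j))"
    by (subst sum_pairs_insert[OF assms]) simp
  also have "(\<Sum>i\<in>S. u z i + u i z) = 2 * (\<Sum>i\<in>S. Xff i z (S-{i}) * bw \<sigma> (S-{i}))"
    unfolding sum_distrib_left by (intro sum.cong refl) (simp only: zi, simp)
  also have "(\<Sum>i\<in>S. \<Sum>j\<in>S-{i}. u i j) = (\<Sum>i\<in>S. \<Sum>j\<in>S-{i}. X z * f i z * f j z * Xff i j (S-{i}-{j})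
         * bw \<sigma> (insert z (S-{i}-{j})))"
    by (intro sum.cong refl ij)
  finally show ?thesis by (simp add: distrib_left)
qed

end

context bethe begin

lemma rowop_wt:
  "rowop (wt z) \<gamma> (UUp # \<sigma>) Dn R = X z * rowop (wt z) \<gamma> \<sigma> Dn (\<lambda>\<rho>. R (UUp # \<rho>))"
  "rowop (wt z) \<gamma> (Zero # \<sigma>) Dn R = d z * rowop (wt z) \<gamma> \<sigma> Dn (\<lambda>\<rho>. R (Zero # \<rho>))
     + rowop (wt z) \<gamma> \<sigma> Up (\<lambda>\<rho>. R (UUp # \<rho>))"
  "rowop (wt z) \<gamma> (DDn # \<sigma>) Dn R = e z * rowop (wt z) \<gamma> \<sigma> Dn (\<lambda>\<rho>. R (DDn # \<rho>))
     + h * rowop (wt z) \<gamma> \<sigma> Up (\<lambda>\<rho>. R (Zero # \<rho>))"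
  "rowop (wt z) \<gamma> (UUp # \<sigma>) Up R = rowop (wt z) \<gamma> \<sigma> Up (\<lambda>\<rho>. R (UUp # \<rho>))
     + r1 z * rowop (wt z) \<gamma> \<sigma> Dn (\<lambda>\<rho>. R (Zero # \<rho>))"
  "rowop (wt z) \<gamma> (Zero # \<sigma>) Up R = m z * rowop (wt z) \<gamma> \<sigma> Up (\<lambda>\<rho>. R (Zero # \<rho>))
     + r2 z * rowop (wt z) \<gamma> \<sigma> Dn (\<lambda>\<rho>. R (DDn # \<rho>))"
  "rowop (wt z) \<gamma> (DDn # \<sigma>) Up R = x' z * rowop (wt z) \<gamma> \<sigma> Up (\<lambda>\<rho>. R (DDn # \<rho>))"
  by (simp_all add: sum_spin_half sum_spin_one wts_def)

text \<open>This is the exchange relation of the algebraic Bethe ansatz: a line entering and leaving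
  with \<open>Up\<close> either keeps its rapidity \<open>z\<close> (wanted term) or trades it for
  that of a row \<open>i\<close> (unwanted terms).\<close>

abbreviation A_bw :: "'b \<Rightarrow> spin_one list \<Rightarrow> 'b set \<Rightarrow> 'a" where
  "A_bw z \<sigma> S \<equiv> fs z S * bw \<sigma> S
     + (\<Sum>i\<in>S. g z i * fs i (S-{i}) * bw \<sigma> (insert z (S-{i})))"

text \<open>The two claims need each other, since an off-diagonal vertex at the head turns one
  auxiliary state into the other. For each head state the coefficients of \<open>bw \<sigma>\<close>
  on smaller sets are compared, which reduces to the assumptions of the locale.\<close>

lemma rowop_bw:
  assumes "finite S" "z \<notin> S"
  shows "rowop (wt z) Up \<sigma> Dn (\<lambda>\<rho>. bw \<rho> S) = bw \<sigma> (insert z S) \<and>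
    rowop (wt z) Up \<sigma> Up (\<lambda>\<rho>. bw \<rho> S) = A_bw z \<sigma> S"
  using assms
proof (induction \<sigma> arbitrary: S)
  case Nil
  then show ?case by simp
next
  case (Cons x \<sigma>)
  note fin = Cons.prems(1) and zS = Cons.prems(2)
  have IHB: "rowop (wt z) Up \<sigma> Dn (\<lambda>\<rho>. bw \<rho> T) = bw \<sigma> (insert z T)" if "T \<subseteq> S" for T
    using Cons.IH[of T] that fin zS finite_subset by blast
  have IHA: "rowop (wt z) Up \<sigma> Up (\<lambda>\<rho>. bw \<rho> T) = A_bw z \<sigma> T" if "T \<subseteq> S" for T
    using Cons.IH[of T] that fin zS finite_subset by blast
  have zne: "z \<noteq> i" if "i \<in> S" for i using zS that by auto
  have rUp: "rowop (wt z) Up \<sigma> \<alpha> (\<lambda>\<rho>. bw (UUp # \<rho>) S) = Xs S * rowop (wt z) Up \<sigma> \<alpha> (\<lambda>\<rho>. bw \<rho> S)" for \<alpha>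
    by (simp add: rowop_cmult)
  have rZero: "rowop (wt z) Up \<sigma> \<alpha> (\<lambda>\<rho>. bw (Zero # \<rho>) S)
      = (\<Sum>i\<in>S. Xf i (S-{i}) * rowop (wt z) Up \<sigma> \<alpha> (\<lambda>\<rho>. bw \<rho> (S-{i})))" for \<alpha>
    by (simp add: rowop_sum[OF fin] rowop_cmult)
  have rDDn: "rowop (wt z) Up \<sigma> \<alpha> (\<lambda>\<rho>. bw (DDn # \<rho>) S)
      = h / 2 * (\<Sum>i\<in>S. \<Sum>j\<in>S-{i}. Xff i j (S-{i}-{j}) * rowop (wt z) Up \<sigma> \<alpha> (\<lambda>\<rho>. bw \<rho> (S-{i}-{j})))" for \<alpha>
    unfolding bw.simps spin_one.case rowop_cmult
    using fin by (simp add: rowop_sum rowop_cmult)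
  have XS: "Xs S = X i * Xs (S-{i})" if "i \<in> S" for i
    using fin that by (simp add: prod.remove)
  have B: "rowop (wt z) Up (x # \<sigma>) Dn (\<lambda>\<rho>. bw \<rho> S) = bw (x # \<sigma>) (insert z S)"
    proof (cases x)
      case UUp
      then show ?thesis
        unfolding UUp rowop_wt rUp using fin zS by (simp add: rowop_cmult IHB mult.assoc)
    next
      case Zero
      have *: "d z * Xf i (S-{i}) + Xs S * (g z i * fs i (S-{i}))
        = X z * f i z * Xf i (S-{i})" if "i \<in> S" for i
        unfolding XS[OF that] prod.distrib B_Zero[OF zne[OF that], symmetric] by (simp add: algebra_simps)
      have "rowop (wt z) Up (x # \<sigma>) Dn (\<lambda>\<rho>. bw \<rho> S)
        = d z * (\<Sum>i\<in>S. Xf i (S-{i}) * bw \<sigma> (insert z (S-{i}))) + Xs S * A_bw z \<sigma> S"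
        unfolding Zero rowop_wt rUp rZero by (simp add: IHB IHA)
      also have "\<dots> = Xf z S * bw \<sigma> S
        + (\<Sum>i\<in>S. (d z * Xf i (S-{i}) + Xs S * (g z i * fs i (S-{i}))) * bw \<sigma> (insert z (S-{i})))"
        by (simp add: sum.distrib sum_distrib_left distrib_right distrib_left prod.distrib mult.assoc)
      also have "\<dots> = bw (x # \<sigma>) (insert z S)"
        unfolding Zero bw_Zero_insert[OF fin zS] by (intro arg_cong2[of _ _ _ _ "(+)"] refl sum.cong) (simp only: *)
      finally show ?thesis .
    next
      case DDn
      have "rowop (wt z) Up (x # \<sigma>) Dn (\<lambda>\<rho>. bw \<rho> S)
        = e z * (h / 2 * (\<Sum>i\<in>S. \<Sum>j\<in>S-{i}. Xff i j (S-{i}-{j}) * bw \<sigma> (insert z (S-{i}-{j}))))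
          + h * (\<Sum>i\<in>S. Xf i (S-{i}) * A_bw z \<sigma> (S-{i}))"
        unfolding DDn rowop_wt rDDn rZero
        by (intro arg_cong2[of _ _ _ _ "(+)"] arg_cong2[of _ _ _ _ "(*)"] refl sum.cong) 
           (subst IHB IHA, use zS in blast, simp?)+
      \<comment> \<open>The wanted terms of \<open>A_bw\<close> supply the pairs that contain
        \<open>z\<close>. The unwanted ones must combine with the \<open>e\<close> term into the
        pairs that avoid \<open>z\<close>, which happens only after symmetrisation.\<close>
      also have "\<dots> = h * (\<Sum>i\<in>S. Xff i z (S-{i}) * bw \<sigma> (S-{i}))
          + (\<Sum>i\<in>S. \<Sum>j\<in>S-{i}. h / 2 * (e z * Xff i j (S-{i}-{j})
            + 2 * Xf i (S-{i}) * g z j * fs j (S-{i}-{j})) * bw \<sigma> (insert z (S-{i}-{j})))"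
        by (simp add: sum.distrib sum_distrib_left distrib_right distrib_left prod.distrib ac_simps)
      also have "(\<Sum>i\<in>S. \<Sum>j\<in>S-{i}. h / 2 * (e z * Xff i j (S-{i}-{j})
            + 2 * Xf i (S-{i}) * g z j * fs j (S-{i}-{j})) * bw \<sigma> (insert z (S-{i}-{j})))
        = (\<Sum>i\<in>S. \<Sum>j\<in>S-{i}. h / 2 * (X z * f i z * f j z * Xff i j (S-{i}-{j})) * bw \<sigma> (insert z (S-{i}-{j})))"
      proof (rule sum_pairs_eqI[OF fin])
        fix i j assume ij: "i \<in> S" "j \<in> S" "i \<noteq> j"
        define T where "T = S - {i} - {j}"
        have T: "finite T" "i \<notin> T" "j \<notin> T" "S - {i} = insert j T" "S - {j} = insert i T" "S - {j} - {i} = T" "S - {i} - {j} = T"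
          using fin ij by (auto simp: T_def)
        have eq: "h * (X j * f i j * g z j + X i * f j i * g z i + e z) = h * (X z * f i z * f j z)"
          using B_DDn[of z i j] ij zne by auto
        show "h / 2 * (e z * Xff i j (S-{i}-{j})
            + 2 * Xf i (S-{i}) * g z j * fs j (S-{i}-{j})) * bw \<sigma> (insert z (S-{i}-{j}))
          + h / 2 * (e z * Xff j i (S-{j}-{i})
            + 2 * Xf j (S-{j}) * g z i * fs i (S-{j}-{i})) * bw \<sigma> (insert z (S-{j}-{i}))
          = h / 2 * (X z * f i z * f j z * Xff i j (S-{i}-{j})) * bw \<sigma> (insert z (S-{i}-{j}))
          + h / 2 * (X z * f j z * f i z * Xff j i (S-{j}-{i})) * bw \<sigma> (insert z (S-{j}-{i}))" (is "?l = ?r")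
        proof -
          \<comment> \<open>All rapidities other than \<open>z\<close>, \<open>i\<close>,
            \<open>j\<close> enter through this common factor; what is left is
            \<open>B_DDn\<close>.\<close>
          define Q where "Q = Xs T * fs i T * fs j T * bw \<sigma> (insert z T)"
          have "?l = h * (X j * f i j * g z j + X i * f j i * g z i + e z) * Q"
            unfolding T(4-7) using T(1-3) by (simp add: Q_def prod.distrib field_simps)
          also have "\<dots> = ?r"
            unfolding eq T(4-7) using T(1-3) by (simp add: Q_def prod.distrib field_simps)
          finally show ?thesis .
        qed
      qed
      also have "h * (\<Sum>i\<in>S. Xff i z (S-{i}) * bw \<sigma> (S-{i})) + \<dots> = bw (x # \<sigma>) (insert z S)"
        unfolding DDn bw_DDn_insert[OF fin zS] by (simp add: sum_distrib_left mult.assoc)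
      finally show ?thesis .
    qed
  have A: "rowop (wt z) Up (x # \<sigma>) Up (\<lambda>\<rho>. bw \<rho> S) = A_bw z (x # \<sigma>) S"
    proof (cases x)
      case UUp
      have *: "Xs S * (g z i * fs i (S-{i})) + r1 z * Xf i (S-{i})
        = g z i * fs i (S-{i}) * (X z * Xs (S-{i}))" if "i \<in> S" for i
      proof -
        have "Xs S * (g z i * fs i (S-{i})) + r1 z * Xf i (S-{i})
          = (X i * g z i + r1 z) * (fs i (S-{i}) * Xs (S-{i}))"
          unfolding XS[OF that] prod.distrib by (simp add: algebra_simps)
        then show ?thesis using A_UUp[OF zne[OF that]] by (simp add: ac_simps)
      qed
      have "rowop (wt z) Up (x # \<sigma>) Up (\<lambda>\<rho>. bw \<rho> S)
        = Xs S * A_bw z \<sigma> S + r1 z * (\<Sum>i\<in>S. Xf i (S-{i}) * bw \<sigma> (insert z (S-{i})))"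
        unfolding UUp rowop_wt rUp rZero by (simp add: IHB IHA)
      also have "\<dots> = fs z S * bw (x # \<sigma>) S
        + (\<Sum>i\<in>S. (Xs S * (g z i * fs i (S-{i})) + r1 z * Xf i (S-{i})) * bw \<sigma> (insert z (S-{i})))"
        by (simp add: UUp sum.distrib sum_distrib_left distrib_right distrib_left mult.assoc mult.left_commute)
      also have "\<dots> = A_bw z (x # \<sigma>) S"
      proof (intro arg_cong2[of _ _ _ _ "(+)"] refl sum.cong)
        fix i assume "i \<in> S"
        then show "(Xs S * (g z i * fs i (S-{i})) + r1 z * Xf i (S-{i})) * bw \<sigma> (insert z (S-{i}))
          = g z i * fs i (S-{i}) * bw (x # \<sigma>) (insert z (S-{i}))"
          using fin zS by (simp add: UUp * mult.assoc)
      qed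
      finally show ?thesis .
    next
      case Zero
      define B where "B i j = bw \<sigma> (insert z (S-{i}-{j}))" for i j
      have "rowop (wt z) Up (x # \<sigma>) Up (\<lambda>\<rho>. bw \<rho> S)
        = m z * (\<Sum>i\<in>S. Xf i (S-{i}) * A_bw z \<sigma> (S-{i}))
          + r2 z * (h / 2 * (\<Sum>i\<in>S. \<Sum>j\<in>S-{i}. Xff i j (S-{i}-{j}) * bw \<sigma> (insert z (S-{i}-{j}))))"
        unfolding Zero rowop_wt rDDn rZero
        by (intro arg_cong2[of _ _ _ _ "(+)"] arg_cong2[of _ _ _ _ "(*)"] refl sum.cong)
           (subst IHB IHA, use zS in blast, simp?)+
      also have "\<dots> = (\<Sum>i\<in>S. m z * Xf i (S-{i}) * fs z (S-{i}) * bw \<sigma> (S-{i}))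
          + (\<Sum>i\<in>S. \<Sum>j\<in>S-{i}. (m z * Xf i (S-{i}) * g z j * fs j (S-{i}-{j})
            + r2 z * h / 2 * Xff i j (S-{i}-{j})) * B i j)"
        by (simp add: B_def sum.distrib sum_distrib_left distrib_right distrib_left prod.distrib ac_simps)
      also have "(\<Sum>i\<in>S. \<Sum>j\<in>S-{i}. (m z * Xf i (S-{i}) * g z j * fs j (S-{i}-{j})
            + r2 z * h / 2 * Xff i j (S-{i}-{j})) * B i j)
        = (\<Sum>i\<in>S. \<Sum>j\<in>S-{i}. g z i * fs i (S-{i}) * (X z * f j z * Xf j (S-{i}-{j})) * B i j)"
      proof (rule sum_pairs_eqI[OF fin])
        fix i j assume ij: "i \<in> S" "j \<in> S" "i \<noteq> j"
        define T where "T = S - {i} - {j}"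
        have T: "finite T" "i \<notin> T" "j \<notin> T" "S - {i} = insert j T" "S - {j} = insert i T" "S - {j} - {i} = T" "S - {i} - {j} = T"
          using fin ij by (auto simp: T_def)
        have B: "B j i = B i j" by (simp add: B_def T)
        have eq: "m z * (X j * f i j * g z j + X i * f j i * g z i) + r2 z * h
            = X z * (g z i * f i j * f j z + g z j * f j i * f i z)"
          using A_Zero2[of z i j] ij zne by auto
        define Q where "Q = Xs T * fs i T * fs j T * B i j"
        have "(m z * Xf i (S-{i}) * g z j * fs j (S-{i}-{j})
            + r2 z * h / 2 * Xff i j (S-{i}-{j})) * B i j
          + (m z * Xf j (S-{j}) * g z i * fs i (S-{j}-{i})
            + r2 z * h / 2 * Xff j i (S-{j}-{i})) * B j i
          = (m z * (X j * f i j * g z j + X i * f j i * g z i) + r2 z * h) * Q"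
          unfolding T(4-7) B using T(1-3) by (simp add: Q_def prod.distrib field_simps)
        also have "\<dots> = g z i * fs i (S-{i}) * (X z * f j z * Xf j (S-{i}-{j})) * B i j
          + g z j * fs j (S-{j}) * (X z * f i z * Xf i (S-{j}-{i})) * B j i"
          unfolding eq T(4-7) B using T(1-3) by (simp add: Q_def prod.distrib field_simps)
        finally show "(m z * Xf i (S-{i}) * g z j * fs j (S-{i}-{j})
            + r2 z * h / 2 * Xff i j (S-{i}-{j})) * B i j
          + (m z * Xf j (S-{j}) * g z i * fs i (S-{j}-{i})
            + r2 z * h / 2 * Xff j i (S-{j}-{i})) * B j i
          = g z i * fs i (S-{i}) * (X z * f j z * Xf j (S-{i}-{j})) * B i j
          + g z j * fs j (S-{j}) * (X z * f i z * Xf i (S-{j}-{i})) * B j i" .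
      qed
      \<comment> \<open>The splitting \<open>m z = f z i + g z i\<close> completes
        \<open>fs z S\<close> for the wanted term with its first part; the second part is the term
        of the unwanted ones in which \<open>z\<close> itself is peeled.\<close>
      also have "(\<Sum>i\<in>S. m z * Xf i (S-{i}) * fs z (S-{i}) * bw \<sigma> (S-{i}))
        = fs z S * bw (x # \<sigma>) S
         + (\<Sum>i\<in>S. g z i * fs i (S-{i}) * (Xf z (S-{i}) * bw \<sigma> (S-{i})))"
      proof -
        have "m z * Xf i (S-{i}) * fs z (S-{i}) * bw \<sigma> (S-{i})
          = fs z S * (Xf i (S-{i}) * bw \<sigma> (S-{i}))
           + g z i * fs i (S-{i}) * (Xf z (S-{i}) * bw \<sigma> (S-{i}))" if "i \<in> S" for i
          unfolding A_Zero1[OF zne[OF that]] prod.remove[OF fin that, of "f z"] prod.distrib by (simp add: algebra_simps)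
        then show ?thesis by (simp add: Zero sum.distrib sum_distrib_left)
      qed
      also have "\<dots> + (\<Sum>i\<in>S. \<Sum>j\<in>S-{i}. g z i * fs i (S-{i}) * (X z * f j z * Xf j (S-{i}-{j})) * B i j)
        = fs z S * bw (x # \<sigma>) S
         + (\<Sum>i\<in>S. g z i * fs i (S-{i}) * (Xf z (S-{i}) * bw \<sigma> (S-{i})
             + (\<Sum>j\<in>S-{i}. X z * f j z * Xf j (S-{i}-{j}) * B i j)))"
        by (simp add: sum.distrib sum_distrib_left distrib_left mult.assoc)
      also have "\<dots> = A_bw z (x # \<sigma>) S"
      proof (intro arg_cong2[of _ _ _ _ "(+)"] refl sum.cong)
        fix i assume "i \<in> S"
        show "g z i * fs i (S-{i}) * (Xf z (S-{i}) * bw \<sigma> (S-{i})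
             + (\<Sum>j\<in>S-{i}. X z * f j z * Xf j (S-{i}-{j}) * B i j))
          = g z i * fs i (S-{i}) * bw (x # \<sigma>) (insert z (S-{i}))"
          unfolding Zero using fin zS by (subst bw_Zero_insert) (simp_all add: B_def)
      qed
      finally show ?thesis .
    next
      case DDn
      define B where "B i j l = bw \<sigma> (insert z (S-{i}-{j}-{l}))" for i j l
      have "rowop (wt z) Up (x # \<sigma>) Up (\<lambda>\<rho>. bw \<rho> S)
        = x' z * (h / 2 * (\<Sum>i\<in>S. \<Sum>j\<in>S-{i}. Xff i j (S-{i}-{j}) * A_bw z \<sigma> (S-{i}-{j})))"
        unfolding DDn rowop_wt rDDn
        by (intro arg_cong2[of _ _ _ _ "(+)"] arg_cong2[of _ _ _ _ "(*)"] refl sum.cong)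
           (subst IHB IHA, use zS in blast, simp?)+
      also have "\<dots> = (\<Sum>i\<in>S. \<Sum>j\<in>S-{i}. h * x' z / 2 * Xff i j (S-{i}-{j}) * fs z (S-{i}-{j}) * bw \<sigma> (S-{i}-{j}))
          + (\<Sum>i\<in>S. \<Sum>j\<in>S-{i}. \<Sum>l\<in>S-{i}-{j}. h * x' z / 2 * Xff i j (S-{i}-{j}) * g z l * fs l (S-{i}-{j}-{l}) * B i j l)"
        by (simp add: B_def sum.distrib sum_distrib_left distrib_right distrib_left ac_simps)
      \<comment> \<open>On the left \<open>i\<close>, \<open>j\<close> are peeled and then
        \<open>l\<close> is exchanged with \<open>z\<close>, on the right \<open>l\<close> is
        exchanged first. \<open>A_DDn2\<close> equates only the sums over all six orders.\<close>
      also have "(\<Sum>i\<in>S. \<Sum>j\<in>S-{i}. \<Sum>l\<in>S-{i}-{j}. h * x' z / 2 * Xff i j (S-{i}-{j}) * g z l * fs l (S-{i}-{j}-{l}) * B i j l)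
        = (\<Sum>l\<in>S. \<Sum>i\<in>S-{l}. \<Sum>j\<in>S-{l}-{i}. g z l * fs l (S-{l}) * (h / 2 * (X z * f i z * f j z * Xff i j (S-{l}-{i}-{j}) * B l i j)))"
      proof (rule sum_triples_eqI[OF fin])
        fix i j l assume ijl: "i \<in> S" "j \<in> S" "l \<in> S" "i \<noteq> j" "i \<noteq> l" "j \<noteq> l"
        define T where "T = S - {i} - {j} - {l}"
        have T: "finite T" "i \<notin> T" "j \<notin> T" "l \<notin> T"
          and T2: "S - {i} - {j} = insert l T" "S - {j} - {i} = insert l T" "S - {i} - {l} = insert j T" "S - {l} - {i} = insert j T"
            "S - {l} - {j} = insert i T" "S - {j} - {l} = insert i T"
            "insert i T - {i} = T" "insert j T - {j} = T" "insert l T - {l} = T"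
            "S - {i} = insert j (insert l T)" "S - {j} = insert i (insert l T)" "S - {l} = insert i (insert j T)"
          using fin ijl by (auto simp: T_def)
        have B: "B i l j = B i j l" "B j i l = B i j l" "B j l i = B i j l" "B l i j = B i j l" "B l j i = B i j l"
          unfolding B_def T2(1-9) by simp_all
        have eq: "h * x' z * (X l * f i l * f j l * g z l + X j * f i j * f l j * g z j + X i * f j i * f l i * g z i)
          = h * X z * (g z l * f l i * f l j * f i z * f j z + g z j * f j i * f j l * f i z * f l z
            + g z i * f i j * f i l * f j z * f l z)"
          using A_DDn2[of z i j l] ijl zne by auto
        define Q where "Q = Xs T * fs i T * fs j T * fs l T * B i j l"
        define u where "u i j l = h * x' z / 2 * Xff i j (S-{i}-{j}) * g z l * fs l (S-{i}-{j}-{l}) * B i j l" for i j l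
        define v where "v l i j = g z l * fs l (S-{l}) * (h / 2 * (X z * f i z * f j z * Xff i j (S-{l}-{i}-{j}) * B l i j))" for i j l
        have "u i j l + u i l j + u j i l + u j l i + u l i j + u l j i
          = h * x' z * (X l * f i l * f j l * g z l + X j * f i j * f l j * g z j + X i * f j i * f l i * g z i) * Q"
          unfolding u_def B T2(1-9) using T by (simp add: Q_def prod.distrib field_simps)
        also have "\<dots> = v i j l + v i l j + v j i l + v j l i + v l i j + v l j i"
          unfolding eq v_def B T2(1-9) unfolding T2 using T ijl by (simp add: Q_def prod.distrib field_simps)
        finally show "h * x' z / 2 * Xff i j (S-{i}-{j}) * g z l * fs l (S-{i}-{j}-{l}) * B i j l
          + h * x' z / 2 * Xff i l (S-{i}-{l}) * g z j * fs j (S-{i}-{l}-{j}) * B i l j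
          + h * x' z / 2 * Xff j i (S-{j}-{i}) * g z l * fs l (S-{j}-{i}-{l}) * B j i l
          + h * x' z / 2 * Xff j l (S-{j}-{l}) * g z i * fs i (S-{j}-{l}-{i}) * B j l i
          + h * x' z / 2 * Xff l i (S-{l}-{i}) * g z j * fs j (S-{l}-{i}-{j}) * B l i j
          + h * x' z / 2 * Xff l j (S-{l}-{j}) * g z i * fs i (S-{l}-{j}-{i}) * B l j i
          = g z i * fs i (S-{i}) * (h / 2 * (X z * f j z * f l z * Xff j l (S-{i}-{j}-{l}) * B i j l))
          + g z i * fs i (S-{i}) * (h / 2 * (X z * f l z * f j z * Xff l j (S-{i}-{l}-{j}) * B i l j))
          + g z j * fs j (S-{j}) * (h / 2 * (X z * f i z * f l z * Xff i l (S-{j}-{i}-{l}) * B j i l))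
          + g z j * fs j (S-{j}) * (h / 2 * (X z * f l z * f i z * Xff l i (S-{j}-{l}-{i}) * B j l i))
          + g z l * fs l (S-{l}) * (h / 2 * (X z * f i z * f j z * Xff i j (S-{l}-{i}-{j}) * B l i j))
          + g z l * fs l (S-{l}) * (h / 2 * (X z * f j z * f i z * Xff j i (S-{l}-{j}-{i}) * B l j i))"
          unfolding u_def v_def .
      qed
      \<comment> \<open>\<open>A_DDn1\<close> splits \<open>x' z\<close>: the term
        \<open>f z i * f z j\<close> gives the wanted part, the two terms with \<open>g\<close> give
        the unwanted parts in which the peeled pair contains \<open>z\<close>.\<close>
      also have "(\<Sum>i\<in>S. \<Sum>j\<in>S-{i}. h * x' z / 2 * Xff i j (S-{i}-{j}) * fs z (S-{i}-{j}) * bw \<sigma> (S-{i}-{j}))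
        = (\<Sum>i\<in>S. \<Sum>j\<in>S-{i}. fs z S * (h / 2 * (Xff i j (S-{i}-{j}) * bw \<sigma> (S-{i}-{j})))
          + g z i * fs i (S-{i}) * (h * (Xff j z (S-{i}-{j}) * bw \<sigma> (S-{i}-{j}))))"
      proof (rule sum_pairs_eqI[OF fin])
        fix i j assume ij: "i \<in> S" "j \<in> S" "i \<noteq> j"
        define T where "T = S - {i} - {j}"
        have T: "finite T" "i \<notin> T" "j \<notin> T" "S - {i} = insert j T" "S - {j} = insert i T" "S - {j} - {i} = T" "S - {i} - {j} = T"
          using fin ij by (auto simp: T_def)
        have S: "S = insert i (insert j T)" using ij by (auto simp: T_def)
        have eq: "h * x' z = h * (f z i * f z j + g z i * f i j + g z j * f j i)"
          using A_DDn1[of z i j] ij zne by auto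
        define Q where "Q = Xs T * fs i T * fs j T * fs z T * bw \<sigma> T"
        have fS: "fs z S = f z i * f z j * fs z T"
          using T(1-3) ij(3) by (simp add: S)
        show "h * x' z / 2 * Xff i j (S-{i}-{j}) * fs z (S-{i}-{j}) * bw \<sigma> (S-{i}-{j})
          + h * x' z / 2 * Xff j i (S-{j}-{i}) * fs z (S-{j}-{i}) * bw \<sigma> (S-{j}-{i})
          = fs z S * (h / 2 * (Xff i j (S-{i}-{j}) * bw \<sigma> (S-{i}-{j})))
          + g z i * fs i (S-{i}) * (h * (Xff j z (S-{i}-{j}) * bw \<sigma> (S-{i}-{j})))
          + (fs z S * (h / 2 * (Xff j i (S-{j}-{i}) * bw \<sigma> (S-{j}-{i})))
          + g z j * fs j (S-{j}) * (h * (Xff i z (S-{j}-{i}) * bw \<sigma> (S-{j}-{i}))))" (is "?l = ?r")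
        proof -
          have "?l = h * x' z * Q"
            unfolding T(4-7) using T(1-3) by (simp add: Q_def prod.distrib field_simps)
          also have "\<dots> = ?r"
            unfolding eq fS T(4-7) using T(1-3) by (simp add: Q_def prod.distrib field_simps)
          finally show ?thesis .
        qed
      qed
      also have "\<dots> + (\<Sum>l\<in>S. \<Sum>i\<in>S-{l}. \<Sum>j\<in>S-{l}-{i}. g z l * fs l (S-{l}) * (h / 2 * (X z * f i z * f j z * Xff i j (S-{l}-{i}-{j}) * B l i j)))
        = fs z S * bw (x # \<sigma>) S
         + (\<Sum>l\<in>S. g z l * fs l (S-{l}) * (h * (\<Sum>i\<in>S-{l}. Xff i z (S-{l}-{i}) * bw \<sigma> (S-{l}-{i}))
             + h / 2 * (\<Sum>i\<in>S-{l}. \<Sum>j\<in>S-{l}-{i}. X z * f i z * f j z * Xff i j (S-{l}-{i}-{j}) * B l i j)))"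
        by (simp add: DDn sum.distrib sum_distrib_left distrib_left)
      also have "\<dots> = A_bw z (x # \<sigma>) S"
      proof (intro arg_cong2[of _ _ _ _ "(+)"] refl sum.cong)
        fix l assume "l \<in> S"
        show "g z l * fs l (S-{l}) * (h * (\<Sum>i\<in>S-{l}. Xff i z (S-{l}-{i}) * bw \<sigma> (S-{l}-{i}))
             + h / 2 * (\<Sum>i\<in>S-{l}. \<Sum>j\<in>S-{l}-{i}. X z * f i z * f j z * Xff i j (S-{l}-{i}-{j}) * B l i j))
          = g z l * fs l (S-{l}) * bw (x # \<sigma>) (insert z (S-{l}))"
          unfolding DDn using fin zS by (subst bw_DDn_insert) (simp_all add: B_def)
      qed
      finally show ?thesis .
    qed
  from B A show ?case ..
qed

lemma bw_empty: "bw \<sigma> {} = (if \<sigma> = replicate (length \<sigma>) UUp then 1 else 0)"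
  by (induction \<sigma>) (auto split: spin_one.splits)

text \<open>Each step of \<open>rowop_bw\<close> needs a rapidity that is not yet present, so the
  list must be distinct; equal rapidities are reached only as limits.\<close>

lemma bw_rows:
  "distinct us \<Longrightarrow> foldr (\<lambda>u R \<sigma>. rowop (wt u) Up \<sigma> Dn R) us (\<lambda>\<sigma>. bw \<sigma> {}) = (\<lambda>\<sigma>. bw \<sigma> (set us))"
proof (induction us)
  case (Cons u us)
  then show ?case using rowop_bw[of "set us" u] by simp
qed simp

end

subsection \<open>Determinants of complete homogeneous polynomials\<close>

definition hs :: "nat \<Rightarrow> 'a::comm_ring_1 \<Rightarrow> 'a \<Rightarrow> 'a" where
  "hs j x y = (\<Sum>k\<le>j. x ^ k * y ^ (j - k))"

lemma hs_diff: "(x - y) * hs j x y = x ^ Suc j - y ^ Suc j"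
  unfolding hs_def lessThan_Suc_atMost[symmetric] power_diff_sumr2[of x "Suc j" y]
  by (intro arg_cong[of _ _ "(*) (x - y)"] sum.cong) (auto simp: mult.commute)

lemma hs_0 [simp]: "hs 0 x y = 1" and hs_1 [simp]: "hs (Suc 0) x y = x + y"
  by (simp_all add: hs_def)

lemma hs_Suc: "hs (Suc j) x y = x * hs j x y + y ^ Suc j"
  unfolding hs_def by (subst sum.atMost_Suc_shift) (simp add: sum_distrib_left mult.assoc)

lemma hs_Suc_Suc: "hs (Suc (Suc j)) x y = (x + y) * hs (Suc j) x y - x * y * hs j x y"
  by (simp add: hs_Suc algebra_simps)

definition alt :: "'b list \<Rightarrow> (nat \<Rightarrow> 'b \<Rightarrow> 'a::comm_ring_1) \<Rightarrow> 'a" where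
  "alt xs F = det (mat (length xs) (length xs) (\<lambda>(i, j). F j (xs ! i)))"

definition del :: "nat \<Rightarrow> 'b list \<Rightarrow> 'b list" where
  "del i xs = take i xs @ drop (Suc i) xs"

lemma length_del: "i < length xs \<Longrightarrow> length (del i xs) = length xs - 1"
  by (simp add: del_def)

lemma set_del: "distinct xs \<Longrightarrow> i < length xs \<Longrightarrow> set (del i xs) = set xs - {xs ! i}"
proof -
  assume *: "distinct xs" "i < length xs"
  then have "xs = take i xs @ xs ! i # drop (Suc i) xs" by (intro id_take_nth_drop)
  then have "set xs = insert (xs ! i) (set (del i xs))" "xs ! i \<notin> set (del i xs)"
    using *(1) unfolding del_def by (metis list.simps(15) set_append Un_insert_right,
      metis distinct.simps(2) distinct_append disjoint_insert(1) list.simps(15) Un_iff set_append)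
  then show ?thesis by auto
qed

lemma nth_del: "j < length xs - 1 \<Longrightarrow> i < length xs \<Longrightarrow> del i xs ! j = xs ! (if j < i then j else Suc j)"
  by (auto simp: del_def nth_append min_def)

lemma distinct_del: "distinct xs \<Longrightarrow> distinct (del i xs)"
  unfolding del_def by (auto dest: in_set_takeD in_set_dropD simp: set_take_disj_set_drop_if_distinct)

text \<open>The column \<open>v\<close> equals \<open>c n\<close> times the last column plus a
  combination of the others, so putting it in place of the last column multiplies the determinant by
  \<open>c n\<close>. The right-hand side is the expansion along that column.\<close>

lemma alt_expand:
  fixes F :: "nat \<Rightarrow> 'b \<Rightarrow> 'a::comm_ring_1"
  assumes len: "length xs = Suc n"
    and v: "\<And>i. i \<le> n \<Longrightarrow> v i = (\<Sum>j\<le>n. c j * F j (xs ! i))"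
  shows "c n * alt xs F = (\<Sum>i\<le>n. v i * (- 1) ^ (i + n) * alt (del i xs) F)"
proof -
  define A where "A = mat (Suc n) (Suc n) (\<lambda>(i, j). F j (xs ! i))"
  have A: "A \<in> carrier_mat (Suc n) (Suc n)" by (simp add: A_def)
  have col: "(\<Sum>i\<le>n. cofactor A i n * A $$ (i, j)) = (if j = n then det A else 0)" if "j \<le> n" for j
  proof -
    have "(\<Sum>i\<le>n. cofactor A i n * A $$ (i, j)) = (adj_mat A * A) $$ (n, j)"
      using A that unfolding adj_mat_def
      by (auto simp: scalar_prod_def A_def lessThan_Suc_atMost[symmetric] atLeast0LessThan intro!: sum.cong)
    also have "\<dots> = (if j = n then det A else 0)"
      using adj_mat(3)[OF A] that by simp
    finally show ?thesis .
  qed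
  have cof: "cofactor A i n = (- 1) ^ (i + n) * alt (del i xs) F" if "i \<le> n" for i
  proof -
    have "mat_delete A i n = mat n n (\<lambda>(i', j). F j (del i xs ! i'))"
      unfolding mat_delete_def A_def using that len by (auto simp: nth_del intro!: eq_matI)
    then show ?thesis using that len by (simp add: cofactor_def alt_def length_del)
  qed
  have "c n * alt xs F = (\<Sum>j\<le>n. c j * (if j = n then det A else 0))"
    unfolding A_def alt_def len by (simp add: if_distrib[of "\<lambda>t. _ * t"] cong: if_cong)
  also have "\<dots> = (\<Sum>j\<le>n. c j * (\<Sum>i\<le>n. cofactor A i n * A $$ (i, j)))"
    by (intro sum.cong refl) (simp add: col)
  also have "\<dots> = (\<Sum>i\<le>n. (\<Sum>j\<le>n. c j * A $$ (i, j)) * cofactor A i n)"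
    unfolding sum_distrib_left sum_distrib_right by (subst sum.swap) (simp add: ac_simps)
  also have "\<dots> = (\<Sum>i\<le>n. v i * cofactor A i n)"
    using v by (intro sum.cong refl) (simp add: A_def)
  finally show ?thesis by (simp add: cof mult.assoc)
qed

lemma prod_linear_degree:
  fixes w :: "'b \<Rightarrow> 'a::field"
  assumes "finite S"
  shows "degree (\<Prod>k\<in>S. [:w k, c:]) \<le> card S" "coeff (\<Prod>k\<in>S. [:w k, c:]) (card S) = c ^ card S"
proof -
  have "degree (\<Prod>k\<in>S. [:w k, c:]) \<le> card S \<and> coeff (\<Prod>k\<in>S. [:w k, c:]) (card S) = c ^ card S"
    using assms
  proof (induction S rule: finite_induct)
    case (insert a S)
    have "degree ([:w a, c:] * (\<Prod>k\<in>S. [:w k, c:])) \<le> Suc (card S)"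
      using insert.IH by (intro order.trans[OF degree_mult_le]) (auto simp: le_Suc_eq)
    moreover have "coeff ([:w a, c:] * (\<Prod>k\<in>S. [:w k, c:])) (Suc (card S)) = c ^ Suc (card S)"
      using insert.IH by (simp add: coeff_eq_0)
    ultimately show ?case using insert by simp
  qed simp
  then show "degree (\<Prod>k\<in>S. [:w k, c:]) \<le> card S" "coeff (\<Prod>k\<in>S. [:w k, c:]) (card S) = c ^ card S"
    by auto
qed

lemma poly_sum_atMost:
  assumes "degree p \<le> n" shows "poly p (a :: 'a::comm_ring_1) = (\<Sum>j\<le>n. coeff p j * a ^ j)"
  unfolding poly_altdef using assms by (intro sum.mono_neutral_left) (auto simp: coeff_eq_0)

text \<open>The monic polynomial whose roots are the \<open>s k\<close> at all nodes but
  \<open>xs ! i\<close> is a column with a single non-zero entry.\<close>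

lemma alt_power_del:
  fixes s :: "'b \<Rightarrow> 'a::field"
  assumes "distinct xs" "length xs = Suc n" "i \<le> n"
  shows "alt xs (\<lambda>j k. s k ^ j) = (- 1) ^ (i + n) * (\<Prod>k\<in>set xs - {xs ! i}. s (xs ! i) - s k) * alt (del i xs) (\<lambda>j k. s k ^ j)"
proof -
  define S where "S = set xs - {xs ! i}"
  have S: "finite S" "card S = n" using assms by (auto simp: S_def distinct_card)
  define P where "P = (\<Prod>k\<in>S. [:- s k, 1:])"
  have P: "degree P \<le> n" "coeff P n = 1"
    using prod_linear_degree[OF S(1), of "\<lambda>k. - s k" 1] S(2) by (simp_all add: P_def)
  have val: "poly P t = (\<Prod>k\<in>S. t - s k)" for t
    by (simp add: P_def poly_prod)
  have zero: "poly P (s (xs ! i')) = 0" if "i' \<le> n" "i' \<noteq> i" for i'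
  proof -
    have "xs ! i' \<in> S" using that assms by (auto simp: S_def nth_eq_iff_index_eq)
    then show ?thesis unfolding val using S(1) by (intro prod_zero) auto
  qed
  have "coeff P n * alt xs (\<lambda>j k. s k ^ j)
      = (\<Sum>i'\<le>n. poly P (s (xs ! i')) * (- 1) ^ (i' + n) * alt (del i' xs) (\<lambda>j k. s k ^ j))"
    by (rule alt_expand[OF assms(2)]) (rule poly_sum_atMost[OF P(1)])
  also have "\<dots> = (\<Sum>i'\<le>n. if i' = i then poly P (s (xs ! i)) * (- 1) ^ (i + n) * alt (del i xs) (\<lambda>j k. s k ^ j) else 0)"
    using zero by (intro sum.cong) auto
  finally show ?thesis using P(2) assms(3) by (simp add: val S_def mult.commute)
qed

lemma alt_power_nonzero:
  fixes s :: "'b \<Rightarrow> 'a::field"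
  assumes "distinct xs" "inj_on s (set xs)"
  shows "alt xs (\<lambda>j k. s k ^ j) \<noteq> 0"
  using assms
proof (induction "length xs" arbitrary: xs)
  case 0
  then show ?case by (simp add: alt_def)
next
  case (Suc n)
  have "alt (del n xs) (\<lambda>j k. s k ^ j) \<noteq> 0"
    using Suc by (intro Suc.hyps(1)) (auto simp: length_del distinct_del set_del intro: inj_on_subset)
  moreover have "(\<Prod>k\<in>set xs - {xs ! n}. s (xs ! n) - s k) \<noteq> 0"
  proof (subst prod_zero_iff)
    have "xs ! n \<in> set xs" using Suc.hyps(2) by (metis lessI nth_mem)
    then show "\<not> (\<exists>k\<in>set xs - {xs ! n}. s (xs ! n) - s k = 0)"
      using Suc.prems(2) by (auto dest: inj_onD)
  qed auto
  ultimately show ?case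
    using alt_power_del[of xs n n s] Suc by simp
qed

theorem alternant_of_recursion:
  fixes s x y :: "'b \<Rightarrow> 'a::field" and r :: "'b set \<Rightarrow> 'a"
  assumes "distinct xs" "inj_on s (set xs)" "\<And>k. k \<in> set xs \<Longrightarrow> x k \<noteq> y k"
    and r0: "r {} = 1"
    and rec: "\<And>S. S \<subseteq> set xs \<Longrightarrow> S \<noteq> {} \<Longrightarrow>
       r S = (\<Sum>i\<in>S. (\<Prod>k\<in>S-{i}. (x k - y i) / (s k - s i)) * r (S - {i}))"
  shows "r (set xs) * alt xs (\<lambda>j k. s k ^ j) = alt xs (\<lambda>j k. hs j (x k) (y k))"
  using assms(1-3) rec
proof (induction "length xs" arbitrary: xs)
  case 0
  then show ?case by (simp add: alt_def r0)
next
  case (Suc n)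
  let ?pw = "\<lambda>j k. s k ^ j" and ?h = "\<lambda>j k. hs j (x k) (y k)"
  have len: "length xs = Suc n" using Suc by simp
  define S where "S = set xs"
  have S: "finite S" "card S = Suc n" using Suc by (auto simp: S_def distinct_card)
  have inS: "xs ! i \<in> S" if "i \<le> n" for i using that len by (simp add: S_def)
  \<comment> \<open>\<open>P\<close> vanishes at \<open>x i\<close> and has the value
    \<open>(x i - y i) * v i\<close> at \<open>y i\<close>, so \<open>v i\<close> is minus the
    divided difference of \<open>P\<close>. The divided differences of powers are the
    \<open>hs\<close>, which puts \<open>v\<close> into the span of the columns.\<close>
  define P where "P = (\<Prod>k\<in>S. [:x k, - 1:])"
  have P: "degree P \<le> Suc n" "coeff P (Suc n) = (- 1) ^ Suc n"
    using prod_linear_degree[OF S(1), of x "-1"] S(2) by (simp_all add: P_def)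
  define v where "v i = (\<Prod>k\<in>S-{xs!i}. x k - y (xs ! i))" for i
  have v: "v i = (\<Sum>j\<le>n. - coeff P (Suc j) * ?h j (xs ! i))" if "i \<le> n" for i
  proof -
    let ?a = "x (xs ! i)" and ?b = "y (xs ! i)"
    have "poly P ?a = 0" using inS[OF that] S(1) unfolding P_def poly_prod by (intro prod_zero) auto
    moreover have "poly P ?b = (?a - ?b) * v i"
      using inS[OF that] S(1) by (simp add: P_def poly_prod v_def prod.remove algebra_simps)
    ultimately have "(?a - ?b) * v i = - (poly P ?a - poly P ?b)" by (simp only: diff_0 minus_minus)
    also have "poly P ?a - poly P ?b = (\<Sum>j\<le>Suc n. coeff P j * (?a ^ j - ?b ^ j))"
      by (simp add: poly_sum_atMost[OF P(1)] sum_subtractf right_diff_distrib del: sum.atMost_Suc)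
    also have "\<dots> = (?a - ?b) * (\<Sum>j\<le>n. coeff P (Suc j) * ?h j (xs ! i))"
      by (subst sum.atMost_Suc_shift) (simp add: sum_distrib_left hs_diff[symmetric] mult.left_commute del: power_Suc)
    finally have "(?a - ?b) * v i = (?a - ?b) * (\<Sum>j\<le>n. - coeff P (Suc j) * ?h j (xs ! i))"
      by (simp add: sum_negf)
    then show ?thesis using Suc.prems(3)[of "xs ! i"] inS[OF that] unfolding S_def
      by (subst (asm) mult_cancel_left) auto
  qed
  have del: "alt xs ?pw * (v i * r (S - {xs ! i}) / (\<Prod>k\<in>S-{xs!i}. s (xs ! i) - s k))
      = v i * (- 1) ^ (i + n) * alt (del i xs) ?h" if "i \<le> n" for i
  proof -
    have sd: "set (del i xs) = S - {xs ! i}" using set_del[of xs i] Suc.prems(1) len that by (simp add: S_def)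
    have "r (set (del i xs)) * alt (del i xs) ?pw = alt (del i xs) ?h"
    proof (rule Suc.hyps(1))
      show "n = length (del i xs)" using len that by (simp add: length_del)
      show "distinct (del i xs)" using Suc.prems(1) by (rule distinct_del)
      show "inj_on s (set (del i xs))" using Suc.prems(2) by (rule inj_on_subset) (auto simp: sd S_def)
      show "x k \<noteq> y k" if "k \<in> set (del i xs)" for k
        using that by (intro Suc.prems(3)) (auto simp: sd S_def)
      show "r T = (\<Sum>i\<in>T. (\<Prod>k\<in>T-{i}. (x k - y i) / (s k - s i)) * r (T - {i}))"
        if "T \<subseteq> set (del i xs)" "T \<noteq> {}" for T
        using that by (intro Suc.prems(4)) (auto simp: sd S_def)
    qed
    moreover have "(\<Prod>k\<in>S-{xs!i}. s (xs ! i) - s k) \<noteq> 0"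
      using Suc.prems(2) inS[OF that] S(1) by (auto simp: inj_on_def S_def)
    moreover have "alt xs ?pw = (- 1) ^ (i + n) * (\<Prod>k\<in>S-{xs!i}. s (xs ! i) - s k) * alt (del i xs) ?pw"
      unfolding S_def by (rule alt_power_del) (use Suc.prems len that in auto)
    ultimately show ?thesis by (simp add: sd[symmetric] field_simps)
  qed
  have "(- 1) ^ n * alt xs ?h = - coeff P (Suc n) * alt xs ?h" by (simp add: P)
  also have "\<dots> = (\<Sum>i\<le>n. v i * (- 1) ^ (i + n) * alt (del i xs) ?h)"
    by (rule alt_expand[OF len, where c = "\<lambda>j. - coeff P (Suc j)" and F = ?h]) (rule v)
  also have "\<dots> = alt xs ?pw * (\<Sum>i\<le>n. v i * r (S - {xs ! i}) / (\<Prod>k\<in>S-{xs!i}. s (xs ! i) - s k))"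
    unfolding sum_distrib_left by (intro sum.cong refl) (simp only: del atMost_iff)
  also have "(\<Sum>i\<le>n. v i * r (S - {xs ! i}) / (\<Prod>k\<in>S-{xs!i}. s (xs ! i) - s k))
      = (\<Sum>i\<in>S. (\<Prod>k\<in>S-{i}. x k - y i) * r (S - {i}) / (\<Prod>k\<in>S-{i}. s i - s k))"
  proof -
    have "bij_betw ((!) xs) {..n} S"
      unfolding S_def using bij_betw_nth[OF Suc.prems(1), of "{..n}"] len by (simp add: lessThan_Suc_atMost[symmetric])
    then show ?thesis unfolding v_def by (rule sum.reindex_bij_betw)
  qed
  also have "\<dots> = (\<Sum>i\<in>S. (- 1) ^ n * ((\<Prod>k\<in>S-{i}. (x k - y i) / (s k - s i)) * r (S - {i})))"
  proof (intro sum.cong refl)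
    fix i assume "i \<in> S"
    have "(\<Prod>k\<in>S-{i}. s i - s k) = (\<Prod>k\<in>S-{i}. (- 1) * (s k - s i))" by simp
    also have "\<dots> = (- 1) ^ n * (\<Prod>k\<in>S-{i}. s k - s i)"
      unfolding prod.distrib using S \<open>i \<in> S\<close> by simp
    finally show "(\<Prod>k\<in>S-{i}. x k - y i) * r (S - {i}) / (\<Prod>k\<in>S-{i}. s i - s k)
      = (- 1) ^ n * ((\<Prod>k\<in>S-{i}. (x k - y i) / (s k - s i)) * r (S - {i}))"
      by (cases "even n") (simp_all add: prod_dividef)
  qed
  also have "\<dots> = (- 1) ^ n * r S"
  proof -
    have "r S = (\<Sum>i\<in>S. (\<Prod>k\<in>S-{i}. (x k - y i) / (s k - s i)) * r (S - {i}))"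
      using S(2) by (intro Suc.prems(4)) (auto simp: S_def)
    then show ?thesis by (simp only: sum_distrib_left)
  qed
  finally have "(- 1) ^ n * alt xs ?h = (- 1) ^ n * (alt xs ?pw * r S)" by (simp add: ac_simps)
  then show ?case by (simp add: S_def mult.commute)
qed

section \<open>Alternants with merging nodes\<close>

lemma tendsto_det:
  assumes "\<And>i j. i < n \<Longrightarrow> j < n \<Longrightarrow> ((\<lambda>e. A e i j) \<longlongrightarrow> (B i j :: complex)) F"
  shows "((\<lambda>e. det (mat n n (\<lambda>(i, j). A e i j))) \<longlongrightarrow> det (mat n n (\<lambda>(i, j). B i j))) F"
proof -
  have *: "det (mat n n (\<lambda>(i, j). C i j)) = (\<Sum>p\<in>{p. p permutes {0..<n}}. signof p * (\<Prod>i = 0..<n. C i (p i)))"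
    for C :: "nat \<Rightarrow> nat \<Rightarrow> complex"
    by (subst det_def') (auto intro!: sum.cong prod.cong dest: permutes_in_image)
  show ?thesis unfolding * using permutes_in_image
    by (intro tendsto_intros assms) (auto simp: permutes_in_image)
qed

lemma coeff_prod_linear_tendsto:
  fixes s :: "'c \<Rightarrow> nat \<Rightarrow> complex"
  assumes "\<And>i. i < n \<Longrightarrow> ((\<lambda>e. s e i) \<longlongrightarrow> 0) F"
  shows "((\<lambda>e. coeff (\<Prod>i<n. [:- s e i, 1:]) k) \<longlongrightarrow> (if k = n then 1 else 0)) F"
  using assms
proof (induction n arbitrary: k)
  case 0
  then show ?case by (simp add: coeff_1)
next
  case (Suc n)
  have "coeff (\<Prod>i<Suc n. [:- s e i, 1:]) k = - s e n * coeff (\<Prod>i<n. [:- s e i, 1:]) k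
      + (case k of 0 \<Rightarrow> 0 | Suc k \<Rightarrow> coeff (\<Prod>i<n. [:- s e i, 1:]) k)" for e
    by (simp add: mult.commute[of _ "[:_, _:]"] coeff_pCons split: nat.splits)
  moreover have "((\<lambda>e. case k of 0 \<Rightarrow> 0 | Suc k \<Rightarrow> coeff (\<Prod>i<n. [:- s e i, 1:]) k)
     \<longlongrightarrow> (case k of 0 \<Rightarrow> 0 | Suc k \<Rightarrow> if k = n then 1 else 0)) F"
    using Suc.IH[OF Suc.prems] by (cases k) auto
  then have "((\<lambda>e. - s e n * coeff (\<Prod>i<n. [:- s e i, 1:]) k
      + (case k of 0 \<Rightarrow> 0 | Suc k \<Rightarrow> coeff (\<Prod>i<n. [:- s e i, 1:]) k))
     \<longlongrightarrow> - 0 * (if k = n then 1 else 0) + (case k of 0 \<Rightarrow> 0 | Suc k \<Rightarrow> if k = n then 1 else 0)) F"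
    using Suc.IH[OF Suc.prems] Suc.prems[of n] by (intro tendsto_add tendsto_mult tendsto_minus) auto
  ultimately show ?case by (cases k) auto
qed

text \<open>In the limit \<open>Q e\<close> becomes the monomial of degree \<open>n\<close>, and
  reduction modulo that monomial is truncation. The induction follows division with remainder one
  coefficient at a time.\<close>

lemma coeff_mod_tendsto:
  fixes Q :: "'c \<Rightarrow> complex poly"
  assumes deg: "\<And>e. degree (Q e) = n" and mon: "\<And>e. lead_coeff (Q e) = 1"
    and lim: "\<And>k. k < n \<Longrightarrow> ((\<lambda>e. coeff (Q e) k) \<longlongrightarrow> 0) F"
    and "k < n"
  shows "((\<lambda>e. coeff (P mod Q e) k) \<longlongrightarrow> coeff P k) F"
  using \<open>k < n\<close>
proof (induction P arbitrary: k)
  case 0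
  then show ?case by simp
next
  case (pCons a P)
  have Q: "Q e \<noteq> 0" for e using mon[of e] by auto
  obtain m where m: "n = Suc m" using pCons.prems by (cases n) auto
  have "coeff (pCons a P mod Q e) k = coeff (pCons a (P mod Q e)) k - coeff (P mod Q e) m * coeff (Q e) k" for e
    using mod_pCons[OF Q[of e], of a P] mon[of e] deg[of e] by (simp add: m)
  moreover have "((\<lambda>e. coeff (pCons a (P mod Q e)) k - coeff (P mod Q e) m * coeff (Q e) k)
      \<longlongrightarrow> coeff (pCons a P) k - coeff P m * 0) F"
    by (cases k; intro tendsto_intros lim) (use pCons m in \<open>auto intro!: tendsto_intros\<close>)
  ultimately show ?case by simp
qed

text \<open>The remainder of \<open>P j\<close> modulo the node polynomial \<open>Q e\<close>
  interpolates \<open>P j\<close> at the nodes. So the matrix of values is the Vandermonde matrix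
  times the matrix of remainder coefficients, the Vandermonde determinant cancels, and the
  remainders tend to truncations.\<close>

theorem confluent_alternant:
  fixes s :: "real \<Rightarrow> nat \<Rightarrow> complex" and r :: "real \<Rightarrow> complex" and P :: "nat \<Rightarrow> complex poly"
  assumes lim: "\<And>i. i < n \<Longrightarrow> ((\<lambda>e. s e i) \<longlongrightarrow> 0) F"
    and ev: "\<forall>\<^sub>F e in F. inj_on (s e) {..<n} \<and>
       r e * det (mat n n (\<lambda>(i, j). s e i ^ j)) = det (mat n n (\<lambda>(i, j). poly (P j) (s e i)))"
  shows "(r \<longlongrightarrow> det (mat n n (\<lambda>(i, j). coeff (P j) i))) F"
proof -
  define Q where "Q e = (\<Prod>i<n. [:- s e i, 1:])" for e
  have deg: "degree (Q e) = n" for e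
    unfolding Q_def by (subst degree_prod_eq_sum_degree) auto
  have mon: "lead_coeff (Q e) = 1" for e
    unfolding Q_def by (simp add: lead_coeff_prod)
  define C where "C e j i = coeff (P j mod Q e) i" for e i j
  have C: "((\<lambda>e. C e j i) \<longlongrightarrow> coeff (P j) i) F" if "i < n" for i j
    unfolding C_def
  proof (rule coeff_mod_tendsto[OF deg mon _ that])
    fix k assume "k < n"
    then show "((\<lambda>e. coeff (Q e) k) \<longlongrightarrow> 0) F"
      using coeff_prod_linear_tendsto[of n s F k, OF lim] by (simp add: Q_def)
  qed
  have "((\<lambda>e. det (mat n n (\<lambda>(i, j). C e j i))) \<longlongrightarrow> det (mat n n (\<lambda>(i, j). coeff (P j) i))) F"
    by (rule tendsto_det) (rule C)
  moreover have "\<forall>\<^sub>F e in F. det (mat n n (\<lambda>(i, j). C e j i)) = r e"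
    using ev
  proof eventually_elim
    case (elim e)
    let ?V = "mat n n (\<lambda>(i, j). s e i ^ j)" and ?C = "mat n n (\<lambda>(i, j). C e j i)"
    have "?V * ?C = mat n n (\<lambda>(i, j). poly (P j) (s e i))"
    proof (rule eq_matI, goal_cases)
      case (1 i j)
      then have i: "i < n" and j: "j < n" by auto
      have Q0: "poly (Q e) (s e i) = 0"
        using i unfolding Q_def poly_prod by (intro prod_zero) auto
      have dm: "degree (P j mod Q e) < n"
        using degree_mod_less'[of "Q e" "P j"] deg[of e] mon[of e] i by (metis degree_0 degree_mod_less leading_coeff_0_iff neq0_conv not_less0 zero_neq_one)
      have "(?V * ?C) $$ (i, j) = (\<Sum>k<n. C e j k * s e i ^ k)"
        using i j by (simp add: scalar_prod_def atLeast0LessThan mult.commute)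
      also have "\<dots> = poly (P j mod Q e) (s e i)"
      proof -
        obtain m where m: "n = Suc m" using i by (cases n) auto
        show ?thesis using dm unfolding m C_def lessThan_Suc_atMost by (simp add: poly_sum_atMost less_Suc_eq_le)
      qed
      also have "\<dots> = poly (P j) (s e i)"
      proof -
        have "poly (P j) (s e i) = poly (Q e * (P j div Q e) + P j mod Q e) (s e i)"
          by (simp only: mult_div_mod_eq)
        then show ?thesis unfolding poly_add poly_mult Q0 by simp
      qed
      finally show ?case using i j by simp
    qed auto
    then have "det ?V * det ?C = r e * det ?V"
      using elim det_mult[of ?V n ?C] by (metis mat_carrier mult.commute)
    moreover have "det ?V \<noteq> 0"
    proof -
      have "det ?V = alt [0..<n] (\<lambda>j k. s e k ^ j)" unfolding alt_def by (auto intro!: arg_cong[of _ _ det] eq_matI)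
      then show ?thesis using alt_power_nonzero[of "[0..<n]" "s e"] elim by (simp add: atLeast0LessThan)
    qed
    ultimately show ?case by simp
  qed
  ultimately show ?thesis by (rule Lim_transform_eventually)
qed

section \<open>Determinant rules, and expansions in elementary symmetric functions\<close>

lemma det_unit_lower:
  assumes "\<And>i k. i < k \<Longrightarrow> k < n \<Longrightarrow> L i k = 0" "\<And>i. i < n \<Longrightarrow> L i i = (1::'a::idom)"
  shows "det (mat n n (\<lambda>(i, k). L i k)) = 1"
  by (subst det_lower_triangular[of n]) (use assms in \<open>auto simp: prod_list_diag_prod\<close>)

lemma det_unit_lower_mult:
  fixes L B C :: "nat \<Rightarrow> nat \<Rightarrow> 'a::idom"
  assumes "\<And>i k. i < k \<Longrightarrow> k < n \<Longrightarrow> L i k = 0" "\<And>i. i < n \<Longrightarrow> L i i = 1"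
    and "\<And>i j. i < n \<Longrightarrow> j < n \<Longrightarrow> C i j = (\<Sum>k<n. L i k * B k j)"
  shows "det (mat n n (\<lambda>(i, j). C i j)) = det (mat n n (\<lambda>(i, j). B i j))"
proof -
  have "mat n n (\<lambda>(i, j). C i j) = mat n n (\<lambda>(i, k). L i k) * mat n n (\<lambda>(i, j). B i j)"
    using assms(3) by (intro eq_matI) (auto simp: scalar_prod_def atLeast0LessThan)
  then have "det (mat n n (\<lambda>(i, j). C i j)) = det (mat n n (\<lambda>(i, k). L i k)) * det (mat n n (\<lambda>(i, j). B i j))"
    using det_mult[of "mat n n (\<lambda>(i, k). L i k)" n] by simp
  then show ?thesis using det_unit_lower[of n L] assms by simp
qed

lemma det_mult_mat:
  fixes A B C :: "nat \<Rightarrow> nat \<Rightarrow> 'a::comm_ring_1"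
  assumes "\<And>i j. i < n \<Longrightarrow> j < n \<Longrightarrow> C i j = (\<Sum>k<n. A i k * B k j)"
  shows "det (mat n n (\<lambda>(i, j). C i j)) = det (mat n n (\<lambda>(i, j). A i j)) * det (mat n n (\<lambda>(i, j). B i j))"
proof -
  have "mat n n (\<lambda>(i, j). C i j) = mat n n (\<lambda>(i, k). A i k) * mat n n (\<lambda>(i, j). B i j)"
    using assms by (intro eq_matI) (auto simp: scalar_prod_def atLeast0LessThan)
  then show ?thesis using det_mult[of "mat n n (\<lambda>(i, k). A i k)" n] by simp
qed

lemma det_swap_index: "det (mat n n (\<lambda>(i, j). A j i)) = (det (mat n n (\<lambda>(i, j). A i j)) :: 'a::comm_ring_1)"
  by (subst det_transpose[of _ n, symmetric]) (auto intro!: arg_cong[of _ _ det] eq_matI)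

text \<open>With \<open>2 + z = Z + 1 / Z\<close> this is
  \<open>(Z^(i+1) - Z^(-i-1)) / (Z - 1 / Z)\<close>, a Chebyshev polynomial of the second kind. Its
  coefficients are the second binomial factor in the determinant of the theorem.\<close>

definition eps :: "nat \<Rightarrow> 'a::comm_ring_1 \<Rightarrow> 'a" where
  "eps i z = (\<Sum>k\<le>i. of_nat ((i + k + 1) choose (2 * k + 1)) * z ^ k)"

lemma eps_0 [simp]: "eps 0 z = 1" and eps_1 [simp]: "eps (Suc 0) z = 2 + z"
  by (simp_all add: eps_def numeral_eq_Suc)

lemma eps_Suc_Suc: "eps (Suc (Suc i)) z = (2 + z) * eps (Suc i) z - eps i (z :: 'a::comm_ring_1)"
proof -
  define c :: "nat \<Rightarrow> nat \<Rightarrow> 'a" where "c i k = of_nat ((i + k + 1) choose (2 * k + 1))" for i k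
  have c: "c (Suc (Suc i)) (Suc k) + c i (Suc k) = 2 * c (Suc i) (Suc k) + c (Suc i) k" for k
  proof -
    have "((i + k + 4) choose (2 * k + 3)) + ((i + k + 2) choose (2 * k + 3))
       = 2 * ((i + k + 3) choose (2 * k + 3)) + ((i + k + 2) choose (2 * k + 1))"
      by (simp add: numeral_eq_Suc)
    then have "(of_nat (((i + k + 4) choose (2 * k + 3)) + ((i + k + 2) choose (2 * k + 3))) :: 'a)
       = of_nat (2 * ((i + k + 3) choose (2 * k + 3)) + ((i + k + 2) choose (2 * k + 1)))"
      by (simp only:)
    moreover have "Suc (Suc i) + Suc k + 1 = i + k + 4" "i + Suc k + 1 = i + k + 2" "Suc i + Suc k + 1 = i + k + 3"
      "Suc i + k + 1 = i + k + 2" "2 * Suc k + 1 = 2 * k + 3" by simp_all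
    ultimately show ?thesis by (simp only: c_def of_nat_add of_nat_mult of_nat_numeral)
  qed
  have c0: "c (Suc (Suc i)) 0 + c i 0 = 2 * c (Suc i) 0" by (simp add: c_def)
  have e: "eps i z = (\<Sum>k\<le>n. c i k * z ^ k)" if "i \<le> n" for i n
    unfolding eps_def c_def
  proof (intro sum.mono_neutral_left ballI)
    fix k assume "k \<in> {..n} - {..i}"
    then have "(i + k + 1) choose (2 * k + 1) = 0" by (intro binomial_eq_0) auto
    then show "of_nat ((i + k + 1) choose (2 * k + 1)) * z ^ k = 0" by (simp only: of_nat_0 mult_zero_left)
  qed (use that in auto)
  have "eps (Suc (Suc i)) z + eps i z = (\<Sum>k\<le>Suc (Suc i). (c (Suc (Suc i)) k + c i k) * z ^ k)"
    unfolding e[OF order.refl, of "Suc (Suc i)"] e[OF le_SucI[OF le_SucI[OF order.refl]], of i] distrib_right sum.distrib ..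
  also have "\<dots> = 2 * c (Suc i) 0 + (\<Sum>k\<le>Suc i. (2 * c (Suc i) (Suc k) + c (Suc i) k) * z ^ Suc k)"
    unfolding sum.atMost_Suc_shift[of _ "Suc i"] c c0 by simp
  also have "\<dots> = 2 * (\<Sum>k\<le>Suc (Suc i). c (Suc i) k * z ^ k) + z * (\<Sum>k\<le>Suc i. c (Suc i) k * z ^ k)"
    unfolding sum.atMost_Suc_shift[of _ "Suc i"]
    by (simp add: distrib_right distrib_left sum.distrib sum_distrib_left mult.assoc mult.left_commute del: sum.atMost_Suc)
  also have "\<dots> = (2 + z) * eps (Suc i) z"
    unfolding e[OF order.refl, of "Suc i", symmetric] e[OF le_SucI[OF order.refl], of "Suc i", symmetric] distrib_right ..
  finally show ?thesis by (simp add: algebra_simps)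
qed

lemma power_eq_eps:
  assumes "Z ^ 2 = (2 + z) * Z - (1::'a::comm_ring_1)"
  shows "Z ^ Suc (Suc c) = eps (Suc c) z * Z - eps c z"
proof (induction c)
  case 0
  then show ?case using assms by (simp add: power2_eq_square algebra_simps)
next
  case (Suc c)
  have "Z ^ Suc (Suc (Suc c)) = Z * (eps (Suc c) z * Z - eps c z)"
    using Suc by simp
  also have "\<dots> = eps (Suc c) z * Z ^ 2 - eps c z * Z"
    by (simp add: power2_eq_square algebra_simps)
  also have "\<dots> = eps (Suc (Suc c)) z * Z - eps (Suc c) z"
    unfolding assms eps_Suc_Suc by (simp add: algebra_simps)
  finally show ?case .
qed

text \<open>In both models \<open>x + y\<close> and \<open>x * y\<close> are functions of the
  invariant variable; this expansion serves the spin-one case. For \<open>2 * r < j\<close> the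
  binomial coefficient is 0, so the truncated exponent \<open>2 * r - j\<close> does no
  harm.\<close>

lemma hs_as_sum:
  fixes x y :: "'a::comm_ring_1"
  shows "hs j x y = (\<Sum>r\<le>j. of_nat (r choose (j - r)) * (x + y) ^ (2 * r - j) * (- (x * y)) ^ (j - r))"
proof (induction j rule: induct_nat_012)
  case 0
  then show ?case by simp
next
  case 1
  then show ?case by simp
next
  case (ge2 j)
  define b c where "b = x + y" and "c = - (x * y)"
  define T where "T j r = of_nat (r choose (j - r)) * b ^ (2 * r - j) * c ^ (j - r)" for j r
  have T: "T (Suc (Suc j)) (Suc r) = b * T (Suc j) r + (if r \<le> j then c * T j r else 0)" if "r \<le> Suc j" for r
  proof (cases "r \<le> j")
    case True
    have 1: "of_nat (r choose (Suc j - r)) * b ^ (2 * r - j) = b * (of_nat (r choose (Suc j - r)) * b ^ (2 * r - Suc j))"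
    proof (cases "Suc j \<le> 2 * r")
      case True
      then have "2 * r - j = Suc (2 * r - Suc j)" by simp
      then show ?thesis by simp
    next
      case False
      then have "r choose (Suc j - r) = 0" by (intro binomial_eq_0) simp
      then show ?thesis by (simp only: of_nat_0 mult_zero_left mult_zero_right)
    qed
    have 2: "Suc r choose (Suc j - r) = (r choose (Suc j - r)) + (r choose (j - r))"
      using True by (simp add: Suc_diff_le)
    have "T (Suc (Suc j)) (Suc r) = of_nat (r choose (Suc j - r)) * b ^ (2 * r - j) * c ^ (Suc j - r)
       + c * (of_nat (r choose (j - r)) * b ^ (2 * r - j) * c ^ (j - r))"
      using True by (simp add: T_def 2 algebra_simps Suc_diff_le)
    then show ?thesis unfolding 1 using True by (simp add: T_def mult.assoc)
  next
    case False
    then have "r = Suc j" using that by simp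
    then show ?thesis by (simp add: T_def)
  qed
  have "(\<Sum>r\<le>Suc (Suc j). T (Suc (Suc j)) r) = (\<Sum>r\<le>Suc j. T (Suc (Suc j)) (Suc r))"
    by (subst sum.atMost_Suc_shift) (simp add: T_def)
  also have "\<dots> = b * (\<Sum>r\<le>Suc j. T (Suc j) r) + (\<Sum>r\<le>Suc j. if r \<le> j then c * T j r else 0)"
    by (simp add: T sum.distrib sum_distrib_left del: sum.atMost_Suc)
  also have "(\<Sum>r\<le>Suc j. if r \<le> j then c * T j r else 0) = c * (\<Sum>r\<le>j. T j r)"
    by (simp add: sum_distrib_left)
  finally show ?case using ge2 unfolding hs_Suc_Suc T_def b_def[symmetric] c_def[symmetric]
    by (simp add: c_def del: sum.atMost_Suc)
qed

subsection \<open>Evaluation of the confluent determinants\<close>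

unbundle fps_syntax

text \<open>This is \<open>p^m * hs j x y\<close> after substituting
  \<open>x + y = \<tau> (1 + p)\<close> and \<open>- x y = (1 + p)^2 / p\<close> in
  \<open>hs_as_sum\<close>. The non-zero terms have a pole of order
  \<open>j - r \<le> j / 2\<close>, which \<open>p^m\<close> clears as long as
  \<open>j \<le> 2 * m + 1\<close>.\<close>

definition spin1_poly :: "complex \<Rightarrow> nat \<Rightarrow> nat \<Rightarrow> complex poly" where
  "spin1_poly \<tau> m j = (\<Sum>r\<le>j. smult (of_nat (r choose (j - r)) * \<tau> ^ (2 * r - j)) ([:1, 1:] ^ j * monom 1 (m + r - j)))"

lemma poly_spin1_poly:
  assumes "j \<le> 2 * m + 1" "x + y = \<tau> * (1 + p)" "x * y * p = - ((1 + p) ^ 2)" "p \<noteq> 0"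
  shows "poly (spin1_poly \<tau> m j) p = p ^ m * hs j x y"
proof -
  have xy: "- (x * y) = (1 + p) ^ 2 / p" using assms(3,4) by (simp add: field_simps)
  have "poly (spin1_poly \<tau> m j) p = (\<Sum>r\<le>j. of_nat (r choose (j - r)) * \<tau> ^ (2 * r - j) * ((1 + p) ^ j * p ^ (m + r - j)))"
    by (simp add: spin1_poly_def poly_sum poly_monom)
  also have "\<dots> = (\<Sum>r\<le>j. p ^ m * (of_nat (r choose (j - r)) * (x + y) ^ (2 * r - j) * (- (x * y)) ^ (j - r)))"
  proof (intro sum.cong refl)
    fix r assume r: "r \<in> {..j}"
    show "of_nat (r choose (j - r)) * \<tau> ^ (2 * r - j) * ((1 + p) ^ j * p ^ (m + r - j))
      = p ^ m * (of_nat (r choose (j - r)) * (x + y) ^ (2 * r - j) * (- (x * y)) ^ (j - r))"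
    proof (cases "j \<le> 2 * r")
      case True
      have "p ^ m = p ^ (m + r - j) * p ^ (j - r)"
        using True r assms(1) by (simp flip: power_add)
      moreover have "(1 + p) ^ j = (1 + p) ^ (2 * r - j) * ((1 + p) ^ 2) ^ (j - r)"
      proof -
        have "(2 * r - j) + 2 * (j - r) = j" using True r by simp
        then have "(1 + p) ^ j = (1 + p) ^ ((2 * r - j) + 2 * (j - r))" by (rule arg_cong[OF sym])
        then show ?thesis unfolding power_mult power_add .
      qed
      ultimately show ?thesis
        using assms(4) by (simp add: assms(2) xy power_mult_distrib power_divide)
    next
      case False
      then have "r choose (j - r) = 0" by (intro binomial_eq_0) simp
      then show ?thesis by simp
    qed
  qed
  finally show ?thesis by (simp add: hs_as_sum sum_distrib_left)
qed

lemma fps_one_plus_X_power_nth: "((1 + fps_X) ^ s :: complex fps) $ i = of_nat (s choose i)"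
proof (induction s arbitrary: i)
  case 0
  then show ?case by (cases i) simp_all
next
  case (Suc s)
  then show ?case by (cases i) (simp_all add: distrib_right)
qed

definition tri :: "complex \<Rightarrow> complex fps" where
  "tri \<tau> = 1 + fps_const \<tau> * fps_X + fps_X ^ 2"

text \<open>The weights in \<open>r\<close> are those of \<open>spin1_poly\<close>, with
  \<open>s choose r\<close> in place of a polynomial in \<open>p\<close>; this is what allows the
  coefficients of \<open>spin1_poly\<close> to be traded for trinomial ones.\<close>

lemma tri_power_nth:
  "(tri \<tau> ^ s) $ i = (\<Sum>r\<le>i. of_nat (r choose (i - r)) * \<tau> ^ (2 * r - i) * of_nat (s choose r))"
proof -
  have nth: "((fps_const \<tau> + fps_X) ^ r :: complex fps) $ l = of_nat (r choose l) * \<tau> ^ (r - l)" for r l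
  proof (induction r arbitrary: l)
    case 0
    then show ?case by (cases l) simp_all
  next
    case (Suc r)
    show ?case
    proof (cases l)
      case 0
      then show ?thesis using Suc by (simp add: distrib_right)
    next
      case l: (Suc l')
      show ?thesis
      proof (cases "l \<le> r")
        case True
        then have "r - l' = Suc (r - l)" using l by simp
        then show ?thesis using Suc l by (simp add: distrib_right algebra_simps)
      next
        case False
        then have "r choose Suc l' = 0" using l by (intro binomial_eq_0) simp
        then show ?thesis using Suc l by (simp add: distrib_right)
      qed
    qed
  qed
  have "tri \<tau> ^ s = (fps_X * (fps_const \<tau> + fps_X) + 1) ^ s"
    by (simp add: tri_def algebra_simps power2_eq_square)
  also have "\<dots> = (\<Sum>r\<le>s. of_nat (s choose r) * (fps_X ^ r * (fps_const \<tau> + fps_X) ^ r))"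
    by (simp add: binomial_ring power_mult_distrib)
  also have "\<dots> $ i = (\<Sum>r\<le>s. of_nat (s choose r) * (if i < r then 0 else of_nat (r choose (i - r)) * \<tau> ^ (r - (i - r))))"
    unfolding fps_sum_nth fps_mult_of_nat_nth fps_X_power_mult_nth nth ..
  also have "\<dots> = (\<Sum>r\<le>max s i. of_nat (s choose r) * (if i < r then 0 else of_nat (r choose (i - r)) * \<tau> ^ (r - (i - r))))"
    by (intro sum.mono_neutral_left) (auto intro: binomial_eq_0)
  also have "\<dots> = (\<Sum>r\<le>i. of_nat (s choose r) * (if i < r then 0 else of_nat (r choose (i - r)) * \<tau> ^ (r - (i - r))))"
    by (intro sum.mono_neutral_right) auto
  also have "\<dots> = (\<Sum>r\<le>i. of_nat (r choose (i - r)) * \<tau> ^ (2 * r - i) * of_nat (s choose r))"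
    by (intro sum.cong refl) (auto simp: mult_2)
  finally show ?thesis .
qed

lemma tri_power_deg: "2 * s < i \<Longrightarrow> (tri \<tau> ^ s) $ i = 0"
  unfolding tri_power_nth
proof (intro sum.neutral ballI)
  fix r assume "2 * s < i" "r \<in> {..i}"
  then have "r choose (i - r) = 0 \<or> s choose r = 0"
    by (cases "s < r") (auto intro: binomial_eq_0)
  then show "of_nat (r choose (i - r)) * \<tau> ^ (2 * r - i) * of_nat (s choose r) = (0::complex)" by auto
qed

lemma tri_power_palindrome:
  assumes "i \<le> 2 * s" shows "(tri \<tau> ^ s) $ (2 * s - i) = (tri \<tau> ^ s) $ i"
proof -
  have step: "(tri \<tau> ^ Suc s) $ i = (tri \<tau> ^ s) $ i + (if i \<ge> 1 then \<tau> * (tri \<tau> ^ s) $ (i - 1) else 0)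
      + (if i \<ge> 2 then (tri \<tau> ^ s) $ (i - 2) else 0)" for s i
    by (simp add: tri_def distrib_right mult.assoc fps_X_power_mult_nth)
  show ?thesis using assms
  proof (induction s arbitrary: i)
    case 0
    then show ?case by simp
  next
    case (Suc s)
    define T where "T i = (tri \<tau> ^ s) $ i" for i
    have pal: "T (2 * s - i) = T i" if "i \<le> 2 * s" for i using Suc.IH that by (simp add: T_def)
    have big: "T i = 0" if "2 * s < i" for i using tri_power_deg that by (simp add: T_def)
    show ?case unfolding step T_def[symmetric]
    proof -
      consider "i = 0" | "i = 1" | "2 \<le> i" "i \<le> 2 * s" | "i = 2 * s + 1" "2 \<le> i" | "i = 2 * s + 2" using Suc.prems by atomize_elim arith
      then show "T (2 * Suc s - i) + (if 1 \<le> 2 * Suc s - i then \<tau> * T (2 * Suc s - i - 1) else 0)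
        + (if 2 \<le> 2 * Suc s - i then T (2 * Suc s - i - 2) else 0)
        = T i + (if 1 \<le> i then \<tau> * T (i - 1) else 0) + (if 2 \<le> i then T (i - 2) else 0)"
      proof cases
        case 1
        then show ?thesis using big pal[of 0] by simp
      next
        case 2
        then show ?thesis using big[of "2 * s + 1"] pal[of 0] pal[of 1] big[of 1] by (cases s) auto
      next
        case 3
        have "2 * Suc s - i = 2 * s - (i - 2)" "2 * Suc s - i - 1 = 2 * s - (i - 1)" "2 * Suc s - i - 2 = 2 * s - i"
          using 3 by auto
        then show ?thesis using 3 pal[of i] pal[of "i - 1"] pal[of "i - 2"] by auto
      next
        case 4
        then show ?thesis using big[of "2 * s + 1"] pal[of 0] pal[of 1] by auto
      next
        case 5
        then show ?thesis using big[of "2 * s + 2"] big[of "2 * s + 1"] pal[of 0] by auto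
      qed
    qed
  qed
qed

lemma fps_nth_sum_const_mult:
  "fps_nth ((\<Sum>r\<in>A. fps_const (w r) * G r) * H) a = (\<Sum>r\<in>A. w r * fps_nth (G r * H) (a :: nat) :: complex)"
  by (simp add: sum_distrib_right fps_sum_nth mult.assoc)

text \<open>Left multiplication by \<open>(1 + p)\<^sup>i / (1 + p)\<^sup>m\<close> in row \<open>i\<close> turns the coefficients into central
  trinomial numbers.\<close>

lemma spin1_coeff_transform:
  assumes "j \<le> 2 * m + 1"
  shows "(\<Sum>b\<le>a. ((1 + fps_X) ^ a * inverse (1 + fps_X) ^ m :: complex fps) $ (a - b) * coeff (spin1_poly \<tau> m j) b)
    = (if m \<le> a + j then (tri \<tau> ^ (a + j - m)) $ j else 0)"
proof -
  define V where "V = (1 + fps_X :: complex fps)"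
  have V: "V * inverse V = 1" unfolding V_def by (rule inverse_mult_eq_1') simp
  have cancel: "V ^ k * inverse V ^ m = V ^ (k - m)" if "m \<le> k" for k
  proof -
    have "V ^ ((k - m) + m) * inverse V ^ m = V ^ (k - m) * (V * inverse V) ^ m"
      by (simp only: power_add power_mult_distrib mult.assoc)
    then show ?thesis using V that by (simp only: le_add_diff_inverse2 power_one mult_1_right)
  qed
  have P: "fps_of_poly (spin1_poly \<tau> m j) = (\<Sum>r\<le>j. fps_const (of_nat (r choose (j - r)) * \<tau> ^ (2 * r - j)) * (V ^ j * fps_X ^ (m + r - j)))"
  proof -
    have "fps_of_poly [:1, 1:] = V" by (simp add: fps_of_poly_pCons V_def)
    then show ?thesis
      unfolding spin1_poly_def fps_of_poly_sum fps_of_poly_smult fps_of_poly_mult fps_of_poly_power fps_of_poly_monom'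
      by (simp only:)
  qed
  have "(\<Sum>b\<le>a. (V ^ a * inverse V ^ m) $ (a - b) * coeff (spin1_poly \<tau> m j) b)
    = (fps_of_poly (spin1_poly \<tau> m j) * (V ^ a * inverse V ^ m)) $ a"
    by (subst fps_mult_nth) (intro sum.cong, auto)
  also have "\<dots> = (\<Sum>r\<le>j. of_nat (r choose (j - r)) * \<tau> ^ (2 * r - j) * (fps_X ^ (m + r - j) * (V ^ (a + j) * inverse V ^ m)) $ a)"
    unfolding P fps_nth_sum_const_mult
  proof (intro sum.cong refl arg_cong2[of _ _ _ _ "(*)"])
    fix r
    have "V ^ j * fps_X ^ (m + r - j) * (V ^ a * inverse V ^ m) = fps_X ^ (m + r - j) * (V ^ (a + j) * inverse V ^ m)"
      by (simp only: power_add mult.assoc mult.commute mult.left_commute)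
    then show "fps_nth (V ^ j * fps_X ^ (m + r - j) * (V ^ a * inverse V ^ m)) a
      = fps_nth (fps_X ^ (m + r - j) * (V ^ (a + j) * inverse V ^ m)) a"
      by (rule arg_cong)
  qed
  also have "\<dots> = (\<Sum>r\<le>j. of_nat (r choose (j - r)) * \<tau> ^ (2 * r - j) * (if m \<le> a + j then of_nat ((a + j - m) choose r) else 0))"
  proof (intro sum.cong refl)
    fix r assume r: "r \<in> {..j}"
    show "of_nat (r choose (j - r)) * \<tau> ^ (2 * r - j) * (fps_X ^ (m + r - j) * (V ^ (a + j) * inverse V ^ m)) $ a
      = of_nat (r choose (j - r)) * \<tau> ^ (2 * r - j) * (if m \<le> a + j then of_nat ((a + j - m) choose r) else 0)"
    proof (cases "j \<le> 2 * r")
      case True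
      \<comment> \<open>From \<open>j \<le> 2 * r\<close> and \<open>j \<le> 2 * m + 1\<close>, by
        parity. From here on \<open>m + r - j\<close> is a true difference.\<close>
      have mr: "j \<le> m + r" using True r assms by simp
      show ?thesis
      proof (cases "m \<le> a + j")
        case ma: True
        have "(fps_X ^ (m + r - j) * (V ^ (a + j) * inverse V ^ m)) $ a
          = (if a < m + r - j then 0 else of_nat ((a + j - m) choose (a - (m + r - j))))"
          unfolding cancel[OF ma] unfolding fps_X_power_mult_nth V_def fps_one_plus_X_power_nth ..
        also have "\<dots> = of_nat ((a + j - m) choose r)"
        proof (cases "a < m + r - j")
          case True
          then have "a + j - m < r" using mr ma by simp
          then show ?thesis using True by (simp add: binomial_eq_0)
        next
          case False
          then have le: "r \<le> a + j - m" and *: "a + j - m - r = a - (m + r - j)" using mr ma by auto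
          \<comment> \<open>The lower indices \<open>r\<close> and \<open>a - (m + r - j)\<close>
            add up to \<open>a + j - m\<close>.\<close>
          have "(a + j - m) choose r = (a + j - m) choose (a - (m + r - j))"
            unfolding *[symmetric] by (rule binomial_symmetric[OF le])
          then show ?thesis using False by (simp only: if_False)
        qed
        finally show ?thesis using ma by simp
      next
        case ma: False
        then have "a < m + r - j" using mr by linarith
        then show ?thesis using ma by (simp add: fps_X_power_mult_nth)
      qed
    next
      case False
      then have "r choose (j - r) = 0" by (intro binomial_eq_0) simp
      then show ?thesis by simp
    qed
  qed
  also have "\<dots> = (if m \<le> a + j then (tri \<tau> ^ (a + j - m)) $ j else 0)"
    by (simp add: tri_power_nth)
  finally show ?thesis by (simp add: V_def)
qed

definition asm_det :: "nat \<Rightarrow> 'a::comm_ring_1 \<Rightarrow> 'a" where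
  "asm_det n t = det (mat n n (\<lambda>(i, j). \<Sum>k<n.
     of_nat ((i + j + 1) choose (i + k + 1)) * of_nat ((i + k + 1) choose (2 * k + 1)) * t ^ k))"

text \<open>A polynomial or power series in \<open>q = X\<^sup>2 / (1 + \<tau>X)\<close>, and \<open>X\<close> times such a series, form the two
  branches over the \<open>q\<close>-line; in this basis the determinant becomes block triangular.\<close>

definition qser :: "complex \<Rightarrow> complex fps" where
  "qser \<tau> = fps_X ^ 2 * inverse (1 + fps_const \<tau> * fps_X)"

lemma qser_mult: "qser \<tau> * (1 + fps_const \<tau> * fps_X) = fps_X ^ 2"
proof -
  have "inverse (1 + fps_const \<tau> * fps_X) * (1 + fps_const \<tau> * fps_X) = 1"
    by (rule inverse_mult_eq_1) simp
  then show ?thesis by (simp add: qser_def mult.assoc)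
qed

lemma qser_nth_0: "fps_nth (qser \<tau>) 0 = 0"
  by (simp add: qser_def)

lemma qser_power: "qser \<tau> ^ k = fps_X ^ (2 * k) * inverse (1 + fps_const \<tau> * fps_X) ^ k"
  by (simp add: qser_def power_mult_distrib power_mult)

lemma qser_power_nth_less: "i < 2 * k \<Longrightarrow> fps_nth (qser \<tau> ^ k) i = 0"
  by (simp add: qser_power fps_X_power_mult_nth)

lemma qser_power_nth: "fps_nth (qser \<tau> ^ k) (2 * k) = 1"
  by (simp add: qser_power fps_X_power_mult_nth fps_nth_power_0)

text \<open>\<open>qser \<tau>\<close> has order 2, so only its first \<open>n\<close> powers reach
  below degree \<open>2 * n\<close>.\<close>

lemma compose_qser_nth:
  assumes "i < 2 * n"
  shows "fps_nth (F oo qser \<tau>) i = (\<Sum>k<n. fps_nth F k * fps_nth (qser \<tau> ^ k) i)"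
proof -
  have "(\<Sum>k=0..i. fps_nth F k * fps_nth (qser \<tau> ^ k) i) = (\<Sum>k\<in>{0..i}\<inter>{..<n}. fps_nth F k * fps_nth (qser \<tau> ^ k) i)"
  proof (intro sum.mono_neutral_right ballI)
    fix k assume "k \<in> {0..i} - {0..i} \<inter> {..<n}"
    then have "i < 2 * k" using assms by auto
    then show "fps_nth F k * fps_nth (qser \<tau> ^ k) i = 0" by (simp add: qser_power_nth_less)
  qed auto
  also have "\<dots> = (\<Sum>k<n. fps_nth F k * fps_nth (qser \<tau> ^ k) i)"
  proof (intro sum.mono_neutral_left ballI)
    fix k assume "k \<in> {..<n} - {0..i} \<inter> {..<n}"
    then have "i < 2 * k" by auto
    then show "fps_nth F k * fps_nth (qser \<tau> ^ k) i = 0" by (simp add: qser_power_nth_less)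
  qed auto
  finally show ?thesis by (simp add: fps_compose_nth)
qed

lemma X_compose_qser_nth:
  assumes "i < 2 * n"
  shows "fps_nth (fps_X * (F oo qser \<tau>)) i = (\<Sum>k<n. fps_nth F k * fps_nth (fps_X * qser \<tau> ^ k) i)"
  using assms compose_qser_nth[of "i - 1" n F \<tau>] by (cases i) simp_all

lemma tri_eq: "tri \<tau> = (1 + fps_const \<tau> * fps_X) * (1 + qser \<tau>)"
  using qser_mult[of \<tau>] by (simp add: tri_def algebra_simps)

lemma compose_qser_simps:
  "(F * G) oo qser \<tau> = (F oo qser \<tau>) * (G oo qser \<tau>)"
  "(F ^ k) oo qser \<tau> = (F oo qser \<tau>) ^ k"
  using fps_compose_mult_distrib[OF qser_nth_0] fps_compose_power[OF qser_nth_0] by auto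

lemma fps_eps_nth: "fps_nth (eps i (fps_const t * fps_X)) k = of_nat ((i + k + 1) choose (2 * k + 1)) * (t :: complex) ^ k"
proof -
  have "fps_nth (eps i (fps_const t * fps_X)) k
    = (\<Sum>l\<le>i. if k = l then of_nat ((i + l + 1) choose (2 * l + 1)) * t ^ l else 0)"
    unfolding eps_def fps_sum_nth
  proof (intro sum.cong refl)
    fix l
    define c where "c = (i + l + 1) choose (2 * l + 1)"
    have "of_nat c * (fps_const t * fps_X) ^ l = fps_const (of_nat c * t ^ l) * (fps_X ^ l :: complex fps)"
      by (simp add: power_mult_distrib fps_const_power mult.assoc flip: fps_of_nat fps_const_mult)
    then show "fps_nth (of_nat ((i + l + 1) choose (2 * l + 1)) * (fps_const t * fps_X) ^ l) k
      = (if k = l then of_nat ((i + l + 1) choose (2 * l + 1)) * t ^ l else 0)"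
      unfolding c_def[symmetric] by simp
  qed
  also have "\<dots> = of_nat ((i + k + 1) choose (2 * k + 1)) * t ^ k"
  proof (cases "k \<le> i")
    case False
    then have "(i + k + 1) choose (2 * k + 1) = 0" by (intro binomial_eq_0) simp
    then show ?thesis using False by (simp only: of_nat_0 mult_zero_left) simp
  qed simp
  finally show ?thesis .
qed

definition odd_part :: "complex \<Rightarrow> nat \<Rightarrow> complex fps" where
  "odd_part \<tau> c = (1 + fps_X) ^ Suc c * eps c (fps_const (\<tau> ^ 2) * fps_X)"

definition even_part :: "complex \<Rightarrow> nat \<Rightarrow> complex fps" where
  "even_part \<tau> c = (1 + fps_X) ^ Suc c * (eps c (fps_const (\<tau> ^ 2) * fps_X)
     - (case c of 0 \<Rightarrow> 0 | Suc c \<Rightarrow> eps c (fps_const (\<tau> ^ 2) * fps_X)))"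

lemma compose_eps: "eps c (fps_const t * fps_X) oo qser \<tau> = eps c (fps_const t * qser \<tau>)"
proof (induction c rule: induct_nat_012)
  case (ge2 c)
  then show ?case
    by (simp add: eps_Suc_Suc fps_compose_sub_distrib fps_compose_add_distrib compose_qser_simps qser_nth_0)
qed (simp_all add: fps_compose_add_distrib compose_qser_simps qser_nth_0)

text \<open>\<open>Z = 1 + \<tau> X\<close> is quadratic over the series in \<open>q\<close>: it and
  its conjugate \<open>1 / Z\<close> have sum \<open>2 + \<tau>^2 q\<close> and product 1. So powers
  of \<open>Z\<close> reduce to \<open>eps\<close> combinations of \<open>Z\<close> and 1, and
  \<open>Z - 1 = \<tau> X\<close> separates the two branches; the rest of \<open>tri\<close> is the
  factor \<open>1 + q\<close>.\<close>

lemma tri_power_split: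
  "tri \<tau> ^ Suc c = (even_part \<tau> c oo qser \<tau>) + fps_const \<tau> * (fps_X * (odd_part \<tau> c oo qser \<tau>))"
proof -
  define Z where "Z = 1 + fps_const \<tau> * fps_X"
  define z where "z = fps_const (\<tau> ^ 2) * qser \<tau>"
  have "Z ^ 2 = 1 + 2 * fps_const \<tau> * fps_X + fps_const (\<tau> ^ 2) * fps_X ^ 2"
    by (simp add: Z_def power2_eq_square algebra_simps flip: fps_const_mult)
  also have "\<dots> = (2 + z) * Z - 1"
    unfolding qser_mult[of \<tau>, symmetric] z_def Z_def by (simp add: algebra_simps)
  finally have Z2: "Z ^ 2 = (2 + z) * Z - 1" .
  have Zc: "Z ^ Suc c = eps c z * Z - (case c of 0 \<Rightarrow> 0 | Suc c \<Rightarrow> eps c z)"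
    using power_eq_eps[OF Z2] by (cases c) simp_all
  have o: "odd_part \<tau> c oo qser \<tau> = (1 + qser \<tau>) ^ Suc c * eps c z"
    unfolding odd_part_def z_def compose_qser_simps compose_eps
    by (simp add: fps_compose_add_distrib qser_nth_0)
  have e: "even_part \<tau> c oo qser \<tau> = (1 + qser \<tau>) ^ Suc c * (eps c z - (case c of 0 \<Rightarrow> 0 | Suc c \<Rightarrow> eps c z))"
    unfolding even_part_def z_def compose_qser_simps fps_compose_sub_distrib compose_eps
    by (cases c) (simp_all add: fps_compose_add_distrib qser_nth_0 compose_eps)
  show ?thesis
    unfolding o e tri_eq Z_def[symmetric] power_mult_distrib Zc
    by (simp add: Z_def algebra_simps)
qed

section \<open>Block triangular form of the spin-one determinant\<close>

definition pser :: "complex fps" where "pser = fps_X * inverse (1 + fps_X)"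

lemma pser_power: "pser ^ c = fps_X ^ c * inverse (1 + fps_X) ^ c"
  by (simp add: pser_def power_mult_distrib)

lemma X2_div_tri: "fps_X ^ 2 * inverse (tri \<tau>) = pser oo qser \<tau>"
proof -
  have "inverse (1 + fps_X :: complex fps) * (1 + fps_X) = 1" by (rule inverse_mult_eq_1) simp
  then have "pser * (1 + fps_X) = fps_X" by (simp add: pser_def mult.assoc)
  then have "(pser * (1 + fps_X)) oo qser \<tau> = qser \<tau>" by (simp add: qser_nth_0)
  then have p: "(pser oo qser \<tau>) * (1 + qser \<tau>) = qser \<tau>"
    by (simp add: compose_qser_simps fps_compose_add_distrib qser_nth_0)
  have "inverse (tri \<tau>) * tri \<tau> = 1" by (rule inverse_mult_eq_1) (simp add: tri_def)
  then have "fps_X ^ 2 * inverse (tri \<tau>) * tri \<tau> = fps_X ^ 2" by (simp add: mult.assoc)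
  also have "\<dots> = (pser oo qser \<tau>) * tri \<tau>"
    unfolding tri_eq qser_mult[of \<tau>, symmetric] by (subst p[symmetric]) (simp only: ac_simps)
  finally have "(fps_X ^ 2 * inverse (tri \<tau>) - (pser oo qser \<tau>)) * tri \<tau> = 0" by (simp add: algebra_simps)
  moreover have "fps_nth (tri \<tau>) 0 = 1" by (simp add: tri_def)
  then have "tri \<tau> \<noteq> 0" by auto
  ultimately show ?thesis by simp
qed

text \<open>For \<open>b > m\<close> a power of \<open>tri\<close>; for \<open>b \<le> m\<close> the
  corresponding negative power, multiplied by the power of \<open>X\<close> that the palindromy of
  \<open>tri\<close> calls for.\<close>

definition Jcol :: "complex \<Rightarrow> nat \<Rightarrow> nat \<Rightarrow> complex fps" where
  "Jcol \<tau> m b = (if b \<le> m then (fps_X ^ 2 * inverse (tri \<tau>)) ^ (m - b) else tri \<tau> ^ (b - m))"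

text \<open>For \<open>c = m - a \<ge> 0\<close> the left side is the coefficient of index
  \<open>j - 2 * c\<close> in \<open>tri^(j - c)\<close>, a palindrome of degree
  \<open>2 * (j - c)\<close>; its mirror image is the coefficient of index \<open>j\<close>.\<close>

lemma tri_mult_Jcol_nth:
  "fps_nth (tri \<tau> ^ j * Jcol \<tau> m a) j = (if m \<le> a + j then fps_nth (tri \<tau> ^ (a + j - m)) j else 0)"
proof (cases "a \<le> m")
  case False
  then show ?thesis by (simp add: Jcol_def flip: power_add) (simp add: add.commute)
next
  case True
  define c where "c = m - a"
  have ca: "m \<le> a + j \<longleftrightarrow> c \<le> j" "a + j - m = j - c" using True by (auto simp: c_def)
  have eq: "tri \<tau> ^ j * Jcol \<tau> m a = fps_X ^ (2 * c) * (tri \<tau> ^ j * inverse (tri \<tau>) ^ c)"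
    using True by (simp add: Jcol_def c_def power_mult_distrib power_mult mult.left_commute)
  show ?thesis
  proof (cases "j < 2 * c")
    case True
    then show ?thesis unfolding eq ca by (simp add: fps_X_power_mult_nth tri_power_deg)
  next
    case False
    have "tri \<tau> * inverse (tri \<tau>) = 1" by (rule inverse_mult_eq_1') (simp add: tri_def)
    moreover have "tri \<tau> ^ ((j - c) + c) * inverse (tri \<tau>) ^ c = tri \<tau> ^ (j - c) * (tri \<tau> * inverse (tri \<tau>)) ^ c"
      by (simp only: power_add power_mult_distrib mult.assoc)
    ultimately have "tri \<tau> ^ j * inverse (tri \<tau>) ^ c = tri \<tau> ^ (j - c)"
      using False by simp
    then have "fps_nth (tri \<tau> ^ j * Jcol \<tau> m a) j = fps_nth (tri \<tau> ^ (j - c)) (2 * (j - c) - j)"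
      unfolding eq using False by (simp add: fps_X_power_mult_nth mult_2)
    then show ?thesis unfolding ca using False tri_power_palindrome[of j "j - c" \<tau>] by simp
  qed
qed

lemma sum_lower:
  fixes n :: nat
  assumes "i < n"
  shows "(\<Sum>k<n. (if k \<le> i then F k else 0) * G k) = (\<Sum>k\<le>i. F k * (G k :: 'a::comm_ring_1))"
proof -
  have "(\<Sum>k<n. (if k \<le> i then F k else 0) * G k) = (\<Sum>k\<le>i. (if k \<le> i then F k else 0) * G k)"
    using assms by (intro sum.mono_neutral_right) auto
  then show ?thesis by simp
qed

text \<open>The multiplier may vary with the row, because row \<open>j\<close> reads only
  coefficient \<open>j\<close>: it is changed by multiples of earlier rows only.\<close>

lemma det_fps_mult:
  assumes "\<And>j. j < n \<Longrightarrow> fps_nth (U j) 0 = (1 :: complex)"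
  shows "det (mat n n (\<lambda>(j, a). fps_nth (U j * G a) j)) = det (mat n n (\<lambda>(j, a). fps_nth (G a) j))"
proof (rule det_unit_lower_mult[where L = "\<lambda>j i. if i \<le> j then fps_nth (U j) (j - i) else 0"])
  fix j a assume "j < n" "a < n"
  then show "fps_nth (U j * G a) j = (\<Sum>k<n. (if k \<le> j then fps_nth (U j) (j - k) else 0) * fps_nth (G a) k)"
    unfolding sum_lower[OF \<open>j < n\<close>] mult.commute[of "U j" "G a"] fps_mult_nth atLeast0AtMost
    by (simp only: mult.commute)
qed (use assms in auto)

text \<open>Two unitriangular reductions with a transposition between them: the first acts on the
  coefficient index and produces trinomial numbers, the second removes the factor
  \<open>tri^j\<close> from row \<open>j\<close>.\<close>

lemma spin1_det_Jcol:
  fixes m :: nat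
  defines "N \<equiv> 2 * m + 2"
  shows "det (mat N N (\<lambda>(a, j). coeff (spin1_poly \<tau> m j) a)) = det (mat N N (\<lambda>(i, a). fps_nth (Jcol \<tau> m a) i))"
proof -
  define M where "M a j = (if m \<le> a + j then fps_nth (tri \<tau> ^ (a + j - m)) j else 0)" for a j
  have "det (mat N N (\<lambda>(a, j). coeff (spin1_poly \<tau> m j) a)) = det (mat N N (\<lambda>(a, j). M a j))"
  proof (rule det_unit_lower_mult[symmetric, where L = "\<lambda>a b. if b \<le> a then
      fps_nth ((1 + fps_X) ^ a * inverse (1 + fps_X) ^ m) (a - b) else 0"])
    fix a j assume "a < N" "j < N"
    then show "M a j = (\<Sum>k<N. (if k \<le> a then fps_nth ((1 + fps_X) ^ a * inverse (1 + fps_X) ^ m) (a - k) else 0)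
        * coeff (spin1_poly \<tau> m j) k)"
      by (subst sum_lower) (simp_all add: spin1_coeff_transform N_def M_def)
  qed (auto simp: fps_nth_power_0)
  also have "\<dots> = det (mat N N (\<lambda>(j, a). M a j))" by (rule det_swap_index[symmetric])
  also have "\<dots> = det (mat N N (\<lambda>(j, a). fps_nth (tri \<tau> ^ j * Jcol \<tau> m a) j))"
    by (simp only: M_def tri_mult_Jcol_nth)
  also have "\<dots> = det (mat N N (\<lambda>(i, a). fps_nth (Jcol \<tau> m a) i))"
    by (rule det_fps_mult) (simp add: fps_nth_power_0 tri_def)
  finally show ?thesis .
qed

definition Hcol :: "complex \<Rightarrow> nat \<Rightarrow> nat \<Rightarrow> complex fps" where
  "Hcol \<tau> m b = (if b \<le> m then qser \<tau> ^ (m - b) else fps_X * qser \<tau> ^ (b - m - 1))"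

text \<open>The columns have the orders \<open>0, ..., 2 * m + 1\<close> with leading coefficient 1,
  so only the sign of their arrangement matters. Passing to \<open>Suc m\<close> adds a last column
  of order \<open>2 * m + 3\<close> and a first column of order \<open>2 * m + 2\<close>; expanding
  along them gives the sign \<open>+\<close> both times.\<close>

lemma det_Hcol: "det (mat (2 * m + 2) (2 * m + 2) (\<lambda>(i, b). fps_nth (Hcol \<tau> m b) i)) = 1"
proof (induction m)
  case 0
  show ?case by (rule det_unit_lower) (auto simp: Hcol_def less_Suc_eq numeral_2_eq_2)
next
  case (Suc m)
  define A where "A = mat (2 * m + 4) (2 * m + 4) (\<lambda>(i, b). fps_nth (Hcol \<tau> (Suc m) b) i)"
  define B where "B = mat (2 * m + 3) (2 * m + 3) (\<lambda>(i, b). fps_nth (Hcol \<tau> (Suc m) b) i)"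
  have last: "A $$ (i, 2 * m + 3) = (if i = 2 * m + 3 then 1 else 0)" if "i < 2 * m + 4" for i
    using that qser_power_nth_less[of "i - 1" "Suc m" \<tau>] qser_power_nth[of \<tau> "Suc m"]
    by (cases i) (auto simp: A_def Hcol_def)
  have first: "B $$ (i, 0) = (if i = 2 * m + 2 then 1 else 0)" if "i < 2 * m + 3" for i
    using that qser_power_nth_less[of i "Suc m" \<tau>] qser_power_nth[of \<tau> "Suc m"]
    by (auto simp: B_def Hcol_def)
  have "det A = (\<Sum>i<2 * m + 4. A $$ (i, 2 * m + 3) * cofactor A i (2 * m + 3))"
    by (rule laplace_expansion_column) (auto simp: A_def)
  also have "\<dots> = (\<Sum>i<2 * m + 4. if i = 2 * m + 3 then cofactor A i (2 * m + 3) else 0)"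
    by (intro sum.cong refl) (simp add: last)
  also have "\<dots> = det (mat_delete A (2 * m + 3) (2 * m + 3))"
    by (simp add: cofactor_def)
  also have "mat_delete A (2 * m + 3) (2 * m + 3) = B"
    by (rule eq_matI) (auto simp: mat_delete_def A_def B_def)
  also have "det B = (\<Sum>i<2 * m + 3. B $$ (i, 0) * cofactor B i 0)"
    by (rule laplace_expansion_column) (auto simp: B_def)
  also have "\<dots> = (\<Sum>i<2 * m + 3. if i = 2 * m + 2 then cofactor B i 0 else 0)"
    by (intro sum.cong refl) (simp add: first)
  also have "\<dots> = det (mat_delete B (2 * m + 2) 0)"
    by (simp add: cofactor_def)
  also have "mat_delete B (2 * m + 2) 0 = mat (2 * m + 2) (2 * m + 2) (\<lambda>(i, b). fps_nth (Hcol \<tau> m b) i)"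
    by (rule eq_matI) (auto simp: mat_delete_def B_def Hcol_def)
  finally have "det A = det (mat (2 * m + 2) (2 * m + 2) (\<lambda>(i, b). fps_nth (Hcol \<tau> m b) i))" .
  moreover have "2 * Suc m + 2 = 2 * m + 4" by simp
  ultimately show ?case using Suc.IH unfolding A_def by (simp only:)
qed

text \<open>Coordinates of \<open>Jcol\<close> in the basis \<open>Hcol\<close>. The columns with
  \<open>b \<le> m\<close> are series in \<open>q\<close> alone, which makes the block with
  \<open>b' > m\<close> vanish there.\<close>

definition Ccoef :: "complex \<Rightarrow> nat \<Rightarrow> nat \<Rightarrow> nat \<Rightarrow> complex" where
  "Ccoef \<tau> m b' b =
    (if b \<le> m then (if b' \<le> m then fps_nth (pser ^ (m - b)) (m - b') else 0)
     else if b' \<le> m then fps_nth (even_part \<tau> (b - m - 1)) (m - b')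
     else \<tau> * fps_nth (odd_part \<tau> (b - m - 1)) (b' - m - 1))"

lemma sum_two_blocks:
  "(\<Sum>b<2 * m + 2. F b) = (\<Sum>k<Suc m. F (m - k)) + (\<Sum>k<Suc m. F (Suc m + k) :: 'a::comm_monoid_add)"
proof -
  have split: "(\<Sum>b<a + c. F b) = (\<Sum>b<a. F b) + (\<Sum>k<c. F (a + k))" for a c
    by (induction c) (simp_all add: add.assoc)
  have "(\<Sum>b<2 * m + 2. F b) = (\<Sum>b<Suc m. F b) + (\<Sum>k<Suc m. F (Suc m + k))"
    using split[of "Suc m" "Suc m"] by (simp add: mult_2)
  also have "(\<Sum>b<Suc m. F b) = (\<Sum>k<Suc m. F (m - k))"
    using sum.nat_diff_reindex[of F "Suc m"] by simp
  finally show ?thesis .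
qed

lemma Jcol_expand:
  assumes "i < 2 * m + 2"
  shows "fps_nth (Jcol \<tau> m b) i = (\<Sum>b'<2 * m + 2. fps_nth (Hcol \<tau> m b') i * Ccoef \<tau> m b' b)"
proof -
  have i: "i < 2 * Suc m" using assms by simp
  show ?thesis
  proof (cases "b \<le> m")
    case True
    have "Jcol \<tau> m b = pser ^ (m - b) oo qser \<tau>"
      using True by (simp add: Jcol_def X2_div_tri compose_qser_simps)
    then have "fps_nth (Jcol \<tau> m b) i = (\<Sum>k<Suc m. fps_nth (pser ^ (m - b)) k * fps_nth (qser \<tau> ^ k) i)"
      by (simp only: compose_qser_nth[OF i])
    also have "\<dots> = (\<Sum>k<Suc m. fps_nth (Hcol \<tau> m (m - k)) i * Ccoef \<tau> m (m - k) b)"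
      using True by (intro sum.cong refl) (simp add: Hcol_def Ccoef_def)
    moreover have "(\<Sum>k<Suc m. fps_nth (Hcol \<tau> m (Suc m + k)) i * Ccoef \<tau> m (Suc m + k) b) = 0"
      using True by (intro sum.neutral) (simp add: Ccoef_def)
    ultimately show ?thesis by (simp only: sum_two_blocks add_0_right)
  next
    case False
    define c where "c = b - m - 1"
    have b: "b - m = Suc c" using False by (simp add: c_def)
    have "fps_nth (Jcol \<tau> m b) i = fps_nth (even_part \<tau> c oo qser \<tau>) i + \<tau> * fps_nth (fps_X * (odd_part \<tau> c oo qser \<tau>)) i"
      using False unfolding Jcol_def b tri_power_split by simp
    also have "\<dots> = (\<Sum>k<Suc m. fps_nth (even_part \<tau> c) k * fps_nth (qser \<tau> ^ k) i)
      + (\<Sum>k<Suc m. \<tau> * fps_nth (odd_part \<tau> c) k * fps_nth (fps_X * qser \<tau> ^ k) i)"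
      by (simp only: compose_qser_nth[OF i] X_compose_qser_nth[OF i] sum_distrib_left mult.assoc)
    also have "\<dots> = (\<Sum>k<Suc m. fps_nth (Hcol \<tau> m (m - k)) i * Ccoef \<tau> m (m - k) b)
      + (\<Sum>k<Suc m. fps_nth (Hcol \<tau> m (Suc m + k)) i * Ccoef \<tau> m (Suc m + k) b)"
      using False by (intro arg_cong2[of _ _ _ _ "(+)"] sum.cong refl)
        (simp_all add: Hcol_def Ccoef_def c_def del: fps_X_mult_nth)
    finally show ?thesis by (simp only: sum_two_blocks)
  qed
qed

text \<open>Multiplying row \<open>j\<close> by \<open>(1 + X)^j\<close> collects all binomial
  powers into \<open>(1 + X)^(i + j + 1)\<close>, whose coefficient of index \<open>j - k\<close> is
  \<open>(i + j + 1) choose (i + k + 1)\<close>.\<close>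

lemma odd_part_det: "det (mat n n (\<lambda>(c, k). fps_nth (odd_part \<tau> c) k)) = asm_det n (\<tau> ^ 2)"
proof -
  have entry: "fps_nth ((1 + fps_X) ^ j * odd_part \<tau> i) j = (\<Sum>k<n.
     of_nat ((i + j + 1) choose (i + k + 1)) * of_nat ((i + k + 1) choose (2 * k + 1)) * (\<tau> ^ 2) ^ k)" if "j < n" for i j
  proof -
    have "(1 + fps_X) ^ j * odd_part \<tau> i = eps i (fps_const (\<tau> ^ 2) * fps_X) * (1 + fps_X) ^ (i + j + 1)"
      by (simp add: odd_part_def power_add algebra_simps)
    then have "fps_nth ((1 + fps_X) ^ j * odd_part \<tau> i) j
      = (\<Sum>k\<le>j. of_nat ((i + k + 1) choose (2 * k + 1)) * (\<tau> ^ 2) ^ k * of_nat ((i + j + 1) choose (j - k)))"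
      by (simp only: fps_mult_nth fps_eps_nth fps_one_plus_X_power_nth atLeast0AtMost)
    also have "\<dots> = (\<Sum>k\<le>j. of_nat ((i + j + 1) choose (i + k + 1)) * of_nat ((i + k + 1) choose (2 * k + 1)) * (\<tau> ^ 2) ^ k)"
    proof (intro sum.cong refl)
      fix k assume "k \<in> {..j}"
      then have "(i + j + 1) choose (i + k + 1) = (i + j + 1) choose ((i + j + 1) - (i + k + 1))"
        by (intro binomial_symmetric) simp
      moreover have "(i + j + 1) - (i + k + 1) = j - k" by simp
      ultimately have "(i + j + 1) choose (i + k + 1) = (i + j + 1) choose (j - k)" by (simp only:)
      then show "of_nat ((i + k + 1) choose (2 * k + 1)) * (\<tau> ^ 2) ^ k * of_nat ((i + j + 1) choose (j - k))
        = of_nat ((i + j + 1) choose (i + k + 1)) * of_nat ((i + k + 1) choose (2 * k + 1)) * (\<tau> ^ 2) ^ k"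
        by (simp only: mult.assoc mult.commute mult.left_commute)
    qed
    also have "\<dots> = (\<Sum>k<n. of_nat ((i + j + 1) choose (i + k + 1)) * of_nat ((i + k + 1) choose (2 * k + 1)) * (\<tau> ^ 2) ^ k)"
    proof (intro sum.mono_neutral_left ballI)
      fix k assume "k \<in> {..<n} - {..j}"
      then have "(i + j + 1) choose (i + k + 1) = 0" by (intro binomial_eq_0) auto
      then show "of_nat ((i + j + 1) choose (i + k + 1)) * of_nat ((i + k + 1) choose (2 * k + 1)) * (\<tau> ^ 2) ^ k = 0"
        by (simp only: of_nat_0 mult_zero_left)
    qed (use that in auto)
    finally show ?thesis .
  qed
  have "det (mat n n (\<lambda>(c, k). fps_nth (odd_part \<tau> c) k)) = det (mat n n (\<lambda>(k, c). fps_nth (odd_part \<tau> c) k))"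
    by (rule det_swap_index[symmetric])
  also have "\<dots> = det (mat n n (\<lambda>(j, i). fps_nth ((1 + fps_X) ^ j * odd_part \<tau> i) j))"
    by (rule det_fps_mult[symmetric]) (simp add: fps_nth_power_0)
  also have "\<dots> = det (mat n n (\<lambda>(j, i). \<Sum>k<n.
     of_nat ((i + j + 1) choose (i + k + 1)) * of_nat ((i + k + 1) choose (2 * k + 1)) * (\<tau> ^ 2) ^ k))"
    by (intro arg_cong[of _ _ det] eq_matI) (auto simp only: entry index_mat dim_row_mat dim_col_mat split)
  also have "\<dots> = asm_det n (\<tau> ^ 2)"
    unfolding asm_det_def by (rule det_swap_index)
  finally show ?thesis .
qed

text \<open>The block of powers of \<open>pser\<close> is unitriangular; the odd parts of the
  \<open>Suc m\<close> positive powers of \<open>tri\<close> contribute one factor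
  \<open>\<tau>\<close> each.\<close>

lemma det_Ccoef: "det (mat (2 * m + 2) (2 * m + 2) (\<lambda>(b', b). Ccoef \<tau> m b' b)) = \<tau> ^ Suc m * asm_det (Suc m) (\<tau> ^ 2)"
proof -
  define A1 where "A1 = mat (Suc m) (Suc m) (\<lambda>(b, b'). fps_nth (pser ^ (m - b)) (m - b'))"
  define A3 where "A3 = mat (Suc m) (Suc m) (\<lambda>(c, b'). fps_nth (even_part \<tau> c) (m - b'))"
  define A4 where "A4 = mat (Suc m) (Suc m) (\<lambda>(c, k). \<tau> * fps_nth (odd_part \<tau> c) k)"
  have "det (mat (2 * m + 2) (2 * m + 2) (\<lambda>(b', b). Ccoef \<tau> m b' b)) = det (mat (2 * m + 2) (2 * m + 2) (\<lambda>(b, b'). Ccoef \<tau> m b' b))"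
    by (rule det_swap_index[symmetric])
  also have "mat (2 * m + 2) (2 * m + 2) (\<lambda>(b, b'). Ccoef \<tau> m b' b) = four_block_mat A1 (0\<^sub>m (Suc m) (Suc m)) A3 A4"
    by (rule eq_matI) (auto simp: four_block_mat_def Let_def A1_def A3_def A4_def Ccoef_def)
  also have "det \<dots> = det A1 * det A4"
    by (rule det_four_block_mat_upper_right_zero[of _ "Suc m" _ "Suc m"]) (auto simp: A1_def A3_def A4_def)
  also have "det A1 = 1"
    unfolding A1_def
  proof (rule det_unit_lower)
    fix i k assume "i < k" "k < Suc m"
    then show "fps_nth (pser ^ (m - i)) (m - k) = 0" by (auto simp: pser_power fps_X_power_mult_nth)
  qed (simp add: pser_power fps_X_power_mult_nth fps_nth_power_0)
  also have "A4 = \<tau> \<cdot>\<^sub>m mat (Suc m) (Suc m) (\<lambda>(c, k). fps_nth (odd_part \<tau> c) k)"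
    by (rule eq_matI) (auto simp: A4_def)
  finally show ?thesis by (simp add: odd_part_det)
qed

theorem spin1_det_even:
  "det (mat (2 * m + 2) (2 * m + 2) (\<lambda>(a, j). coeff (spin1_poly \<tau> m j) a)) = \<tau> ^ Suc m * asm_det (Suc m) (\<tau> ^ 2)"
proof -
  have "det (mat (2 * m + 2) (2 * m + 2) (\<lambda>(i, b). fps_nth (Jcol \<tau> m b) i))
    = det (mat (2 * m + 2) (2 * m + 2) (\<lambda>(i, b). fps_nth (Hcol \<tau> m b) i)) * det (mat (2 * m + 2) (2 * m + 2) (\<lambda>(b', b). Ccoef \<tau> m b' b))"
    by (rule det_mult_mat) (rule Jcol_expand)
  then show ?thesis by (simp only: spin1_det_Jcol det_Hcol det_Ccoef mult_1)
qed

lemma spin1_poly_Suc: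
  assumes "j \<le> 2 * m + 1"
  shows "spin1_poly \<tau> (Suc m) j = pCons 0 (spin1_poly \<tau> m j)"
proof -
  have "spin1_poly \<tau> (Suc m) j = (\<Sum>r\<le>j. [:0, 1:] * smult (of_nat (r choose (j - r)) * \<tau> ^ (2 * r - j)) ([:1, 1:] ^ j * monom 1 (m + r - j)))"
    unfolding spin1_poly_def
  proof (intro sum.cong refl)
    fix r
    show "smult (of_nat (r choose (j - r)) * \<tau> ^ (2 * r - j)) ([:1, 1:] ^ j * monom 1 (Suc m + r - j))
      = [:0, 1:] * smult (of_nat (r choose (j - r)) * \<tau> ^ (2 * r - j)) ([:1, 1:] ^ j * monom 1 (m + r - j))"
    proof (cases "j \<le> 2 * r")
      case True
      then have "Suc m + r - j = Suc (m + r - j)" using assms by simp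
      then show ?thesis by (simp add: monom_Suc)
    next
      case False
      then have "r choose (j - r) = 0" by (intro binomial_eq_0) simp
      then show ?thesis by (simp only: of_nat_0 mult_zero_left smult_0_left mult_zero_right)
    qed
  qed
  also have "\<dots> = [:0, 1:] * spin1_poly \<tau> m j"
    unfolding spin1_poly_def by (simp only: sum_distrib_left)
  finally show ?thesis by simp
qed

lemma spin1_poly_coeff_0:
  assumes "j \<le> 2 * n"
  shows "coeff (spin1_poly \<tau> n j) 0 = (if j = 2 * n then 1 else 0)"
proof -
  have "coeff (spin1_poly \<tau> n j) 0 = (\<Sum>r\<le>j. of_nat (r choose (j - r)) * \<tau> ^ (2 * r - j) * (if n + r - j = 0 then 1 else 0))"
    by (simp add: spin1_poly_def coeff_sum coeff_mult_0 coeff_0_power)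
  also have "\<dots> = (\<Sum>r\<le>j. if r = n then (if j = 2 * n then 1 else 0) else 0)"
  proof (intro sum.cong refl)
    fix r assume r: "r \<in> {..j}"
    show "of_nat (r choose (j - r)) * \<tau> ^ (2 * r - j) * (if n + r - j = 0 then 1 else 0)
      = (if r = n then (if j = 2 * n then 1 else 0) else (0 :: complex))"
    proof (cases "j \<le> 2 * r")
      case True
      then show ?thesis using assms by auto
    next
      case False
      then have "r choose (j - r) = 0" by (intro binomial_eq_0) simp
      then show ?thesis using False by auto
    qed
  qed
  finally show ?thesis by auto
qed

text \<open>At \<open>p = 0\<close> all columns vanish except \<open>j = 2 * m + 2\<close>, which
  has the value 1, so row 0 splits off. The other columns are divisible by \<open>p\<close>, and
  dropping row 0 removes that factor, which leaves the even determinant.\<close>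

theorem spin1_det_odd:
  "det (mat (2 * m + 3) (2 * m + 3) (\<lambda>(a, j). coeff (spin1_poly \<tau> (Suc m) j) a)) = \<tau> ^ Suc m * asm_det (Suc m) (\<tau> ^ 2)"
proof -
  define A where "A = mat (2 * m + 3) (2 * m + 3) (\<lambda>(a, j). coeff (spin1_poly \<tau> (Suc m) j) a)"
  have "det A = (\<Sum>j<2 * m + 3. A $$ (0, j) * cofactor A 0 j)"
    by (rule laplace_expansion_row) (auto simp: A_def)
  also have "\<dots> = (\<Sum>j<2 * m + 3. if j = 2 * m + 2 then cofactor A 0 j else 0)"
    by (intro sum.cong refl) (auto simp: A_def spin1_poly_coeff_0)
  also have "\<dots> = det (mat_delete A 0 (2 * m + 2))"
    by (simp add: cofactor_def)
  also have "mat_delete A 0 (2 * m + 2) = mat (2 * m + 2) (2 * m + 2) (\<lambda>(a, j). coeff (spin1_poly \<tau> m j) a)"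
    by (rule eq_matI) (auto simp: mat_delete_def A_def spin1_poly_Suc)
  finally show ?thesis by (simp only: A_def spin1_det_even)
qed

subsection \<open>The spin-one model\<close>

text \<open>Here \<open>u = - [z] / [q z]\<close>, so that \<open>z = 1\<close> is
  \<open>u = 0\<close>. Divided by \<open>[q z]\<close>, the diagonal entries of
  \<open>R(z / q)\<close> become \<open>1\<close>, \<open>- u\<close> and
  \<open>- (1 + \<tau> u)\<close> with \<open>\<tau> = q + 1 / q\<close>, and the product of
  opposite off-diagonal entries becomes \<open>sr\<close>, because
  \<open>[z]^2 - [q z] [z / q] = [q]^2\<close>.\<close>

definition sX :: "complex \<Rightarrow> complex \<Rightarrow> complex" where "sX \<tau> u = - (1 + \<tau> * u)"
definition sr :: "complex \<Rightarrow> complex \<Rightarrow> complex" where "sr \<tau> u = \<tau> * (1 + \<tau> * u + u * u)"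
definition sN :: "complex \<Rightarrow> complex \<Rightarrow> complex \<Rightarrow> complex" where "sN \<tau> z j = 1 + \<tau> * z + z * j"
definition sf :: "complex \<Rightarrow> complex \<Rightarrow> complex \<Rightarrow> complex" where "sf \<tau> z j = sN \<tau> z j / (z - j)"
definition sg :: "complex \<Rightarrow> complex \<Rightarrow> complex \<Rightarrow> complex" where "sg \<tau> z j = - (sN \<tau> z z) / (z - j)"

lemma sf_swap: "sf \<tau> j z = - (sN \<tau> j z / (z - j))"
  unfolding sf_def by (metis minus_diff_eq minus_divide_right)

text \<open>Both sides are quadratic in \<open>z\<close>; \<open>e2\<close>, \<open>e1\<close>,
  \<open>e0\<close> compare the three coefficients, which involve only \<open>a\<close>,
  \<open>b\<close>, \<open>c\<close>.\<close>

lemma three_body_identity: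
  fixes a b c z t :: "'a::comm_ring_1"
  defines "N \<equiv> \<lambda>i j. 1 + t * i + i * j"
  shows "(1 + t * c) * N a c * N b c * (z - a) * (z - b) * (a - b) - (1 + t * b) * N a b * N c b * (z - a) * (z - c) * (a - c)
      + (1 + t * a) * N b a * N c a * (z - b) * (z - c) * (b - c)
    = - N c a * N c b * N a z * N b z * (a - b) + N b a * N b c * N a z * N c z * (a - c) - N a b * N a c * N b z * N c z * (b - c)"
proof -
  define A B C where "A = 1 + t * a" and "B = 1 + t * b" and "C = 1 + t * c"
  have e2: "C * N a c * N b c * (a - b) - B * N a b * N c b * (a - c) + A * N b a * N c a * (b - c)
    = - N c a * N c b * (a * b) * (a - b) + N b a * N b c * (a * c) * (a - c) - N a b * N a c * (b * c) * (b - c)"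
    unfolding N_def A_def B_def C_def by (simp add: algebra_simps)
  have e1: "- C * N a c * N b c * (a - b) * (a + b) + B * N a b * N c b * (a - c) * (a + c) - A * N b a * N c a * (b - c) * (b + c)
    = - N c a * N c b * (a * B + b * A) * (a - b) + N b a * N b c * (a * C + c * A) * (a - c) - N a b * N a c * (b * C + c * B) * (b - c)"
    unfolding N_def A_def B_def C_def by (simp add: algebra_simps)
  have e0: "C * N a c * N b c * (a - b) * (a * b) - B * N a b * N c b * (a - c) * (a * c) + A * N b a * N c a * (b - c) * (b * c)
    = - N c a * N c b * (A * B) * (a - b) + N b a * N b c * (A * C) * (a - c) - N a b * N a c * (B * C) * (b - c)"
    unfolding N_def A_def B_def C_def by (simp add: algebra_simps)
  have Nz: "N a z = A + a * z" "N b z = B + b * z" "N c z = C + c * z" by (simp_all add: N_def A_def B_def C_def)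
  have "C * N a c * N b c * (z - a) * (z - b) * (a - b) - B * N a b * N c b * (z - a) * (z - c) * (a - c)
      + A * N b a * N c a * (z - b) * (z - c) * (b - c)
    = z * z * (C * N a c * N b c * (a - b) - B * N a b * N c b * (a - c) + A * N b a * N c a * (b - c))
      + z * (- C * N a c * N b c * (a - b) * (a + b) + B * N a b * N c b * (a - c) * (a + c) - A * N b a * N c a * (b - c) * (b + c))
      + (C * N a c * N b c * (a - b) * (a * b) - B * N a b * N c b * (a - c) * (a * c) + A * N b a * N c a * (b - c) * (b * c))"
    by (simp add: algebra_simps)
  also have "\<dots> = - N c a * N c b * N a z * N b z * (a - b) + N b a * N b c * N a z * N c z * (a - c) - N a b * N a c * N b z * N c z * (b - c)"
    unfolding e0 e1 e2 Nz by (simp add: algebra_simps)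
  finally show ?thesis by (simp only: A_def B_def C_def)
qed

interpretation spin1: bethe "sX \<tau>" "\<lambda>u. - u" "\<lambda>u. - u" "sX \<tau>" "\<lambda>u. 1" "sr \<tau>" "sr \<tau>" "sf \<tau>" "sg \<tau>" 1
  for \<tau> :: complex
proof (unfold_locales, goal_cases)
  case (1 z i)
  \<comment> \<open>The differences are named so that denominators can be cleared before anything is
    expanded; the same device is used in the other cases.\<close>
  define p where "p = z - i"
  have "p \<noteq> 0" using 1 by (simp add: p_def)
  then show ?case unfolding sg_def sf_swap[of \<tau> i z] p_def[symmetric]
    by (simp add: divide_simps) (simp add: sN_def sX_def p_def algebra_simps)
next
  case (2 z i)
  define p where "p = z - i"
  have "p \<noteq> 0" using 2 by (simp add: p_def)
  then show ?case unfolding sg_def p_def[symmetric]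
    by (simp add: divide_simps) (simp add: sN_def sX_def sr_def p_def algebra_simps)
next
  case (3 z i)
  define p where "p = z - i"
  have "p \<noteq> 0" using 3 by (simp add: p_def)
  then show ?case unfolding sg_def sf_def p_def[symmetric]
    by (simp add: divide_simps) (simp add: sN_def p_def algebra_simps)
next
  case (4 z i j)
  define p q r where "p = z - i" and "q = z - j" and "r = i - j"
  have "p \<noteq> 0" "q \<noteq> 0" "r \<noteq> 0" using 4 by (simp_all add: p_def q_def r_def)
  then show ?case unfolding sg_def sf_swap[of \<tau> i z] sf_swap[of \<tau> j z] sf_swap[of \<tau> j i] sf_def[of \<tau> i j]
      p_def[symmetric] q_def[symmetric] r_def[symmetric]
    by (simp add: divide_simps) (simp add: sN_def sX_def sr_def p_def q_def r_def algebra_simps)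
next
  case (5 z i j)
  define p q r where "p = z - i" and "q = z - j" and "r = i - j"
  have "p \<noteq> 0" "q \<noteq> 0" "r \<noteq> 0" using 5 by (simp_all add: p_def q_def r_def)
  then show ?case unfolding sg_def sf_swap[of \<tau> i z] sf_swap[of \<tau> j z] sf_swap[of \<tau> j i] sf_def[of \<tau> i j]
      p_def[symmetric] q_def[symmetric] r_def[symmetric]
    by (simp add: divide_simps) (simp add: sN_def sX_def sr_def p_def q_def r_def algebra_simps)
next
  case (6 z i j)
  define p q r where "p = z - i" and "q = z - j" and "r = i - j"
  have "p \<noteq> 0" "q \<noteq> 0" "r \<noteq> 0" using 6 by (simp_all add: p_def q_def r_def)
  then show ?case unfolding sg_def sf_def[of \<tau> z] sf_swap[of \<tau> j i] sf_def[of \<tau> i j]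
      p_def[symmetric] q_def[symmetric] r_def[symmetric]
    by (simp add: divide_simps) (simp add: sN_def sX_def sr_def p_def q_def r_def algebra_simps)
next
  \<comment> \<open>This is \<open>A_DDn2\<close>. After multiplication by all six differences the
    factor \<open>sN \<tau> z z\<close>, common to the \<open>sg\<close>, comes out, and
    \<open>three_body_identity\<close> remains.\<close>
  case (7 z a b c)
  define za zb zc ab ac bc where "za = z - a" and "zb = z - b" and "zc = z - c"
    and "ab = a - b" and "ac = a - c" and "bc = b - c"
  have nz: "za \<noteq> 0" "zb \<noteq> 0" "zc \<noteq> 0" "ab \<noteq> 0" "ac \<noteq> 0" "bc \<noteq> 0"
    using 7 by (simp_all add: za_def zb_def zc_def ab_def ac_def bc_def)
  define D where "D = za * zb * zc * ab * ac * bc"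
  have D: "D \<noteq> 0" using nz by (simp add: D_def)
  let ?N = "sN \<tau>" and ?M = "sN \<tau> z z" and ?X = "sX \<tau>"
  note folds = za_def[symmetric] zb_def[symmetric] zc_def[symmetric] ab_def[symmetric] ac_def[symmetric] bc_def[symmetric]
  have f: "sf \<tau> b a = - (?N b a / ab)" "sf \<tau> c a = - (?N c a / ac)" "sf \<tau> c b = - (?N c b / bc)"
    "sf \<tau> a z = - (?N a z / za)" "sf \<tau> b z = - (?N b z / zb)" "sf \<tau> c z = - (?N c z / zc)"
    by (simp_all only: sf_swap[of \<tau> b a] sf_swap[of \<tau> c a] sf_swap[of \<tau> c b] sf_swap[of \<tau> a z] sf_swap[of \<tau> b z]
      sf_swap[of \<tau> c z] folds)
  have f': "sf \<tau> a b = ?N a b / ab" "sf \<tau> a c = ?N a c / ac" "sf \<tau> b c = ?N b c / bc"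
    "sg \<tau> z a = - ?M / za" "sg \<tau> z b = - ?M / zb" "sg \<tau> z c = - ?M / zc"
    by (simp_all only: sf_def sg_def folds)
  have "(?X c * sf \<tau> a c * sf \<tau> b c * sg \<tau> z c + ?X b * sf \<tau> a b * sf \<tau> c b * sg \<tau> z b + ?X a * sf \<tau> b a * sf \<tau> c a * sg \<tau> z a) * D
    = ?M * (- ?X c * ?N a c * ?N b c * za * zb * ab + ?X b * ?N a b * ?N c b * za * zc * ac - ?X a * ?N b a * ?N c a * zb * zc * bc)"
    unfolding f f' D_def using nz by (simp add: distrib_left distrib_right) (simp add: field_simps)
  also have "\<dots> = ?M * (- ?N c a * ?N c b * ?N a z * ?N b z * ab + ?N b a * ?N b c * ?N a z * ?N c z * ac - ?N a b * ?N a c * ?N b z * ?N c z * bc)"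
  proof (rule arg_cong[of _ _ "(*) ?M"])
    show "- ?X c * ?N a c * ?N b c * za * zb * ab + ?X b * ?N a b * ?N c b * za * zc * ac - ?X a * ?N b a * ?N c a * zb * zc * bc
      = - ?N c a * ?N c b * ?N a z * ?N b z * ab + ?N b a * ?N b c * ?N a z * ?N c z * ac - ?N a b * ?N a c * ?N b z * ?N c z * bc"
      using three_body_identity[of \<tau> c a b z]
      unfolding sN_def sX_def za_def zb_def zc_def ab_def ac_def bc_def minus_minus minus_mult_left[symmetric] diff_minus_eq_add by simp
  qed
  also have "\<dots> = (sg \<tau> z c * sf \<tau> c a * sf \<tau> c b * sf \<tau> a z * sf \<tau> b z + sg \<tau> z b * sf \<tau> b a * sf \<tau> b c * sf \<tau> a z * sf \<tau> c z
      + sg \<tau> z a * sf \<tau> a b * sf \<tau> a c * sf \<tau> b z * sf \<tau> c z) * D"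
    unfolding f f' D_def using nz by (simp add: distrib_left distrib_right) (simp add: field_simps)
  finally show ?case using D by simp
qed

section \<open>Rows of the spin-one model and the limit of rapidity 0\<close>

definition brow :: "complex \<Rightarrow> complex \<Rightarrow> (spin_one list \<Rightarrow> complex) \<Rightarrow> spin_one list \<Rightarrow> complex" where
  "brow \<tau> u R \<sigma> = rowop (spin1.wt \<tau> u) Up \<sigma> Dn R"

lemma spin1_bw_rows:
  "distinct us \<Longrightarrow> foldr (brow \<tau>) us (\<lambda>\<sigma>. spin1.bw \<tau> \<sigma> {}) = (\<lambda>\<sigma>. spin1.bw \<tau> \<sigma> (set us))"
  using spin1.bw_rows[of us \<tau>] by (simp add: brow_def[abs_def])

lemma tendsto_rowop:
  fixes W :: "'c \<Rightarrow> _ \<Rightarrow> _ \<Rightarrow> complex"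
  assumes "\<And>v w. ((\<lambda>e. W e v w) \<longlongrightarrow> W' v w) F" "\<And>\<rho>. ((\<lambda>e. R e \<rho>) \<longlongrightarrow> R' \<rho>) F"
  shows "((\<lambda>e. rowop (W e) \<gamma> \<sigma> \<alpha> (R e)) \<longlongrightarrow> rowop W' \<gamma> \<sigma> \<alpha> R') F"
  using assms(2)
proof (induction \<sigma> arbitrary: \<alpha> R R')
  case Nil
  then show ?case by simp
next
  case (Cons x \<sigma>)
  then show ?case by (auto intro!: tendsto_intros assms(1))
qed

lemma tendsto_wts:
  fixes x m d x' e h r1 r2 :: "'c \<Rightarrow> complex"
  assumes "(x \<longlongrightarrow> x0) F" "(m \<longlongrightarrow> m0) F" "(d \<longlongrightarrow> d0) F" "(x' \<longlongrightarrow> x0') F" "(e \<longlongrightarrow> e0) F"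
    "(r1 \<longlongrightarrow> r10) F" "(r2 \<longlongrightarrow> r20) F"
  shows "((\<lambda>t. wts (x t) (m t) (d t) (x' t) (e t) h0 (r1 t) (r2 t) v w) \<longlongrightarrow> wts x0 m0 d0 x0' e0 h0 r10 r20 v w) F"
proof -
  obtain a b where v: "v = (a, b)" by (cases v)
  show ?thesis unfolding wts_def v
    by (cases a; cases b) (auto intro!: assms tendsto_const)
qed

text \<open>Positive multiples of \<open>e\<close>: then \<open>u + v\<close> is of exact order
  \<open>e\<close> and dominates \<open>\<tau> * u * v\<close>, which keeps the values of
  \<open>pn\<close> apart in \<open>eventually_good_nodes\<close>.\<close>

definition node :: "real \<Rightarrow> nat \<Rightarrow> complex" where
  "node e i = of_real (e * real (Suc i))"

lemma node_tendsto: "((\<lambda>e. node e i) \<longlongrightarrow> 0) (at_right 0)"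
proof -
  have "((\<lambda>e. of_real (e * real (Suc i)) :: complex) \<longlongrightarrow> of_real (0 * real (Suc i))) (at_right 0)"
    by (intro tendsto_intros)
  then show ?thesis by (simp add: node_def)
qed

lemma node_nonzero: "e > 0 \<Longrightarrow> node e i \<noteq> 0"
  unfolding node_def of_real_eq_0_iff by simp

lemma inj_node: "e > 0 \<Longrightarrow> inj (node e)"
  by (auto simp: node_def inj_def)

lemma tendsto_brow:
  assumes "(u \<longlongrightarrow> u0) F" "\<And>\<rho>. ((\<lambda>e. R e \<rho>) \<longlongrightarrow> R' \<rho>) F"
  shows "((\<lambda>e. brow \<tau> (u e) (R e) \<sigma>) \<longlongrightarrow> brow \<tau> u0 R' \<sigma>) F"
  unfolding brow_def sX_def sr_def
  by (intro tendsto_rowop tendsto_wts tendsto_intros assms)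

lemma tendsto_brow_rows:
  "((\<lambda>e. foldr (brow \<tau>) (map (node e) is) R \<sigma>) \<longlongrightarrow> (brow \<tau> 0 ^^ length is) R \<sigma>) (at_right 0)"
proof (induction "is" arbitrary: \<sigma>)
  case Nil
  then show ?case by simp
next
  case (Cons i "is")
  have "((\<lambda>e. brow \<tau> (node e i) (foldr (brow \<tau>) (map (node e) is) R) \<sigma>) \<longlongrightarrow> brow \<tau> 0 ((brow \<tau> 0 ^^ length is) R) \<sigma>) (at_right 0)"
    by (intro tendsto_brow node_tendsto Cons.IH)
  then show ?case by simp
qed

text \<open>The \<open>s\<close>, \<open>x\<close>, \<open>y\<close> of
  \<open>alternant_of_recursion\<close>: replacing \<open>u\<close> by
  \<open>- u / (1 + \<tau> * u)\<close> leaves \<open>pn\<close> unchanged and takes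
  \<open>px\<close> to \<open>py\<close>.\<close>

definition pn :: "complex \<Rightarrow> complex \<Rightarrow> complex" where "pn \<tau> u = u ^ 2 / (1 + \<tau> * u)"
definition px :: "complex \<Rightarrow> complex \<Rightarrow> complex" where "px \<tau> u = inverse u + \<tau> + u"
definition py :: "complex \<Rightarrow> complex \<Rightarrow> complex" where "py \<tau> u = - (inverse u + u / (1 + \<tau> * u))"

lemma pxy_sum: "1 + \<tau> * u \<noteq> 0 \<Longrightarrow> px \<tau> u + py \<tau> u = \<tau> * (1 + pn \<tau> u)"
  unfolding px_def py_def pn_def by (simp add: divide_simps) (simp add: algebra_simps power2_eq_square)

lemma pxy_prod: "u \<noteq> 0 \<Longrightarrow> 1 + \<tau> * u \<noteq> 0 \<Longrightarrow> px \<tau> u * py \<tau> u * pn \<tau> u = - ((1 + pn \<tau> u) ^ 2)"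
  unfolding px_def py_def pn_def by (simp add: divide_simps) (simp add: algebra_simps power2_eq_square)

text \<open>Both differences on the right contain the factor \<open>i + k + \<tau> * i * k\<close>;
  it cancels and leaves the single pole at \<open>i = k\<close>.\<close>

lemma spin1_scattering:
  assumes "i \<noteq> 0" "k \<noteq> 0" "1 + \<tau> * i \<noteq> 0" "1 + \<tau> * k \<noteq> 0" "pn \<tau> k \<noteq> pn \<tau> i"
  shows "sX \<tau> k * sf \<tau> i k = i * k * ((px \<tau> k - py \<tau> i) / (pn \<tau> k - pn \<tau> i))"
proof -
  have ik: "i - k \<noteq> 0" using assms(5) by auto
  have p: "pn \<tau> k - pn \<tau> i = - ((i - k) * (i + k + \<tau> * i * k) / ((1 + \<tau> * i) * (1 + \<tau> * k)))"
    using assms unfolding pn_def by (simp add: divide_simps) (simp add: algebra_simps power2_eq_square)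
  have q: "i + k + \<tau> * i * k \<noteq> 0" using p assms(5) by auto
  have "(px \<tau> k - py \<tau> i) * (i * k * (1 + \<tau> * i)) = sN \<tau> i k * (i + k + \<tau> * i * k)"
    using assms unfolding px_def py_def sN_def
    by (simp add: divide_simps) (simp add: algebra_simps power2_eq_square)
  then have d: "px \<tau> k - py \<tau> i = sN \<tau> i k * (i + k + \<tau> * i * k) / (i * k * (1 + \<tau> * i))"
    by (subst nonzero_eq_divide_eq) (use assms in auto)
  show ?thesis
    unfolding p d sX_def sf_def using assms(1-4) ik q by (simp add: divide_simps) (simp add: algebra_simps)
qed

lemma bw_Zero_pairs:
  assumes "finite S" "\<And>k. k \<in> S \<Longrightarrow> sX \<tau> k \<noteq> 0"
  shows "spin1.bw \<tau> (replicate (2 * n) Zero) S = \<tau> ^ n * (\<Prod>k\<in>S. k / sX \<tau> k) * spin1.bw \<tau> (concat (replicate n [UUp, DDn])) S"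
  using assms
proof (induction n arbitrary: S)
  case 0
  then show ?case by simp
next
  case (Suc n)
  let ?X = "sX \<tau>" and ?f = "sf \<tau>" and ?Z = "replicate (2 * n) Zero" and ?C = "concat (replicate n [UUp, DDn])"
  have "spin1.bw \<tau> (replicate (2 * Suc n) Zero) S
    = (\<Sum>i\<in>S. \<Sum>j\<in>S-{i}. (\<Prod>k\<in>S-{i}. ?X k * ?f i k) * (\<Prod>k\<in>S-{i}-{j}. ?X k * ?f j k) * spin1.bw \<tau> ?Z (S-{i}-{j}))"
    by (simp add: sum_distrib_left mult.assoc)
  also have "\<dots> = (\<Sum>i\<in>S. \<Sum>j\<in>S-{i}. \<tau> ^ Suc n * (\<Prod>k\<in>S. k / ?X k) * ((\<Prod>k\<in>S. ?X k) * (1 / 2 *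
      ((\<Prod>k\<in>S-{i}-{j}. ?X k * ?f i k * ?f j k) * spin1.bw \<tau> ?C (S-{i}-{j})))))"
  proof (rule sum_pairs_eqI[OF Suc.prems(1)])
    fix i j assume ij: "i \<in> S" "j \<in> S" "i \<noteq> j"
    define T where "T = S - {i} - {j}"
    have T: "finite T" "i \<notin> T" "j \<notin> T" "S - {i} = insert j T" "S - {j} = insert i T" "S - {j} - {i} = T" "S - {i} - {j} = T"
      and S: "S = insert i (insert j T)"
      using Suc.prems ij by (auto simp: T_def)
    have X: "?X i \<noteq> 0" "?X j \<noteq> 0" using Suc.prems ij by auto
    have IH: "spin1.bw \<tau> ?Z T = \<tau> ^ n * (\<Prod>k\<in>T. k / ?X k) * spin1.bw \<tau> ?C T"
      using Suc.prems by (intro Suc.IH) (auto simp: T_def)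
    \<comment> \<open>The two orders in which \<open>i\<close> and \<open>j\<close> can be peeled as
      \<open>Zero\<close> sites add up to an expression without a pole. It supplies one
      \<open>\<tau>\<close> per pair and the numerators \<open>k\<close> of the product.\<close>
    have pair: "?X j * ?f i j + ?X i * ?f j i = \<tau> * i * j"
    proof -
      have "?X j * ?f i j + ?X i * ?f j i = (?X j * sN \<tau> i j - ?X i * sN \<tau> j i) / (i - j)"
        unfolding sf_swap[of \<tau> j i] sf_def[of \<tau> i j] by (simp add: diff_divide_distrib)
      also have "?X j * sN \<tau> i j - ?X i * sN \<tau> j i = \<tau> * i * j * (i - j)"
        unfolding sX_def sN_def by (simp add: algebra_simps)
      finally show ?thesis using ij by simp
    qed
    define Q where "Q = (\<Prod>k\<in>T. ?X k) * (\<Prod>k\<in>T. ?f i k) * (\<Prod>k\<in>T. ?X k) * (\<Prod>k\<in>T. ?f j k)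
      * (\<tau> ^ n * (\<Prod>k\<in>T. k / ?X k) * spin1.bw \<tau> ?C T)"
    have "(\<Prod>k\<in>S-{i}. ?X k * ?f i k) * (\<Prod>k\<in>S-{i}-{j}. ?X k * ?f j k) * spin1.bw \<tau> ?Z (S-{i}-{j})
      + (\<Prod>k\<in>S-{j}. ?X k * ?f j k) * (\<Prod>k\<in>S-{j}-{i}. ?X k * ?f i k) * spin1.bw \<tau> ?Z (S-{j}-{i})
      = (?X j * ?f i j + ?X i * ?f j i) * Q"
      unfolding T(6,7) IH unfolding T(4,5) using T(1-3) by (simp add: Q_def prod.distrib algebra_simps)
    also have "\<dots> = \<tau> * i * j * Q" unfolding pair ..
    also have "\<dots> = \<tau> ^ Suc n * (\<Prod>k\<in>S. k / ?X k) * ((\<Prod>k\<in>S. ?X k) * (1 / 2 *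
        ((\<Prod>k\<in>S-{i}-{j}. ?X k * ?f i k * ?f j k) * spin1.bw \<tau> ?C (S-{i}-{j}))))
      + \<tau> ^ Suc n * (\<Prod>k\<in>S. k / ?X k) * ((\<Prod>k\<in>S. ?X k) * (1 / 2 *
        ((\<Prod>k\<in>S-{j}-{i}. ?X k * ?f j k * ?f i k) * spin1.bw \<tau> ?C (S-{j}-{i}))))"
    proof -
      have pS: "(\<Prod>k\<in>S. k / ?X k) = i / ?X i * (j / ?X j) * (\<Prod>k\<in>T. k / ?X k)"
        "(\<Prod>k\<in>S. ?X k) = ?X i * ?X j * (\<Prod>k\<in>T. ?X k)"
        using T(1-3) ij(3) by (simp_all add: S)
      show ?thesis unfolding T(6,7) Q_def pS using X by (simp add: prod.distrib field_simps)
    qed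
    finally show "(\<Prod>k\<in>S-{i}. ?X k * ?f i k) * (\<Prod>k\<in>S-{i}-{j}. ?X k * ?f j k) * spin1.bw \<tau> ?Z (S-{i}-{j})
      + (\<Prod>k\<in>S-{j}. ?X k * ?f j k) * (\<Prod>k\<in>S-{j}-{i}. ?X k * ?f i k) * spin1.bw \<tau> ?Z (S-{j}-{i})
      = \<tau> ^ Suc n * (\<Prod>k\<in>S. k / ?X k) * ((\<Prod>k\<in>S. ?X k) * (1 / 2 *
        ((\<Prod>k\<in>S-{i}-{j}. ?X k * ?f i k * ?f j k) * spin1.bw \<tau> ?C (S-{i}-{j}))))
      + \<tau> ^ Suc n * (\<Prod>k\<in>S. k / ?X k) * ((\<Prod>k\<in>S. ?X k) * (1 / 2 *
        ((\<Prod>k\<in>S-{j}-{i}. ?X k * ?f j k * ?f i k) * spin1.bw \<tau> ?C (S-{j}-{i}))))" .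
  qed
  also have "\<dots> = \<tau> ^ Suc n * (\<Prod>k\<in>S. k / ?X k) * spin1.bw \<tau> (concat (replicate (Suc n) [UUp, DDn])) S"
    by (simp add: sum_distrib_left)
  finally show ?case .
qed

lemma det_row_scale:
  "det (mat n n (\<lambda>(i, j). a i * B i j)) = (\<Prod>i<n. a i) * (det (mat n n (\<lambda>(i, j). B i j)) :: 'a::comm_ring_1)"
proof -
  have "(\<Prod>i=0..<n. a i * B i (p i)) = (\<Prod>i<n. a i) * (\<Prod>i=0..<n. B i (p i))" for p
    by (simp add: prod.distrib atLeast0LessThan)
  moreover have "det (mat n n (\<lambda>(i, j). C i j)) = (\<Sum>p\<in>{p. p permutes {0..<n}}. signof p * (\<Prod>i=0..<n. C i (p i)))"
    for C :: "nat \<Rightarrow> nat \<Rightarrow> 'a"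
    by (subst det_def') (auto intro!: sum.cong prod.cong dest: permutes_in_image)
  ultimately show ?thesis by (simp add: sum_distrib_left mult.left_commute)
qed

definition good_nodes :: "complex \<Rightarrow> complex set \<Rightarrow> bool" where
  "good_nodes \<tau> S \<longleftrightarrow> inj_on (pn \<tau>) S \<and> (\<forall>u\<in>S. u \<noteq> 0 \<and> 1 + \<tau> * u \<noteq> 0 \<and> px \<tau> u \<noteq> py \<tau> u)"

lemma spin1_alternant:
  assumes "distinct us" "good_nodes \<tau> (set us)"
  defines "N \<equiv> length us"
  shows "spin1.bw \<tau> (replicate N Zero) (set us) * det (mat N N (\<lambda>(i, j). pn \<tau> (us ! i) ^ j))
     = (\<Prod>u\<in>set us. u ^ (N - 1)) * det (mat N N (\<lambda>(i, j). hs j (px \<tau> (us ! i)) (py \<tau> (us ! i))))"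
proof -
  \<comment> \<open>The division absorbs the prefactors \<open>i * k\<close> of
    \<open>spin1_scattering\<close>: peeling \<open>i\<close> from \<open>Suc m\<close> rapidities
    produces \<open>i^m\<close> and every other \<open>k\<close> once.\<close>
  define r where "r S = spin1.bw \<tau> (replicate (card S) Zero) S / (\<Prod>u\<in>S. u ^ (card S - 1))" for S
  have "r (set us) * alt us (\<lambda>j k. pn \<tau> k ^ j) = alt us (\<lambda>j k. hs j (px \<tau> k) (py \<tau> k))"
  proof (rule alternant_of_recursion[OF assms(1)])
    show "r {} = 1" by (simp add: r_def)
    show "inj_on (pn \<tau>) (set us)" "\<And>k. k \<in> set us \<Longrightarrow> px \<tau> k \<noteq> py \<tau> k"
      using assms(2) by (auto simp: good_nodes_def)
    fix S assume S: "S \<subseteq> set us" "S \<noteq> {}"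
    then have fin: "finite S" using finite_subset by blast
    have nz: "u \<noteq> 0" "1 + \<tau> * u \<noteq> 0" if "u \<in> S" for u using that assms(2) S by (auto simp: good_nodes_def)
    obtain m where m: "card S = Suc m" using fin S(2) by (metis card_gt_0_iff gr0_conv_Suc)
    have "spin1.bw \<tau> (replicate (card S) Zero) S
      = (\<Sum>i\<in>S. (\<Prod>k\<in>S-{i}. sX \<tau> k * sf \<tau> i k) * spin1.bw \<tau> (replicate m Zero) (S-{i}))"
      by (simp add: m)
    also have "\<dots> = (\<Sum>i\<in>S. (\<Prod>u\<in>S. u ^ m) * ((\<Prod>k\<in>S-{i}. (px \<tau> k - py \<tau> i) / (pn \<tau> k - pn \<tau> i)) * r (S - {i})))"
    proof (intro sum.cong refl)
      fix i assume i: "i \<in> S"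
      have c: "card (S - {i}) = m" using m fin i by simp
      have sc: "sX \<tau> k * sf \<tau> i k = i * k * ((px \<tau> k - py \<tau> i) / (pn \<tau> k - pn \<tau> i))" if "k \<in> S - {i}" for k
      proof (rule spin1_scattering)
        show "pn \<tau> k \<noteq> pn \<tau> i" using assms(2) that i S by (auto simp: good_nodes_def inj_on_def)
      qed (use nz that i in auto)
      have r: "spin1.bw \<tau> (replicate m Zero) (S-{i}) = r (S - {i}) * (\<Prod>u\<in>S-{i}. u ^ (m - 1))"
        using nz fin unfolding r_def c by simp
      have pw: "(\<Prod>k\<in>S-{i}. i * k) * (\<Prod>u\<in>S-{i}. u ^ (m - 1)) = (\<Prod>u\<in>S. u ^ m)"
      proof -
        have "(\<Prod>k\<in>S-{i}. k * k ^ (m - 1)) = (\<Prod>k\<in>S-{i}. k ^ m)"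
        proof (cases m)
          case 0
          then have "S - {i} = {}" using c fin by simp
          then show ?thesis by (simp only: prod.empty)
        qed simp
        then have "(\<Prod>k\<in>S-{i}. k) * (\<Prod>k\<in>S-{i}. k ^ (m - 1)) = (\<Prod>k\<in>S-{i}. k ^ m)" by (simp add: prod.distrib)
        then show ?thesis using fin i c by (simp add: prod.distrib prod.remove[of S i] mult.assoc)
      qed
      have swap: "a * (s * d) = b * d * (c * s)" if "a = b * c" for a b c d s :: complex
        using that by simp
      have "(\<Prod>k\<in>S-{i}. sX \<tau> k * sf \<tau> i k) = (\<Prod>k\<in>S-{i}. i * k) * (\<Prod>k\<in>S-{i}. (px \<tau> k - py \<tau> i) / (pn \<tau> k - pn \<tau> i))"
        unfolding prod.distrib[symmetric] by (intro prod.cong refl) (simp only: sc)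
      then show "(\<Prod>k\<in>S-{i}. sX \<tau> k * sf \<tau> i k) * spin1.bw \<tau> (replicate m Zero) (S-{i})
        = (\<Prod>u\<in>S. u ^ m) * ((\<Prod>k\<in>S-{i}. (px \<tau> k - py \<tau> i) / (pn \<tau> k - pn \<tau> i)) * r (S - {i}))"
        unfolding r pw[symmetric] by (rule swap)
    qed
    also have "\<dots> = (\<Prod>u\<in>S. u ^ m) * (\<Sum>i\<in>S. (\<Prod>k\<in>S-{i}. (px \<tau> k - py \<tau> i) / (pn \<tau> k - pn \<tau> i)) * r (S - {i}))"
      by (simp only: sum_distrib_left)
    finally have bw: "spin1.bw \<tau> (replicate (card S) Zero) S = \<dots>" .
    have "(\<Prod>u\<in>S. u ^ m) \<noteq> 0" using nz fin by simp
    then show "r S = (\<Sum>i\<in>S. (\<Prod>k\<in>S-{i}. (px \<tau> k - py \<tau> i) / (pn \<tau> k - pn \<tau> i)) * r (S - {i}))"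
      unfolding r_def[of S] bw by (simp add: m)
  qed
  moreover have "card (set us) = N" using assms(1) by (simp add: distinct_card N_def)
  moreover have "(\<Prod>u\<in>set us. u ^ (N - 1)) \<noteq> 0" using assms(2) by (auto simp: good_nodes_def)
  ultimately show ?thesis by (simp add: r_def alt_def N_def[symmetric] field_simps)
qed

lemma eventually_good_nodes: "\<forall>\<^sub>F e in at_right 0. good_nodes \<tau> (node e ` {..<N})"
proof -
  have pos: "\<forall>\<^sub>F e in at_right (0::real). e > 0" by (simp add: eventually_at_right_less)
  have ev1: "\<forall>\<^sub>F e in at_right 0. 1 + \<tau> * node e i \<noteq> 0" for i
  proof (rule tendsto_imp_eventually_ne)
    show "((\<lambda>e. 1 + \<tau> * node e i) \<longlongrightarrow> 1) (at_right 0)"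
      by (auto intro!: tendsto_eq_intros node_tendsto)
  qed simp
  \<comment> \<open>This expression is \<open>(px \<tau> u - py \<tau> u) * u\<close> at the node
    \<open>u\<close>.\<close>
  have ev2: "\<forall>\<^sub>F e in at_right 0. 2 + \<tau> * node e i + node e i ^ 2 + node e i ^ 2 / (1 + \<tau> * node e i) \<noteq> 0" for i
  proof (rule tendsto_imp_eventually_ne)
    show "((\<lambda>e. 2 + \<tau> * node e i + node e i ^ 2 + node e i ^ 2 / (1 + \<tau> * node e i)) \<longlongrightarrow> 2) (at_right 0)"
      by (auto intro!: tendsto_eq_intros node_tendsto)
  qed simp
  \<comment> \<open>\<open>pn\<close> takes equal values at \<open>u \<noteq> v\<close> only if
    \<open>u + v + \<tau> * u * v = 0\<close>; at two nodes this expression is \<open>e\<close>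
    times the one below.\<close>
  have ev3: "\<forall>\<^sub>F e in at_right 0. of_nat (i + k + 2) + \<tau> * node e i * of_nat (Suc k) \<noteq> 0" for i k
  proof (rule tendsto_imp_eventually_ne)
    show "((\<lambda>e. of_nat (i + k + 2) + \<tau> * node e i * of_nat (Suc k)) \<longlongrightarrow> of_nat (i + k + 2)) (at_right 0)"
      by (auto intro!: tendsto_eq_intros node_tendsto)
  qed (use of_nat_neq_0[of "i + k + 1", where 'a = complex] in simp)
  have "\<forall>\<^sub>F e in at_right 0. e > 0 \<and> (\<forall>i\<in>{..<N}. 1 + \<tau> * node e i \<noteq> 0)
     \<and> (\<forall>i\<in>{..<N}. 2 + \<tau> * node e i + node e i ^ 2 + node e i ^ 2 / (1 + \<tau> * node e i) \<noteq> 0)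
     \<and> (\<forall>i\<in>{..<N}. \<forall>k\<in>{..<N}. of_nat (i + k + 2) + \<tau> * node e i * of_nat (Suc k) \<noteq> 0)"
    by (intro eventually_conj pos eventually_ball_finite ballI ev1 ev2 ev3) auto
  then show ?thesis
  proof eventually_elim
    case (elim e)
    have nz: "node e i \<noteq> 0" for i using elim node_nonzero by blast
    have "pn \<tau> (node e i) \<noteq> pn \<tau> (node e k)" if "i < N" "k < N" "i \<noteq> k" for i k
    proof
      define u v where "u = node e i" and "v = node e k"
      have uv: "u \<noteq> v" using inj_node[of e] elim that by (auto simp: u_def v_def inj_def)
      have d: "1 + \<tau> * u \<noteq> 0" "1 + \<tau> * v \<noteq> 0" using elim that by (auto simp: u_def v_def)
      assume "pn \<tau> (node e i) = pn \<tau> (node e k)"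
      then have "u ^ 2 * (1 + \<tau> * v) = v ^ 2 * (1 + \<tau> * u)"
        using d by (simp add: pn_def u_def[symmetric] v_def[symmetric] divide_simps)
      then have "(u - v) * (u + v + \<tau> * u * v) = 0" by (simp add: algebra_simps power2_eq_square)
      then have "u + v + \<tau> * u * v = 0" using uv by simp
      moreover have "u + v + \<tau> * u * v = of_real e * (of_nat (i + k + 2) + \<tau> * u * of_nat (Suc k))"
        by (simp add: u_def v_def node_def algebra_simps)
      ultimately show False using elim that by (simp add: u_def)
    qed
    then have "inj_on (pn \<tau>) (node e ` {..<N})" by (auto simp: inj_on_def)
    moreover have "px \<tau> (node e i) \<noteq> py \<tau> (node e i)" if "i < N" for i
    proof
      assume "px \<tau> (node e i) = py \<tau> (node e i)"
      then have "(px \<tau> (node e i) - py \<tau> (node e i)) * node e i = 0" by simp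
      moreover have "(px \<tau> (node e i) - py \<tau> (node e i)) * node e i
        = 2 + \<tau> * node e i + node e i ^ 2 + node e i ^ 2 / (1 + \<tau> * node e i)"
        using nz[of i] by (simp add: px_def py_def algebra_simps power2_eq_square)
      ultimately show False using elim that by simp
    qed
    ultimately show ?case using elim nz by (auto simp: good_nodes_def)
  qed
qed

text \<open>\<open>r\<close> is the component in the normalisation of \<open>spin1_alternant\<close>
  times the product of the \<open>pn^m\<close>; these factors turn the rows of the \<open>hs\<close>
  determinant into values of \<open>spin1_poly\<close>, to which \<open>confluent_alternant\<close>
  applies.\<close>

lemma spin1_limit:
  assumes "N \<le> 2 * m + 2"
  shows "\<exists>r. (r \<longlongrightarrow> det (mat N N (\<lambda>(i, j). coeff (spin1_poly \<tau> m j) i))) (at_right 0) \<and>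
    (\<forall>\<^sub>F e in at_right 0. spin1.bw \<tau> (replicate N Zero) (node e ` {..<N}) * (\<Prod>i<N. pn \<tau> (node e i)) ^ m
       = (\<Prod>i<N. node e i) ^ (N - 1) * r e)"
proof -
  let ?us = "\<lambda>e. map (node e) [0..<N]"
  have us: "set (?us e) = node e ` {..<N}" "length (?us e) = N" for e by auto
  define r where "r e = spin1.bw \<tau> (replicate N Zero) (node e ` {..<N}) / (\<Prod>i<N. node e i) ^ (N - 1)
     * (\<Prod>i<N. pn \<tau> (node e i)) ^ m" for e
  have pos: "\<forall>\<^sub>F e in at_right (0::real). e > 0" by (simp add: eventually_at_right_less)
  have "(r \<longlongrightarrow> det (mat N N (\<lambda>(i, j). coeff (spin1_poly \<tau> m j) i))) (at_right 0)"
  proof (rule confluent_alternant)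
    show "((\<lambda>e. pn \<tau> (node e i)) \<longlongrightarrow> 0) (at_right 0)" for i
      unfolding pn_def by (auto intro!: tendsto_eq_intros node_tendsto)
    show "\<forall>\<^sub>F e in at_right 0. inj_on (\<lambda>i. pn \<tau> (node e i)) {..<N} \<and>
      r e * det (mat N N (\<lambda>(i, j). pn \<tau> (node e i) ^ j))
        = det (mat N N (\<lambda>(i, j). poly (spin1_poly \<tau> m j) (pn \<tau> (node e i))))"
      using eventually_good_nodes[of \<tau> N] pos
    proof eventually_elim
      case (elim e)
      have inj: "inj (node e)" using elim inj_node by blast
      then have inj': "inj_on (node e) A" for A by (rule inj_on_subset) simp
      have nz: "node e i \<noteq> 0" for i using elim node_nonzero by blast
      have dist: "distinct (?us e)" using inj' by (simp add: distinct_map)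
      have "inj_on (pn \<tau> \<circ> node e) {..<N}"
        using elim inj' by (intro comp_inj_on) (auto simp: good_nodes_def)
      moreover have "r e * det (mat N N (\<lambda>(i, j). pn \<tau> (node e i) ^ j))
        = det (mat N N (\<lambda>(i, j). poly (spin1_poly \<tau> m j) (pn \<tau> (node e i))))"
      proof -
        have idx: "mat N N (\<lambda>(i, j). F j (?us e ! i)) = mat N N (\<lambda>(i, j). F j (node e i))" for F :: "nat \<Rightarrow> complex \<Rightarrow> complex"
          by (rule eq_matI) auto
        have A: "spin1.bw \<tau> (replicate N Zero) (node e ` {..<N}) * det (mat N N (\<lambda>(i, j). pn \<tau> (node e i) ^ j))
          = (\<Prod>u\<in>node e ` {..<N}. u ^ (N - 1)) * det (mat N N (\<lambda>(i, j). hs j (px \<tau> (node e i)) (py \<tau> (node e i))))"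
          using spin1_alternant[OF dist, of \<tau>] elim
          unfolding us idx[of "\<lambda>j u. pn \<tau> u ^ j"] idx[of "\<lambda>j u. hs j (px \<tau> u) (py \<tau> u)"] by blast
        have P: "(\<Prod>u\<in>node e ` {..<N}. u ^ (N - 1)) = (\<Prod>i<N. node e i) ^ (N - 1)"
          using inj' by (simp add: prod.reindex prod_power_distrib)
        have "r e * det (mat N N (\<lambda>(i, j). pn \<tau> (node e i) ^ j))
          = (\<Prod>i<N. pn \<tau> (node e i) ^ m) * det (mat N N (\<lambda>(i, j). hs j (px \<tau> (node e i)) (py \<tau> (node e i))))"
          using A nz unfolding P r_def by (simp add: field_simps prod_power_distrib)
        also have "\<dots> = det (mat N N (\<lambda>(i, j). pn \<tau> (node e i) ^ m * hs j (px \<tau> (node e i)) (py \<tau> (node e i))))"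
          by (rule det_row_scale[symmetric])
        also have "\<dots> = det (mat N N (\<lambda>(i, j). poly (spin1_poly \<tau> m j) (pn \<tau> (node e i))))"
        proof (intro arg_cong[of _ _ det] eq_matI)
          fix i j assume ij: "i < dim_row (mat N N (\<lambda>(i, j). poly (spin1_poly \<tau> m j) (pn \<tau> (node e i))))"
            "j < dim_col (mat N N (\<lambda>(i, j). poly (spin1_poly \<tau> m j) (pn \<tau> (node e i))))"
          then have d: "1 + \<tau> * node e i \<noteq> 0" using elim by (auto simp: good_nodes_def)
          have "poly (spin1_poly \<tau> m j) (pn \<tau> (node e i)) = pn \<tau> (node e i) ^ m * hs j (px \<tau> (node e i)) (py \<tau> (node e i))"
            by (rule poly_spin1_poly[OF _ pxy_sum[OF d] pxy_prod[OF nz d]])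
              (use ij assms d nz in \<open>auto simp: pn_def\<close>)
          then show "mat N N (\<lambda>(i, j). pn \<tau> (node e i) ^ m * hs j (px \<tau> (node e i)) (py \<tau> (node e i))) $$ (i, j)
            = mat N N (\<lambda>(i, j). poly (spin1_poly \<tau> m j) (pn \<tau> (node e i))) $$ (i, j)"
            using ij by simp
        qed auto
        finally show ?thesis .
      qed
      ultimately show ?case by (simp add: o_def)
    qed
  qed
  moreover have "\<forall>\<^sub>F e in at_right 0. spin1.bw \<tau> (replicate N Zero) (node e ` {..<N}) * (\<Prod>i<N. pn \<tau> (node e i)) ^ m
       = (\<Prod>i<N. node e i) ^ (N - 1) * r e"
    using pos by eventually_elim (simp add: r_def node_nonzero)
  ultimately show ?thesis by blast
qed

definition vac :: "spin_one list \<Rightarrow> complex" where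
  "vac \<sigma> = (if \<sigma> = replicate (length \<sigma>) UUp then 1 else 0)"

text \<open>The vertex weights are polynomial in the rapidity, so the product of rows with distinct
  rapidities tends to a power of the row at 0, although the terms of \<open>bw\<close> are singular
  there.\<close>

lemma spin1_rows_limit:
  "((\<lambda>e. spin1.bw \<tau> \<sigma> (node e ` {..<N})) \<longlongrightarrow> (brow \<tau> 0 ^^ N) vac \<sigma>) (at_right 0)"
proof -
  have v: "vac = (\<lambda>\<sigma>. spin1.bw \<tau> \<sigma> {})" by (auto simp: vac_def spin1.bw_empty)
  have "((\<lambda>e. foldr (brow \<tau>) (map (node e) [0..<N]) vac \<sigma>) \<longlongrightarrow> (brow \<tau> 0 ^^ length [0..<N]) vac \<sigma>) (at_right 0)"
    by (rule tendsto_brow_rows)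
  moreover have "\<forall>\<^sub>F e in at_right (0::real). e > 0" by (simp add: eventually_at_right_less)
  then have "\<forall>\<^sub>F e in at_right 0. foldr (brow \<tau>) (map (node e) [0..<N]) vac \<sigma> = spin1.bw \<tau> \<sigma> (node e ` {..<N})"
  proof eventually_elim
    case (elim e)
    then have "inj (node e)" by (rule inj_node)
    then have "distinct (map (node e) [0..<N])" by (auto simp: distinct_map intro: inj_on_subset)
    then have "foldr (brow \<tau>) (map (node e) [0..<N]) vac = (\<lambda>\<sigma>. spin1.bw \<tau> \<sigma> (set (map (node e) [0..<N])))"
      unfolding v by (rule spin1_bw_rows)
    then show ?case by (simp add: atLeast0LessThan)
  qed
  ultimately show ?thesis by (auto elim: Lim_transform_eventually)
qed

lemma pn_prod:
  "e > 0 \<Longrightarrow> (\<Prod>i<N. node e i) ^ (2 * m) = (\<Prod>i<N. pn \<tau> (node e i)) ^ m * (\<Prod>i<N. 1 + \<tau> * node e i) ^ m"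
  if "\<And>i. i < N \<Longrightarrow> 1 + \<tau> * node e i \<noteq> 0"
proof -
  have "(\<Prod>i<N. node e i ^ 2) = (\<Prod>i<N. pn \<tau> (node e i) * (1 + \<tau> * node e i))"
    by (intro prod.cong refl) (use that in \<open>simp add: pn_def\<close>)
  then have "(\<Prod>i<N. node e i) ^ 2 = (\<Prod>i<N. pn \<tau> (node e i)) * (\<Prod>i<N. 1 + \<tau> * node e i)"
    by (simp add: prod.distrib prod_power_distrib)
  then show ?thesis by (metis power_mult power_mult_distrib)
qed

theorem spin1_component_odd:
  "(brow \<tau> 0 ^^ (2 * m + 3)) vac (replicate (2 * m + 3) Zero) = \<tau> ^ Suc m * asm_det (Suc m) (\<tau> ^ 2)"
proof -
  let ?N = "2 * m + 3"
  obtain r where r: "(r \<longlongrightarrow> det (mat ?N ?N (\<lambda>(i, j). coeff (spin1_poly \<tau> (Suc m) j) i))) (at_right 0)"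
    and ev: "\<forall>\<^sub>F e in at_right 0. spin1.bw \<tau> (replicate ?N Zero) (node e ` {..<?N}) * (\<Prod>i<?N. pn \<tau> (node e i)) ^ Suc m
       = (\<Prod>i<?N. node e i) ^ (?N - 1) * r e"
    using spin1_limit[of ?N "Suc m" \<tau>] by auto
  have "((\<lambda>e. (\<Prod>i<?N. 1 + \<tau> * node e i) ^ Suc m * r e) \<longlongrightarrow> (\<Prod>i<?N. 1 + \<tau> * 0) ^ Suc m
      * det (mat ?N ?N (\<lambda>(i, j). coeff (spin1_poly \<tau> (Suc m) j) i))) (at_right 0)"
    by (intro tendsto_intros r node_tendsto)
  then have "((\<lambda>e. (\<Prod>i<?N. 1 + \<tau> * node e i) ^ Suc m * r e) \<longlongrightarrow> \<tau> ^ Suc m * asm_det (Suc m) (\<tau> ^ 2)) (at_right 0)"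
    unfolding spin1_det_odd by simp
  moreover have "\<forall>\<^sub>F e in at_right 0. (\<Prod>i<?N. 1 + \<tau> * node e i) ^ Suc m * r e = spin1.bw \<tau> (replicate ?N Zero) (node e ` {..<?N})"
    using ev eventually_good_nodes[of \<tau> ?N] eventually_at_right_less[of "0::real"]
  proof eventually_elim
    case (elim e)
    have d: "1 + \<tau> * node e i \<noteq> 0" if "i < ?N" for i using elim(2) that by (auto simp: good_nodes_def)
    have "(\<Prod>i<?N. pn \<tau> (node e i)) \<noteq> 0" using d elim(3) node_nonzero by (auto simp: pn_def)
    \<comment> \<open>Here \<open>?N - 1 = 2 * Suc m\<close>, so the powers of the nodes balance
      exactly up to factors tending to 1.\<close>
    moreover have "(\<Prod>i<?N. node e i) ^ (?N - 1) = (\<Prod>i<?N. pn \<tau> (node e i)) ^ Suc m * (\<Prod>i<?N. 1 + \<tau> * node e i) ^ Suc m"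
      using pn_prod[of ?N \<tau> e "Suc m", OF d elim(3)] by simp
    ultimately show ?case using elim(1) by (simp only: mult.assoc) (simp del: power_Suc prod.lessThan_Suc)
  qed
  ultimately have "((\<lambda>e. spin1.bw \<tau> (replicate ?N Zero) (node e ` {..<?N})) \<longlongrightarrow> \<tau> ^ Suc m * asm_det (Suc m) (\<tau> ^ 2)) (at_right 0)"
    by (rule Lim_transform_eventually)
  with spin1_rows_limit[of \<tau> "replicate ?N Zero" ?N] show ?thesis
    by (rule tendsto_unique[rotated]) simp
qed

text \<open>The value for \<open>\<tau> \<noteq> 0\<close> comes from the component of all
  \<open>Zero\<close>, divided by the \<open>\<tau> ^ Suc m\<close> of
  \<open>bw_Zero_pairs\<close>.\<close>

theorem spin1_component_even:
  assumes "\<tau> \<noteq> 0"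
  shows "(brow \<tau> 0 ^^ (2 * m + 2)) vac (concat (replicate (Suc m) [UUp, DDn])) = asm_det (Suc m) (\<tau> ^ 2)"
proof -
  let ?N = "2 * m + 2" and ?C = "concat (replicate (Suc m) [UUp, DDn])"
  obtain r where r: "(r \<longlongrightarrow> det (mat ?N ?N (\<lambda>(i, j). coeff (spin1_poly \<tau> m j) i))) (at_right 0)"
    and ev: "\<forall>\<^sub>F e in at_right 0. spin1.bw \<tau> (replicate ?N Zero) (node e ` {..<?N}) * (\<Prod>i<?N. pn \<tau> (node e i)) ^ m
       = (\<Prod>i<?N. node e i) ^ (?N - 1) * r e"
    using spin1_limit[of ?N m \<tau>] by auto
  have "((\<lambda>e. (\<Prod>i<?N. 1 + \<tau> * node e i) ^ m * r e * (\<Prod>i<?N. sX \<tau> (node e i)) / \<tau> ^ Suc m) \<longlongrightarrow> (\<Prod>i<?N. 1 + \<tau> * 0) ^ m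
      * det (mat ?N ?N (\<lambda>(i, j). coeff (spin1_poly \<tau> m j) i)) * (\<Prod>i<?N. - (1 + \<tau> * 0)) / \<tau> ^ Suc m) (at_right 0)"
    unfolding sX_def using assms by (intro tendsto_intros r node_tendsto) auto
  then have "((\<lambda>e. (\<Prod>i<?N. 1 + \<tau> * node e i) ^ m * r e * (\<Prod>i<?N. sX \<tau> (node e i)) / \<tau> ^ Suc m) \<longlongrightarrow> asm_det (Suc m) (\<tau> ^ 2)) (at_right 0)"
    unfolding spin1_det_even using assms by simp
  moreover have "\<forall>\<^sub>F e in at_right 0. (\<Prod>i<?N. 1 + \<tau> * node e i) ^ m * r e * (\<Prod>i<?N. sX \<tau> (node e i)) / \<tau> ^ Suc m
      = spin1.bw \<tau> ?C (node e ` {..<?N})"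
    using ev eventually_good_nodes[of \<tau> ?N] eventually_at_right_less[of "0::real"]
  proof eventually_elim
    case (elim e)
    have d: "1 + \<tau> * node e i \<noteq> 0" if "i < ?N" for i using elim(2) that by (auto simp: good_nodes_def)
    define P U X B where "P = (\<Prod>i<?N. pn \<tau> (node e i)) ^ m" and "U = (\<Prod>i<?N. node e i)"
      and "X = (\<Prod>i<?N. sX \<tau> (node e i))" and "B = (\<Prod>i<?N. 1 + \<tau> * node e i) ^ m"
    have nz: "P \<noteq> 0" "U \<noteq> 0" using d elim(3) node_nonzero by (auto simp: pn_def P_def U_def)
    have sX: "sX \<tau> (node e i) \<noteq> 0" if "i < ?N" for i
      using d[OF that] unfolding sX_def neg_equal_0_iff_equal .
    have X: "X \<noteq> 0" unfolding X_def by (subst prod_zero_iff) (use sX in blast)+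
    have inj: "inj_on (node e) {..<?N}" using inj_node[OF elim(3)] by (rule inj_on_subset) simp
    have "spin1.bw \<tau> (replicate (2 * Suc m) Zero) (node e ` {..<?N})
      = \<tau> ^ Suc m * (\<Prod>k\<in>node e ` {..<?N}. k / sX \<tau> k) * spin1.bw \<tau> ?C (node e ` {..<?N})"
      using sX by (intro bw_Zero_pairs) auto
    also have "(\<Prod>k\<in>node e ` {..<?N}. k / sX \<tau> k) = U / X"
      by (simp only: prod.reindex[OF inj] o_def prod_dividef U_def X_def)
    finally have "\<tau> ^ Suc m * (U / X) * spin1.bw \<tau> ?C (node e ` {..<?N}) * P = U ^ (?N - 1) * r e"
      using elim(1) unfolding P_def U_def by simp
    \<comment> \<open>The exponent \<open>?N - 1 = 2 * m + 1\<close> leaves one spare factor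
      \<open>U\<close>, which cancels the numerator from \<open>bw_Zero_pairs\<close>. The remaining
      \<open>X\<close> tends to \<open>(-1)^?N = 1\<close>, as \<open>?N\<close> is even.\<close>
    also have "U ^ (?N - 1) = U * (P * B)"
      using pn_prod[of ?N \<tau> e m, OF d elim(3)] by (simp add: U_def P_def B_def)
    finally have "\<tau> ^ Suc m * spin1.bw \<tau> ?C (node e ` {..<?N}) = B * r e * X"
      using nz X by (simp add: field_simps)
    then show ?case using assms unfolding B_def[symmetric] X_def[symmetric] by (simp add: field_simps)
  qed
  ultimately have "((\<lambda>e. spin1.bw \<tau> ?C (node e ` {..<?N})) \<longlongrightarrow> asm_det (Suc m) (\<tau> ^ 2)) (at_right 0)"
    by (rule Lim_transform_eventually)
  with spin1_rows_limit[of \<tau> ?C ?N] show ?thesis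
    by (rule tendsto_unique[rotated]) simp
qed

section \<open>From the monodromy matrix to row operators\<close>

lemma rowop_snoc:
  "rowop W \<gamma> (xs @ [x]) \<alpha> R = (\<Sum>\<beta>\<in>UNIV. \<Sum>\<tau>\<in>UNIV. W (\<gamma>, x) (\<beta>, \<tau>) * rowop W \<beta> xs \<alpha> (\<lambda>\<rho>. R (\<rho> @ [\<tau>])))"
proof (induction xs arbitrary: \<alpha> R)
  case Nil
  show ?case by (cases \<alpha>; cases \<gamma>) (simp_all add: sum_spin_half)
next
  case (Cons y xs)
  show ?case
    by (simp add: Cons sum_spin_half sum_spin_one distrib_left ac_simps)
qed

lemma rowop_cong:
  "(\<And>\<rho>. length \<rho> = length \<sigma> \<Longrightarrow> R \<rho> = R' \<rho>) \<Longrightarrow> rowop W \<gamma> \<sigma> \<alpha> R = rowop W \<gamma> \<sigma> \<alpha> R'"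
proof (induction \<sigma> arbitrary: \<alpha> R R')
  case (Cons x \<sigma>)
  have "rowop W \<gamma> \<sigma> \<beta> (\<lambda>\<rho>. R (\<tau> # \<rho>)) = rowop W \<gamma> \<sigma> \<beta> (\<lambda>\<rho>. R' (\<tau> # \<rho>))" for \<beta> \<tau>
    by (rule Cons.IH) (simp add: Cons.prems)
  then show ?case by simp
qed simp

text \<open>\<open>monodromy\<close> adds sites at the end, while \<open>rowop\<close> consumes them
  from the head; \<open>rowop_snoc\<close> reconciles the two. The sum runs over the auxiliary state
  that enters at the first site.\<close>

lemma monodromy_rowop:
  assumes "k \<le> length \<sigma>"
  shows "monodromy q s 1 k \<psi> (\<gamma>, \<sigma>)
    = (\<Sum>\<alpha>\<in>UNIV. rowop (R_mat q s (inverse q)) \<gamma> (take k \<sigma>) \<alpha> (\<lambda>\<rho>. \<psi> (\<alpha>, \<rho> @ drop k \<sigma>)))"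
  using assms
proof (induction k arbitrary: \<gamma> \<sigma>)
  case 0
  then show ?case by (cases \<gamma>) (simp_all add: sum_spin_half)
next
  case (Suc k)
  let ?W = "R_mat q s (inverse q)"
  have k: "k < length \<sigma>" using Suc.prems by simp
  have "monodromy q s 1 (Suc k) \<psi> (\<gamma>, \<sigma>)
    = (\<Sum>\<beta>\<in>UNIV. \<Sum>\<tau>\<in>UNIV. ?W (\<gamma>, \<sigma> ! k) (\<beta>, \<tau>) * monodromy q s 1 k \<psi> (\<beta>, \<sigma>[k := \<tau>]))"
    by (simp add: R_site_def)
  also have "\<dots> = (\<Sum>\<beta>\<in>UNIV. \<Sum>\<tau>\<in>UNIV. ?W (\<gamma>, \<sigma> ! k) (\<beta>, \<tau>) *
      (\<Sum>\<alpha>\<in>UNIV. rowop ?W \<beta> (take k \<sigma>) \<alpha> (\<lambda>\<rho>. \<psi> (\<alpha>, (\<rho> @ [\<tau>]) @ drop (Suc k) \<sigma>))))"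
  proof -
    have "drop k (\<sigma>[k := \<tau>]) = \<tau> # drop (Suc k) \<sigma>" "take k (\<sigma>[k := \<tau>]) = take k \<sigma>" for \<tau>
      using k by (simp_all add: Cons_nth_drop_Suc[symmetric] del: Cons_nth_drop_Suc)
    then show ?thesis using k by (simp add: Suc.IH)
  qed
  also have "\<dots> = (\<Sum>\<alpha>\<in>UNIV. \<Sum>\<beta>\<in>UNIV. \<Sum>\<tau>\<in>UNIV. ?W (\<gamma>, \<sigma> ! k) (\<beta>, \<tau>) *
      rowop ?W \<beta> (take k \<sigma>) \<alpha> (\<lambda>\<rho>. \<psi> (\<alpha>, (\<rho> @ [\<tau>]) @ drop (Suc k) \<sigma>)))"
    by (simp only: sum_spin_half sum_spin_one distrib_left ac_simps)
  also have "\<dots> = (\<Sum>\<alpha>\<in>UNIV. rowop ?W \<gamma> (take k \<sigma> @ [\<sigma> ! k]) \<alpha> (\<lambda>\<rho>. \<psi> (\<alpha>, \<rho> @ drop (Suc k) \<sigma>)))"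
    by (simp only: rowop_snoc)
  finally show ?case using k by (simp only: take_Suc_conv_app_nth)
qed

lemma B_op_rowop:
  assumes "length \<sigma> = N"
  shows "B_op q s N 1 \<psi> \<sigma> = rowop (R_mat q s (inverse q)) Up \<sigma> Dn \<psi>"
  using assms monodromy_rowop[of N \<sigma> q s "\<lambda>(\<alpha>, \<tau>). if \<alpha> = Dn then \<psi> \<tau> else 0" Up]
  by (simp add: B_op_def sum_spin_half rowop_zero)

text \<open>The ratios of \<open>G\<close> telescope along the row, so only the two end states
  remain.\<close>

lemma rowop_gauge:
  fixes G :: "spin_half \<Rightarrow> 'a::field"
  assumes "\<And>\<beta> x \<alpha> \<tau>. W (\<beta>, x) (\<alpha>, \<tau>) = c * (G \<beta> / G \<alpha>) * W' (\<beta>, x) (\<alpha>, \<tau>)" "\<And>\<alpha>. G \<alpha> \<noteq> 0"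
  shows "rowop W \<gamma> \<sigma> \<alpha> R = c ^ length \<sigma> * (G \<gamma> / G \<alpha>) * rowop W' \<gamma> \<sigma> \<alpha> R"
proof (induction \<sigma> arbitrary: \<alpha> R)
  case Nil
  then show ?case using assms(2) by simp
next
  case (Cons x \<sigma>)
  have "W (\<beta>, x) (\<alpha>, \<tau>) * rowop W \<gamma> \<sigma> \<beta> (\<lambda>\<rho>. R (\<tau> # \<rho>))
    = c ^ length (x # \<sigma>) * (G \<gamma> / G \<alpha>) * (W' (\<beta>, x) (\<alpha>, \<tau>) * rowop W' \<gamma> \<sigma> \<beta> (\<lambda>\<rho>. R (\<tau> # \<rho>)))" for \<beta> \<tau>
    unfolding Cons assms(1) using assms(2)[of \<beta>] by simp
  then show ?case by (simp only: rowop.simps sum_distrib_left)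
qed

definition half_weight :: "complex \<Rightarrow> spin_half \<Rightarrow> complex" where
  "half_weight w \<alpha> = (if \<alpha> = Up then w else 1)"

text \<open>At \<open>z = 1\<close> every diagonal entry is \<open>0\<close> or \<open>[q]\<close>
  up to sign, and \<open>s^2 = [q]^2 \<tau>\<close>. Weighting \<open>Up\<close> with
  \<open>s / [q]\<close> turns the raising entries \<open>s\<close> into \<open>[q]\<close> and the
  lowering ones into \<open>[q] \<tau>\<close>, so the choice of the root disappears.\<close>

lemma R_mat_gauge:
  assumes "q \<noteq> 0" "qbr q \<noteq> 0" "s \<noteq> 0" "s ^ 2 = qbr q * qbr (q ^ 2)" and \<tau>: "\<tau> = q + inverse q"
  shows "R_mat q s (inverse q) (\<beta>, x) (\<alpha>, y)
    = qbr q * (half_weight (s / qbr q) \<beta> / half_weight (s / qbr q) \<alpha>) * spin1.wt \<tau> 0 (\<beta>, x) (\<alpha>, y)"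
proof -
  have "qbr (q ^ 2) = qbr q * \<tau>"
    by (simp add: qbr_def \<tau> power2_eq_square square_diff_square_factored mult.commute)
  then have s2: "s * s = qbr q * qbr q * \<tau>" using assms(4) by (simp add: power2_eq_square)
  have d: "qbr (q\<^sup>2 * inverse q) = qbr q" "qbr (q * inverse q) = 0" "qbr (inverse q) = - qbr q"
  proof -
    have "q\<^sup>2 * inverse q = q" using assms(1) by (simp add: power2_eq_square mult.assoc)
    then show "qbr (q\<^sup>2 * inverse q) = qbr q" by simp
  qed (use assms(1) in \<open>simp_all add: qbr_def\<close>)
  have "qbr q * (\<tau> * qbr q / s) = s" using s2 assms(3) by (simp add: field_simps)
  then have s': "qbr q * (qbr q * \<tau>) = s * s" by (simp add: s2)
  show ?thesis
    unfolding R_mat_def wts_def half_weight_def sX_def sr_def using assms(2,3) d s'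
    by (cases \<beta>; cases \<alpha>; cases x; cases y) (auto simp: doubleton_eq_iff field_simps)
qed

text \<open>The condition \<open>q ^ 4 \<noteq> 1\<close> amounts to \<open>[q] \<noteq> 0\<close>
  and \<open>\<tau> \<noteq> 0\<close>. Each of the \<open>N\<close> rows contributes
  \<open>[q]^N * s / [q]\<close> through the gauge, together \<open>[q]^(N (N - 1)) * s^N\<close>,
  exactly what the normalisation removes.\<close>

lemma phi_D_generic_rows:
  assumes "q \<noteq> 0" "q ^ 4 \<noteq> 1" "s ^ 2 = qbr q * qbr (q ^ 2)" "length \<sigma> = N"
  shows "phi_D_generic q s N \<sigma> = (brow (q + inverse q) 0 ^^ N) vac \<sigma>"
proof -
  define \<tau> where "\<tau> = q + inverse q"
  have c: "qbr q \<noteq> 0"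
  proof
    assume "qbr q = 0"
    then have "q * q = 1" using assms(1) by (simp add: qbr_def field_simps)
    then have "q ^ 4 = 1" by (simp add: power4_eq_xxxx)
    then show False using assms(2) by simp
  qed
  have \<tau>0: "\<tau> \<noteq> 0"
  proof
    assume "\<tau> = 0"
    then have "(q + inverse q) * q = 0" by (simp add: \<tau>_def)
    then have "q * q = - 1" using assms(1) by (simp add: distrib_right add_eq_0_iff2)
    then have "q * q * (q * q) = 1" by simp
    then have "q ^ 4 = 1" by (simp add: power4_eq_xxxx mult.assoc)
    then show False using assms(2) by simp
  qed
  have "qbr (q ^ 2) = qbr q * \<tau>"
    by (simp add: qbr_def \<tau>_def power2_eq_square square_diff_square_factored mult.commute)
  then have s: "s \<noteq> 0" using assms(3) c \<tau>0 by auto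
  define b where "b = s / qbr q"
  have b: "b \<noteq> 0" using s c by (simp add: b_def)
  have row: "rowop (R_mat q s (inverse q)) Up \<sigma> Dn R = qbr q ^ N * b * brow \<tau> 0 R \<sigma>" if "length \<sigma> = N" for R \<sigma>
    unfolding brow_def using that
    by (subst rowop_gauge[where G = "half_weight (s / qbr q)" and c = "qbr q" and W' = "spin1.wt \<tau> 0", OF R_mat_gauge[OF assms(1) c s assms(3) \<tau>_def]])
      (use b in \<open>auto simp: half_weight_def b_def\<close>)
  have "(B_op q s N 1 ^^ j) (all_up N) \<sigma> = (qbr q ^ N * b) ^ j * (brow \<tau> 0 ^^ j) vac \<sigma>" if "length \<sigma> = N" for j \<sigma>
    using that
  proof (induction j arbitrary: \<sigma>)
    case 0
    then show ?case by (auto simp: all_up_def vac_def)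
  next
    case (Suc j)
    have "(B_op q s N 1 ^^ Suc j) (all_up N) \<sigma> = qbr q ^ N * b * brow \<tau> 0 ((B_op q s N 1 ^^ j) (all_up N)) \<sigma>"
      using Suc.prems by (simp add: B_op_rowop row)
    also have "brow \<tau> 0 ((B_op q s N 1 ^^ j) (all_up N)) \<sigma>
      = brow \<tau> 0 (\<lambda>\<rho>. (qbr q ^ N * b) ^ j * (brow \<tau> 0 ^^ j) vac \<rho>) \<sigma>"
      unfolding brow_def[of \<tau> 0 _ \<sigma>] using Suc by (intro rowop_cong) simp
    also have "\<dots> = (qbr q ^ N * b) ^ j * brow \<tau> 0 ((brow \<tau> 0 ^^ j) vac) \<sigma>"
      unfolding brow_def[of \<tau> 0 _ \<sigma>] rowop_cmult ..
    finally show ?case by simp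
  qed
  from this[OF assms(4), of N]
  have "phi_D_generic q s N \<sigma> = inverse (s ^ N) * inverse (qbr q ^ (N * (N - 1))) * ((qbr q ^ N * b) ^ N) * (brow \<tau> 0 ^^ N) vac \<sigma>"
    by (simp add: phi_D_generic_def)
  also have "(qbr q ^ N * b) ^ N = qbr q ^ (N * (N - 1)) * s ^ N"
  proof -
    have "qbr q ^ (N * N) = qbr q ^ (N * (N - 1)) * qbr q ^ N"
    proof -
      have "N * N = N * (N - 1) + N" by (cases N) simp_all
      then show ?thesis by (simp only: power_add)
    qed
    then show ?thesis using c by (simp add: power_mult_distrib b_def power_divide flip: power_mult)
  qed
  also have "inverse (s ^ N) * inverse (qbr q ^ (N * (N - 1))) * (qbr q ^ (N * (N - 1)) * s ^ N) = 1"
  proof -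
    have "inverse a * inverse b * (b * a) = 1" if "a \<noteq> 0" "b \<noteq> 0" for a b :: complex
      using that by (simp add: field_simps)
    then show ?thesis using c s by simp
  qed
  finally show ?thesis by (simp add: \<tau>_def)
qed

section \<open>Continuation to the fourth roots of unity\<close>

lemma asm_det_tendsto:
  assumes "(t \<longlongrightarrow> t0) F" shows "((\<lambda>e. asm_det n (t e)) \<longlongrightarrow> asm_det n (t0 :: complex)) F"
  unfolding asm_det_def by (intro tendsto_det tendsto_intros assms)

text \<open>The exceptional points are finite in number, so near \<open>q\<close> they are avoided
  by all \<open>p \<noteq> q\<close>; there the component equals \<open>V\<close>, whose limit is
  its value at \<open>q\<close>.\<close>

lemma phi_D_eqI:
  assumes "q \<noteq> 0" and r: "\<And>p. p \<noteq> 0 \<Longrightarrow> (r p)^2 = qbr p * qbr (p^2)"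
    and V: "\<And>p. p \<noteq> 0 \<Longrightarrow> p ^ 4 \<noteq> 1 \<Longrightarrow> (brow (p + inverse p) 0 ^^ N) vac \<sigma> = V (p + inverse p)"
    and lim: "((\<lambda>p. V (p + inverse p)) \<longlongrightarrow> V (q + inverse q)) (at q)" and len: "length \<sigma> = N"
  shows "phi_D r q N \<sigma> = V (q + inverse q)"
proof (cases "q ^ 4 = 1")
  case False
  then show ?thesis using V[OF assms(1) False] phi_D_generic_rows[OF assms(1) False r[OF assms(1)] len]
    by (simp add: phi_D_def)
next
  case True
  have "finite {p :: complex. p ^ 4 = 1}" by (rule finite_roots_unity) simp
  then have "\<forall>\<^sub>F p in at q. \<forall>a\<in>{p. p ^ 4 = 1}. p \<noteq> a"
  proof (rule eventually_ball_finite, intro ballI)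
    fix a assume "a \<in> {p :: complex. p ^ 4 = 1}"
    show "\<forall>\<^sub>F p in at q. p \<noteq> a"
      by (cases "a = q") (auto intro: eventually_neq_at_within tendsto_imp_eventually_ne[OF tendsto_ident_at])
  qed
  moreover have "\<forall>\<^sub>F p in at q. p \<noteq> 0" using assms(1) tendsto_imp_eventually_ne[OF tendsto_ident_at] by blast
  ultimately have "\<forall>\<^sub>F p in at q. V (p + inverse p) = phi_D_generic p (r p) N \<sigma>"
  proof eventually_elim
    case (elim p)
    then have "p ^ 4 \<noteq> 1" by blast
    then show ?case using V elim(2) phi_D_generic_rows[OF elim(2) _ r[OF elim(2)] len] by simp
  qed
  with lim have "((\<lambda>p. phi_D_generic p (r p) N \<sigma>) \<longlongrightarrow> V (q + inverse q)) (at q)"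
    by (rule Lim_transform_eventually)
  then have "Lim (at q) (\<lambda>p. phi_D_generic p (r p) N \<sigma>) = V (q + inverse q)"
    by (intro tendsto_Lim) auto
  then show ?thesis using True by (simp add: phi_D_def)
qed

theorem phi_D_components:
  assumes "q \<noteq> 0" "\<And>p. p \<noteq> 0 \<Longrightarrow> (r p)^2 = qbr p * qbr (p^2)" "n \<ge> 1"
  shows "phi_D r q (2 * n) (concat (replicate n [UUp, DDn])) = asm_det n ((q + inverse q) ^ 2)"
    and "phi_D r q (2 * n + 1) (replicate (2 * n + 1) Zero) = (q + inverse q) ^ n * asm_det n ((q + inverse q) ^ 2)"
proof -
  obtain m where m: "n = Suc m" using assms(3) by (cases n) auto
  \<comment> \<open>The even component was computed only for \<open>\<tau> \<noteq> 0\<close>; its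
    zeros \<open>p^2 = -1\<close> lie among the points that \<open>phi_D_eqI\<close> treats by
    continuity.\<close>
  have tau: "p + inverse p \<noteq> 0" if "p \<noteq> 0" "p ^ 4 \<noteq> 1" for p :: complex
  proof
    assume "p + inverse p = 0"
    then have "(p + inverse p) * p = 0" by simp
    then have "p * p = - 1" using that(1) by (simp add: distrib_right add_eq_0_iff2)
    then have "p * p * (p * p) = 1" by simp
    then have "p ^ 4 = 1" by (simp add: power4_eq_xxxx mult.assoc)
    then show False using that by simp
  qed
  have len: "length (concat (replicate n [UUp, DDn])) = 2 * n"
    by (induction n) simp_all
  show "phi_D r q (2 * n) (concat (replicate n [UUp, DDn])) = asm_det n ((q + inverse q) ^ 2)"
  proof (rule phi_D_eqI[OF assms(1,2), where V = "\<lambda>\<tau>. asm_det n (\<tau> ^ 2)"])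
    show "((\<lambda>p. asm_det n ((p + inverse p) ^ 2)) \<longlongrightarrow> asm_det n ((q + inverse q) ^ 2)) (at q)"
      using assms(1) by (intro asm_det_tendsto tendsto_intros)
    fix p :: complex assume "p \<noteq> 0" "p ^ 4 \<noteq> 1"
    then show "(brow (p + inverse p) 0 ^^ (2 * n)) vac (concat (replicate n [UUp, DDn])) = asm_det n ((p + inverse p) ^ 2)"
      using spin1_component_even[OF tau, of p m] by (simp add: m)
  qed (use len in auto)
  show "phi_D r q (2 * n + 1) (replicate (2 * n + 1) Zero) = (q + inverse q) ^ n * asm_det n ((q + inverse q) ^ 2)"
  proof (rule phi_D_eqI[OF assms(1,2), where V = "\<lambda>\<tau>. \<tau> ^ n * asm_det n (\<tau> ^ 2)"])
    show "((\<lambda>p. (p + inverse p) ^ n * asm_det n ((p + inverse p) ^ 2)) \<longlongrightarrow> (q + inverse q) ^ n * asm_det n ((q + inverse q) ^ 2)) (at q)"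
      using assms(1) by (intro asm_det_tendsto tendsto_intros)
    fix p :: complex
    have "2 * n + 1 = 2 * m + 3" by (simp add: m)
    then show "(brow (p + inverse p) 0 ^^ (2 * n + 1)) vac (replicate (2 * n + 1) Zero) = (p + inverse p) ^ n * asm_det n ((p + inverse p) ^ 2)"
      unfolding m by (simp only: spin1_component_odd)
  qed auto
qed

subsection \<open>The six-vertex model\<close>

text \<open>With \<open>a = 1\<close>, \<open>b = u\<close> and \<open>c^2 = vK t u\<close> the
  anisotropy \<open>(a^2 + b^2 - c^2) / (2 a b)\<close> is \<open>1 - t / 2\<close> for every
  \<open>u\<close>, as commuting rows require. At \<open>u = 1\<close> one has
  \<open>vK t 1 = t\<close>, the weight of an entry \<open>-1\<close>, and the other six-vertex
  weights are 1.\<close>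

definition vK :: "complex \<Rightarrow> complex \<Rightarrow> complex" where "vK t u = 1 + (t - 2) * u + u * u"
definition vf :: "complex \<Rightarrow> complex \<Rightarrow> complex \<Rightarrow> complex" where "vf t z j = (1 + (t - 2) * z + z * j) / (j - z)"
definition vg :: "complex \<Rightarrow> complex \<Rightarrow> complex \<Rightarrow> complex" where "vg t z j = - vK t z / (j - z)"

lemma vf_swap: "vf t j z = - ((1 + (t - 2) * j + j * z) / (j - z))"
  unfolding vf_def by (metis minus_diff_eq minus_divide_right)

text \<open>For \<open>h = 0\<close> the state \<open>DDn\<close> is never reached: this is the six-vertex model.\<close>

interpretation sixv: bethe "\<lambda>u. u" "\<lambda>u. u" "\<lambda>u. 1" "\<lambda>u. 1" "\<lambda>u. 1" "vK t" "\<lambda>u. 0" "vf t" "vg t" 0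
  for t :: complex
proof (unfold_locales, goal_cases)
  case (1 z i)
  define p where "p = i - z"
  have "p \<noteq> 0" using 1 by (simp add: p_def)
  then show ?case unfolding vg_def vf_swap[of t i z] p_def[symmetric]
    by (simp add: divide_simps) (simp add: vK_def p_def algebra_simps)
next
  case (2 z i)
  define p where "p = i - z"
  have "p \<noteq> 0" using 2 by (simp add: p_def)
  then show ?case unfolding vg_def p_def[symmetric]
    by (simp add: divide_simps) (simp add: vK_def p_def algebra_simps)
next
  case (3 z i)
  define p where "p = i - z"
  have "p \<noteq> 0" using 3 by (simp add: p_def)
  then show ?case unfolding vg_def vf_def p_def[symmetric]
    by (simp add: divide_simps) (simp add: vK_def p_def algebra_simps)
next
  case (4 z i j)
  define p q r where "p = i - z" and "q = j - z" and "r = j - i"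
  have "p \<noteq> 0" "q \<noteq> 0" "r \<noteq> 0" using 4 by (simp_all add: p_def q_def r_def)
  then show ?case unfolding vg_def vf_swap[of t i z] vf_swap[of t j z] vf_swap[of t j i] vf_def[of t i j]
      p_def[symmetric] q_def[symmetric] r_def[symmetric]
    by (simp add: divide_simps) (simp add: vK_def p_def q_def r_def algebra_simps)
qed auto

definition vrow :: "complex \<Rightarrow> complex \<Rightarrow> (spin_one list \<Rightarrow> complex) \<Rightarrow> spin_one list \<Rightarrow> complex" where
  "vrow t u R \<sigma> = rowop (sixv.wt t u) Up \<sigma> Dn R"

lemma sixv_bw_rows:
  "distinct us \<Longrightarrow> foldr (vrow t) us (\<lambda>\<sigma>. sixv.bw t \<sigma> {}) = (\<lambda>\<sigma>. sixv.bw t \<sigma> (set us))"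
  using sixv.bw_rows[of us t] by (simp add: vrow_def[abs_def])

lemma tendsto_vrow:
  assumes "(u \<longlongrightarrow> u0) F" "\<And>\<rho>. ((\<lambda>e. R e \<rho>) \<longlongrightarrow> R' \<rho>) F"
  shows "((\<lambda>e. vrow t (u e) (R e) \<sigma>) \<longlongrightarrow> vrow t u0 R' \<sigma>) F"
  unfolding vrow_def vK_def
  by (intro tendsto_rowop tendsto_wts tendsto_intros assms)

text \<open>The rapidities collapse to 1, the fixed point of \<open>u \<mapsto> 1 / u\<close>, where
  the rows count matrices.\<close>

definition vnode :: "real \<Rightarrow> nat \<Rightarrow> complex" where "vnode e i = 1 + node e i"

lemma vnode_tendsto: "((\<lambda>e. vnode e i) \<longlongrightarrow> 1) (at_right 0)"
  unfolding vnode_def by (auto intro!: tendsto_eq_intros node_tendsto)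

lemma inj_vnode: "e > 0 \<Longrightarrow> inj (vnode e)"
  using inj_node[of e] by (auto simp: vnode_def inj_def)

lemma tendsto_vrow_rows:
  "((\<lambda>e. foldr (vrow t) (map (vnode e) is) R \<sigma>) \<longlongrightarrow> (vrow t 1 ^^ length is) R \<sigma>) (at_right 0)"
proof (induction "is" arbitrary: \<sigma>)
  case Nil
  then show ?case by simp
next
  case (Cons i "is")
  have "((\<lambda>e. vrow t (vnode e i) (foldr (vrow t) (map (vnode e) is) R) \<sigma>) \<longlongrightarrow> vrow t 1 ((vrow t 1 ^^ length is) R) \<sigma>) (at_right 0)"
    by (intro tendsto_vrow vnode_tendsto Cons.IH)
  then show ?case by simp
qed

lemma sixv_rows_limit:
  "((\<lambda>e. sixv.bw t \<sigma> (vnode e ` {..<N})) \<longlongrightarrow> (vrow t 1 ^^ N) vac \<sigma>) (at_right 0)"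
proof -
  have v: "vac = (\<lambda>\<sigma>. sixv.bw t \<sigma> {})" by (auto simp: vac_def sixv.bw_empty)
  have "((\<lambda>e. foldr (vrow t) (map (vnode e) [0..<N]) vac \<sigma>) \<longlongrightarrow> (vrow t 1 ^^ length [0..<N]) vac \<sigma>) (at_right 0)"
    by (rule tendsto_vrow_rows)
  moreover have "\<forall>\<^sub>F e in at_right 0. foldr (vrow t) (map (vnode e) [0..<N]) vac \<sigma> = sixv.bw t \<sigma> (vnode e ` {..<N})"
    using eventually_at_right_less[of "0::real"]
  proof eventually_elim
    case (elim e)
    then have "inj (vnode e)" by (rule inj_vnode)
    then have "distinct (map (vnode e) [0..<N])" by (auto simp: distinct_map intro: inj_on_subset)
    then have "foldr (vrow t) (map (vnode e) [0..<N]) vac = (\<lambda>\<sigma>. sixv.bw t \<sigma> (set (map (vnode e) [0..<N])))"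
      unfolding v by (rule sixv_bw_rows)
    then show ?case by (simp add: atLeast0LessThan)
  qed
  ultimately show ?thesis by (auto elim: Lim_transform_eventually)
qed

text \<open>The partial row sums \<open>0, 1, 0, ..., 1, 0\<close> that the middle column
  \<open>1, -1, ..., 1\<close> forces on the columns to its left.\<close>

definition alt_state :: "nat \<Rightarrow> spin_one list" where
  "alt_state n = concat (replicate n [UUp, Zero]) @ [UUp]"

text \<open>The \<open>s\<close> and \<open>y\<close> of the alternant, with \<open>vK t\<close> as
  \<open>x\<close>; for \<open>u \<noteq> 0\<close>, \<open>vy t u\<close> is \<open>vK t\<close> at
  \<open>1 / u\<close>.\<close>

definition vs :: "complex \<Rightarrow> complex" where "vs u = u + inverse u - 2"
definition vy :: "complex \<Rightarrow> complex \<Rightarrow> complex" where "vy t u = vK t u / u ^ 2"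

text \<open>The factor \<open>i * k - 1\<close> is common to both differences and cancels. One of
  the two factors \<open>k\<close> on the left stems from the \<open>UUp\<close> site that precedes
  each \<open>Zero\<close>.\<close>

lemma sixv_scattering:
  assumes "i \<noteq> 0" "k \<noteq> 0" "vs k \<noteq> vs i"
  shows "k * (k * vf t i k) = i * k * ((vK t k - vy t i) / (vs k - vs i))"
proof -
  have s: "vs k - vs i = (k - i) * (i * k - 1) / (i * k)"
    using assms(1,2) unfolding vs_def by (simp add: divide_simps) (simp add: algebra_simps)
  then have ne: "k - i \<noteq> 0" "i * k - 1 \<noteq> 0" using assms by auto
  have d: "vK t k - vy t i = (i * k - 1) * (1 + (t - 2) * i + i * k) / i ^ 2"
    using assms(1,2) unfolding vK_def vy_def by (simp add: divide_simps) (simp add: algebra_simps power2_eq_square)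
  show ?thesis unfolding s d vf_def using assms(1,2) ne by (simp add: divide_simps power2_eq_square)
qed

lemma sixv_alternant:
  assumes "distinct us" "inj_on vs (set us)" "\<And>u. u \<in> set us \<Longrightarrow> u \<noteq> 0 \<and> vK t u \<noteq> vy t u"
  defines "N \<equiv> length us"
  shows "sixv.bw t (alt_state N) (set us) * det (mat N N (\<lambda>(i, j). vs (us ! i) ^ j))
     = (\<Prod>u\<in>set us. u ^ N) * det (mat N N (\<lambda>(i, j). hs j (vK t (us ! i)) (vy t (us ! i))))"
proof -
  \<comment> \<open>The exponent is \<open>card S\<close>, one more than for spin one: the
    \<open>UUp\<close> site also contributes a factor \<open>i\<close> for the peeled
    rapidity.\<close>
  define r where "r S = sixv.bw t (alt_state (card S)) S / (\<Prod>u\<in>S. u ^ card S)" for S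
  have "r (set us) * alt us (\<lambda>j k. vs k ^ j) = alt us (\<lambda>j k. hs j (vK t k) (vy t k))"
  proof (rule alternant_of_recursion[OF assms(1,2)])
    show "r {} = 1" by (simp add: r_def alt_state_def)
    show "\<And>k. k \<in> set us \<Longrightarrow> vK t k \<noteq> vy t k" using assms(3) by auto
    fix S assume S: "S \<subseteq> set us" "S \<noteq> {}"
    then have fin: "finite S" using finite_subset by blast
    have nz: "u \<noteq> 0" if "u \<in> S" for u using that assms(3) S by auto
    obtain m where m: "card S = Suc m" using fin S(2) by (metis card_gt_0_iff gr0_conv_Suc)
    have "sixv.bw t (alt_state (card S)) S
      = (\<Sum>i\<in>S. (\<Prod>k\<in>S. k) * ((\<Prod>k\<in>S-{i}. k * vf t i k) * sixv.bw t (alt_state m) (S-{i})))"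
      by (simp add: m alt_state_def sum_distrib_left)
    also have "\<dots> = (\<Sum>i\<in>S. (\<Prod>u\<in>S. u ^ Suc m) * ((\<Prod>k\<in>S-{i}. (vK t k - vy t i) / (vs k - vs i)) * r (S - {i})))"
    proof (intro sum.cong refl)
      fix i assume i: "i \<in> S"
      have c: "card (S - {i}) = m" using m fin i by simp
      have sc: "k * (k * vf t i k) = i * k * ((vK t k - vy t i) / (vs k - vs i))" if "k \<in> S - {i}" for k
      proof (rule sixv_scattering)
        show "vs k \<noteq> vs i" using assms(2) that i S by (auto simp: inj_on_def)
      qed (use nz that i in auto)
      have r: "sixv.bw t (alt_state m) (S-{i}) = r (S - {i}) * (\<Prod>u\<in>S-{i}. u ^ m)"
        using nz fin unfolding r_def c by simp
      have pw: "i * ((\<Prod>k\<in>S-{i}. i * k) * (\<Prod>u\<in>S-{i}. u ^ m)) = (\<Prod>u\<in>S. u ^ Suc m)"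
        using fin i c by (simp add: prod.distrib prod.remove[of S i] mult.assoc)
      have "(\<Prod>k\<in>S. k) * (\<Prod>k\<in>S-{i}. k * vf t i k) = i * (\<Prod>k\<in>S-{i}. k * (k * vf t i k))"
        using fin i by (simp add: prod.remove[of S i] prod.distrib mult.assoc)
      also have "(\<Prod>k\<in>S-{i}. k * (k * vf t i k)) = (\<Prod>k\<in>S-{i}. i * k) * (\<Prod>k\<in>S-{i}. (vK t k - vy t i) / (vs k - vs i))"
        unfolding prod.distrib[symmetric] by (intro prod.cong refl) (simp only: sc)
      finally have A: "(\<Prod>k\<in>S. k) * (\<Prod>k\<in>S-{i}. k * vf t i k)
        = i * ((\<Prod>k\<in>S-{i}. i * k) * (\<Prod>k\<in>S-{i}. (vK t k - vy t i) / (vs k - vs i)))" .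
      have swap: "a * (a' * (s * d)) = b * (b' * d) * (c * s)" if "a * a' = b * (b' * c)" for a a' b b' c d s :: complex
      proof -
        have "a * (a' * (s * d)) = a * a' * (s * d)" by simp
        then show ?thesis unfolding that by simp
      qed
      show "(\<Prod>k\<in>S. k) * ((\<Prod>k\<in>S-{i}. k * vf t i k) * sixv.bw t (alt_state m) (S-{i}))
        = (\<Prod>u\<in>S. u ^ Suc m) * ((\<Prod>k\<in>S-{i}. (vK t k - vy t i) / (vs k - vs i)) * r (S - {i}))"
        unfolding r pw[symmetric] by (rule swap[OF A])
    qed
    also have "\<dots> = (\<Prod>u\<in>S. u ^ Suc m) * (\<Sum>i\<in>S. (\<Prod>k\<in>S-{i}. (vK t k - vy t i) / (vs k - vs i)) * r (S - {i}))"
      by (simp only: sum_distrib_left)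
    finally have bw: "sixv.bw t (alt_state (card S)) S = \<dots>" .
    have "(\<Prod>u\<in>S. u ^ Suc m) \<noteq> 0" using nz fin by simp
    then show "r S = (\<Sum>i\<in>S. (\<Prod>k\<in>S-{i}. (vK t k - vy t i) / (vs k - vs i)) * r (S - {i}))"
      unfolding r_def[of S] bw unfolding m by (rule nonzero_mult_div_cancel_left)
  qed
  moreover have "card (set us) = N" using assms(1) by (simp add: distinct_card N_def)
  moreover have "(\<Prod>u\<in>set us. u ^ N) \<noteq> 0" using assms(3) by auto
  ultimately show ?thesis by (simp add: r_def alt_def N_def[symmetric] field_simps)
qed

definition vpoly :: "complex \<Rightarrow> nat \<Rightarrow> complex poly" where
  "vpoly t j = [:t, 1:] ^ j * eps j [:0, 1:]"

lemma poly_eps: "poly (eps j p) a = eps j (poly p a :: complex)"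
proof (induction j rule: induct_nat_012)
  case (ge2 j)
  then show ?case by (simp add: eps_Suc_Suc)
qed simp_all

lemma pcompose_numeral_2: "pcompose 2 q = (2 :: complex poly)"
  using pcompose_const[of 2 q] by (simp add: numeral_poly)

lemma pcompose_pow: "pcompose (p ^ n) q = pcompose p q ^ n"
  by (induction n) (simp_all add: pcompose_mult pcompose_1)

lemma pcompose_eps: "pcompose (eps j p) q = eps j (pcompose p q :: complex poly)"
proof (induction j rule: induct_nat_012)
  case (ge2 j)
  then show ?case by (simp add: eps_Suc_Suc pcompose_diff pcompose_mult pcompose_add pcompose_numeral_2)
qed (simp_all add: pcompose_add pcompose_numeral_2 pcompose_1)

lemma fps_of_poly_eps: "fps_of_poly (eps j p) = eps j (fps_of_poly p :: complex fps)"
proof (induction j rule: induct_nat_012)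
  case (ge2 j)
  then show ?case by (simp add: eps_Suc_Suc fps_of_poly_simps)
qed (simp_all add: fps_of_poly_simps)

text \<open>\<open>vK t u\<close> and \<open>vy t u\<close> are \<open>(vs u + t)\<close> times
  \<open>u\<close> and \<open>1 / u\<close>; homogeneity of \<open>hs\<close> leaves
  \<open>hs j u (1 / u)\<close>, which is the Chebyshev polynomial
  \<open>eps j (vs u)\<close>.\<close>

lemma poly_vpoly:
  assumes "u \<noteq> 0"
  shows "poly (vpoly t j) (vs u) = hs j (vK t u) (vy t u)"
proof -
  have e: "hs j u (inverse u) = eps j (vs u)" for j
  proof (induction j rule: induct_nat_012)
    case (ge2 j)
    then show ?case using assms by (simp add: hs_Suc_Suc eps_Suc_Suc vs_def)
  qed (simp_all add: vs_def)
  have x: "vK t u = (vs u + t) * u" "vy t u = (vs u + t) * inverse u"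
    using assms by (simp_all add: vK_def vy_def vs_def field_simps power2_eq_square)
  have "hs j (c * a) (c * b) = c ^ j * hs j a b" for a b c :: complex
  proof (induction j rule: induct_nat_012)
    case (ge2 j)
    then show ?case by (simp add: hs_Suc_Suc algebra_simps)
  qed (simp_all add: algebra_simps)
  then have "hs j (vK t u) (vy t u) = (vs u + t) ^ j * eps j (vs u)"
    unfolding x by (simp add: e)
  then show ?thesis by (simp add: vpoly_def poly_eps add.commute)
qed

text \<open>Rescaling the variable by \<open>t\<close> multiplies row \<open>i\<close> by
  \<open>t^i\<close> and column \<open>j\<close> by \<open>t^(-j)\<close>, which cancel in the
  determinant for \<open>t \<noteq> 0\<close>. A further factor \<open>1 + X\<close> gives
  \<open>odd_part\<close>, where \<open>csqrt t\<close> serves as a \<open>\<tau>\<close> with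
  \<open>\<tau>^2 = t\<close>.\<close>

lemma det_vpoly:
  assumes "t \<noteq> 0"
  shows "det (mat n n (\<lambda>(i, j). coeff (vpoly t j) i)) = asm_det n t"
proof -
  define P where "P j = [:1, 1:] ^ j * eps j [:0, t:]" for j
  have "pcompose (vpoly t j) [:0, t:] = smult (t ^ j) (P j)" for j
  proof -
    have "pcompose [:t, 1:] [:0, t:] = smult t [:1, 1:]" "pcompose [:0, 1:] [:0, t:] = [:0, t:]"
      by (simp_all add: pcompose_pCons)
    then show ?thesis
      unfolding vpoly_def P_def pcompose_mult pcompose_pow pcompose_eps by (simp only: smult_power mult_smult_left)
  qed
  then have co: "t ^ i * coeff (vpoly t j) i = t ^ j * coeff (P j) i" for i j
    by (metis coeff_pcompose_linear coeff_smult)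
  have odd: "(1 + fps_X) * fps_of_poly (P j) = odd_part (csqrt t) j" for j
  proof -
    have 1: "fps_of_poly [:1, 1:] = (1 + fps_X :: complex fps)" by (simp add: fps_of_poly_pCons)
    have 2: "fps_of_poly [:0, t:] = fps_const t * fps_X" by (simp add: fps_of_poly_pCons)
    show ?thesis unfolding P_def odd_part_def fps_of_poly_mult fps_of_poly_power fps_of_poly_eps 1 2 by (simp add: mult.assoc)
  qed
  have "(\<Prod>i<n. t ^ i) * det (mat n n (\<lambda>(i, j). coeff (vpoly t j) i)) = det (mat n n (\<lambda>(i, j). t ^ j * coeff (P j) i))"
    unfolding det_row_scale[symmetric] co ..
  also have "\<dots> = det (mat n n (\<lambda>(j, i). t ^ j * coeff (P j) i))" by (rule det_swap_index[symmetric])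
  also have "\<dots> = (\<Prod>i<n. t ^ i) * det (mat n n (\<lambda>(j, i). coeff (P j) i))" by (rule det_row_scale)
  finally have "det (mat n n (\<lambda>(i, j). coeff (vpoly t j) i)) = det (mat n n (\<lambda>(j, i). coeff (P j) i))"
    using assms by simp
  also have "\<dots> = det (mat n n (\<lambda>(i, j). coeff (P j) i))" by (rule det_swap_index[symmetric])
  also have "\<dots> = det (mat n n (\<lambda>(i, j). fps_nth (fps_of_poly (P j)) i))" by simp
  also have "\<dots> = det (mat n n (\<lambda>(i, j). fps_nth ((1 + fps_X) * fps_of_poly (P j)) i))"
    by (rule det_fps_mult[symmetric]) simp
  also have "\<dots> = det (mat n n (\<lambda>(i, j). fps_nth (odd_part (csqrt t) j) i))"
    by (simp only: odd)
  also have "\<dots> = det (mat n n (\<lambda>(c, k). fps_nth (odd_part (csqrt t) c) k))"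
    by (rule det_swap_index)
  finally show ?thesis by (simp add: odd_part_det)
qed

theorem sixv_component:
  assumes "t \<noteq> 0"
  shows "(vrow t 1 ^^ n) vac (alt_state n) = asm_det n t"
proof -
  let ?us = "\<lambda>e. map (vnode e) [0..<n]"
  have us: "set (?us e) = vnode e ` {..<n}" "length (?us e) = n" for e by auto
  define r where "r e = sixv.bw t (alt_state n) (vnode e ` {..<n}) / (\<Prod>i<n. vnode e i ^ n)" for e
  \<comment> \<open>\<open>vK t u = vy t u\<close> means \<open>vK t u * (u^2 - 1) = 0\<close>; near
    \<open>u = 1\<close> the first factor is close to \<open>t\<close>, the other is
    \<open>node * (2 + node)\<close>.\<close>
  have evK: "\<forall>\<^sub>F e in at_right 0. vK t (vnode e i) \<noteq> 0" for i
  proof (rule tendsto_imp_eventually_ne)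
    show "((\<lambda>e. vK t (vnode e i)) \<longlongrightarrow> t) (at_right 0)"
      unfolding vK_def by (auto intro!: tendsto_eq_intros vnode_tendsto)
  qed (use assms in auto)
  have ev2: "\<forall>\<^sub>F e in at_right 0. 2 + node e i \<noteq> 0" for i
  proof (rule tendsto_imp_eventually_ne)
    show "((\<lambda>e. 2 + node e i) \<longlongrightarrow> 2) (at_right 0)"
      by (auto intro!: tendsto_eq_intros node_tendsto)
  qed auto
  have "\<forall>\<^sub>F e in at_right 0. e > 0 \<and> good_nodes 1 (node e ` {..<n}) \<and> (\<forall>i\<in>{..<n}. vK t (vnode e i) \<noteq> 0) \<and> (\<forall>i\<in>{..<n}. 2 + node e i \<noteq> 0)"
    by (intro eventually_conj eventually_ball_finite ballI evK ev2 eventually_good_nodes eventually_at_right_less) auto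
  then have ev: "\<forall>\<^sub>F e in at_right 0. inj (vnode e) \<and> inj_on (\<lambda>i. vs (vnode e i)) {..<n} \<and>
      (\<forall>i<n. vnode e i \<noteq> 0 \<and> vK t (vnode e i) \<noteq> vy t (vnode e i))"
  proof eventually_elim
    case (elim e)
    have nz: "vnode e i \<noteq> 0" if "i < n" for i using elim that by (auto simp: good_nodes_def vnode_def)
    have inj: "inj_on (node e) {..<n}" using elim inj_node inj_on_subset by blast
    have "inj_on (pn 1 \<circ> node e) {..<n}"
      using elim by (intro comp_inj_on[OF inj]) (auto simp: good_nodes_def)
    \<comment> \<open>In terms of \<open>u - 1\<close> the variable \<open>vs\<close> is the
      \<open>pn\<close> of spin one at \<open>\<tau> = 1\<close>, so the injectivity shown for
      \<open>good_nodes\<close> applies.\<close>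
    moreover have "vs (vnode e i) = pn 1 (node e i)" if "i < n" for i
      using nz[OF that] unfolding vs_def pn_def vnode_def by (simp add: divide_simps) (simp add: algebra_simps power2_eq_square)
    ultimately have "inj_on (\<lambda>i. vs (vnode e i)) {..<n}" by (auto simp: inj_on_def)
    moreover have "vK t (vnode e i) \<noteq> vy t (vnode e i)" if "i < n" for i
    proof
      assume "vK t (vnode e i) = vy t (vnode e i)"
      moreover have "vy t (vnode e i) * vnode e i ^ 2 = vK t (vnode e i)" using nz[OF that] by (simp add: vy_def)
      ultimately have "vK t (vnode e i) * (vnode e i ^ 2 - 1) = 0" by (simp add: right_diff_distrib)
      moreover have "vnode e i ^ 2 - 1 = node e i * (2 + node e i)"
        by (simp add: vnode_def power2_eq_square algebra_simps)
      ultimately show False using elim that node_nonzero[of e i] by simp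
    qed
    ultimately show ?case using nz elim inj_vnode by blast
  qed
  have "(r \<longlongrightarrow> det (mat n n (\<lambda>(i, j). coeff (vpoly t j) i))) (at_right 0)"
  proof (rule confluent_alternant)
    show "((\<lambda>e. vs (vnode e i)) \<longlongrightarrow> 0) (at_right 0)" for i
      unfolding vs_def by (auto intro!: tendsto_eq_intros vnode_tendsto)
    show "\<forall>\<^sub>F e in at_right 0. inj_on (\<lambda>i. vs (vnode e i)) {..<n} \<and>
      r e * det (mat n n (\<lambda>(i, j). vs (vnode e i) ^ j)) = det (mat n n (\<lambda>(i, j). poly (vpoly t j) (vs (vnode e i))))"
      using ev
    proof eventually_elim
      case (elim e)
      have inj: "inj_on (vnode e) A" for A using elim inj_on_subset by blast
      have dist: "distinct (?us e)" using inj by (simp add: distinct_map)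
      have idx: "mat n n (\<lambda>(i, j). F j (?us e ! i)) = mat n n (\<lambda>(i, j). F j (vnode e i))" for F :: "nat \<Rightarrow> complex \<Rightarrow> complex"
        by (rule eq_matI) auto
      have "inj_on vs (vnode e ` {..<n})" using elim by (auto simp: inj_on_def)
      then have c1: "inj_on vs (set (?us e))" by (simp only: us)
      have c2: "u \<noteq> 0 \<and> vK t u \<noteq> vy t u" if "u \<in> set (?us e)" for u
        using elim that by auto
      have "sixv.bw t (alt_state n) (vnode e ` {..<n}) * det (mat n n (\<lambda>(i, j). vs (vnode e i) ^ j))
        = (\<Prod>u\<in>vnode e ` {..<n}. u ^ n) * det (mat n n (\<lambda>(i, j). hs j (vK t (vnode e i)) (vy t (vnode e i))))"
        using sixv_alternant[OF dist c1, of t, OF c2]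
        unfolding us idx[of "\<lambda>j u. vs u ^ j"] idx[of "\<lambda>j u. hs j (vK t u) (vy t u)"] .
      moreover have "(\<Prod>u\<in>vnode e ` {..<n}. u ^ n) = (\<Prod>i<n. vnode e i ^ n)" using inj by (simp add: prod.reindex)
      moreover have "(\<Prod>i<n. vnode e i ^ n) \<noteq> 0" using elim by auto
      ultimately have "r e * det (mat n n (\<lambda>(i, j). vs (vnode e i) ^ j))
        = det (mat n n (\<lambda>(i, j). hs j (vK t (vnode e i)) (vy t (vnode e i))))"
        by (simp add: r_def field_simps)
      also have "\<dots> = det (mat n n (\<lambda>(i, j). poly (vpoly t j) (vs (vnode e i))))"
        using elim by (intro arg_cong[of _ _ det] eq_matI) (auto simp: poly_vpoly)
      finally show ?case using elim by blast
    qed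
  qed
  then have "((\<lambda>e. r e * (\<Prod>i<n. vnode e i ^ n)) \<longlongrightarrow> asm_det n t * (\<Prod>i<n. 1 ^ n)) (at_right 0)"
    unfolding det_vpoly[OF assms] by (intro tendsto_intros vnode_tendsto)
  moreover have "\<forall>\<^sub>F e in at_right 0. r e * (\<Prod>i<n. vnode e i ^ n) = sixv.bw t (alt_state n) (vnode e ` {..<n})"
    using ev by eventually_elim (auto simp: r_def)
  ultimately have "((\<lambda>e. sixv.bw t (alt_state n) (vnode e ` {..<n})) \<longlongrightarrow> asm_det n t) (at_right 0)"
    by (auto elim: Lim_transform_eventually)
  with sixv_rows_limit[of t "alt_state n" n] show ?thesis
    by (rule tendsto_unique[rotated]) simp
qed

subsection \<open>Vertically symmetric alternating sign matrices as six-vertex paths\<close>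

definition asmseq :: "nat \<Rightarrow> (nat \<Rightarrow> int) \<Rightarrow> bool" where
  "asmseq m f \<longleftrightarrow> (\<forall>k\<le>m. (\<Sum>j<k. f j) \<in> {0, 1}) \<and> (\<Sum>j<m. f j) = 1"

lemma asmseq_entry:
  assumes "asmseq m f" "j < m" shows "f j \<in> {-1, 0, 1}"
proof -
  have "(\<Sum>j<j. f j) \<in> {0, 1}" "(\<Sum>j<Suc j. f j) \<in> {0, 1}"
    using assms by (auto simp: asmseq_def simp del: sum.lessThan_Suc)
  then show ?thesis by auto
qed

lemma sum_zero_between:
  fixes f :: "nat \<Rightarrow> int"
  assumes "l \<le> k" "\<And>j. l \<le> j \<Longrightarrow> j < k \<Longrightarrow> f j = 0"
  shows "(\<Sum>j<k. f j) = (\<Sum>j<l. f j)"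
  using assms by (intro sum.mono_neutral_right) auto

text \<open>Prefix sums turn a condition on consecutive non-zero entries into a local one that a
  vertex model can enforce. Alternation makes the prefix sums oscillate between 0 and the first
  non-zero entry, which the total identifies as 1.\<close>

lemma alternating_iff_asmseq:
  fixes f :: "nat \<Rightarrow> int"
  shows "(\<forall>j<m. f j \<in> {-1, 0, 1}) \<and> (\<Sum>j<m. f j) = 1 \<and>
      (\<forall>j<m. \<forall>j'<m. j < j' \<and> f j \<noteq> 0 \<and> f j' \<noteq> 0 \<and> (\<forall>l. j < l \<and> l < j' \<longrightarrow> f l = 0) \<longrightarrow> f j' = - f j)
    \<longleftrightarrow> asmseq m f" (is "?L \<longleftrightarrow> ?R")
proof
  assume R: ?R
  show ?L
  proof (intro conjI allI impI)
    show "f j \<in> {-1, 0, 1}" if "j < m" for j using asmseq_entry[OF R that] .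
    show "(\<Sum>j<m. f j) = 1" using R by (simp add: asmseq_def)
    fix j j' assume j: "j < m" "j' < m" and A: "j < j' \<and> f j \<noteq> 0 \<and> f j' \<noteq> 0 \<and> (\<forall>l. j < l \<and> l < j' \<longrightarrow> f l = 0)"
    have "(\<Sum>l<j'. f l) = (\<Sum>l<Suc j. f l)" using A by (intro sum_zero_between) auto
    moreover have "(\<Sum>l<j. f l) \<in> {0, 1}" "(\<Sum>l<Suc j. f l) \<in> {0, 1}" "(\<Sum>l<Suc j'. f l) \<in> {0, 1}"
      using R j by (auto simp: asmseq_def simp del: sum.lessThan_Suc)
    ultimately show "f j' = - f j" using A by auto
  qed
next
  assume L: ?L
  have alt: "f j' = - f j" if "j < j'" "j' < m" "f j \<noteq> 0" "f j' \<noteq> 0" "\<And>l. j < l \<Longrightarrow> l < j' \<Longrightarrow> f l = 0" for j j'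
    using L that by (meson less_trans)
  have "\<exists>j<m. f j \<noteq> 0"
  proof (rule ccontr)
    assume "\<not> (\<exists>j<m. f j \<noteq> 0)"
    then have "(\<Sum>j<m. f j) = 0" by (intro sum.neutral) auto
    then show False using L by simp
  qed
  define p where "p = (LEAST j. j < m \<and> f j \<noteq> 0)"
  have p: "p < m" "f p \<noteq> 0" using \<open>\<exists>j<m. f j \<noteq> 0\<close> unfolding p_def by (metis (mono_tags, lifting) LeastI)+
  have before: "f j = 0" if "j < p" for j
    using not_less_Least[of j "\<lambda>j. j < m \<and> f j \<noteq> 0"] that p(1) unfolding p_def[symmetric] by auto
  \<comment> \<open>Besides the prefix sum, the invariant records the sign of the last non-zero
    entry, which decides the next one. \<open>p\<close> is the first non-zero position.\<close>
  have inv: "((\<Sum>j<k. f j) = f p \<and> (\<exists>l<k. f l = f p \<and> (\<forall>j. l < j \<and> j < k \<longrightarrow> f j = 0))) \<or>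
      ((\<Sum>j<k. f j) = 0 \<and> (\<exists>l<k. f l = - f p \<and> (\<forall>j. l < j \<and> j < k \<longrightarrow> f j = 0)))"
    if "p < k" "k \<le> m" for k
    using that
  proof (induction k)
    case 0
    then show ?case by simp
  next
    case (Suc k)
    show ?case
    proof (cases "k = p")
      case True
      have "(\<Sum>j<p. f j) = 0" using before by (intro sum.neutral) auto
      then have "(\<Sum>j<Suc k. f j) = f p" by (simp add: True)
      moreover have "\<exists>l<Suc k. f l = f p \<and> (\<forall>j. l < j \<and> j < Suc k \<longrightarrow> f j = 0)"
        by (intro exI[of _ p]) (simp add: True)
      ultimately show ?thesis by blast
    next
      case False
      then have IH: "((\<Sum>j<k. f j) = f p \<and> (\<exists>l<k. f l = f p \<and> (\<forall>j. l < j \<and> j < k \<longrightarrow> f j = 0))) \<or>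
        ((\<Sum>j<k. f j) = 0 \<and> (\<exists>l<k. f l = - f p \<and> (\<forall>j. l < j \<and> j < k \<longrightarrow> f j = 0)))" using Suc by simp
      show ?thesis
      proof (cases "f k = 0")
        case True
        have ext: "\<forall>j. l < j \<and> j < Suc k \<longrightarrow> f j = 0" if "\<forall>j. l < j \<and> j < k \<longrightarrow> f j = 0" for l
          using that True by (auto simp: less_Suc_eq)
        have "(\<Sum>j<Suc k. f j) = (\<Sum>j<k. f j)" using True by simp
        moreover have "\<exists>l<Suc k. f l = c \<and> (\<forall>j. l < j \<and> j < Suc k \<longrightarrow> f j = 0)"
          if "\<exists>l<k. f l = c \<and> (\<forall>j. l < j \<and> j < k \<longrightarrow> f j = 0)" for c
        proof -
          from that obtain l where "l < k" "f l = c" "\<forall>j. l < j \<and> j < k \<longrightarrow> f j = 0" by blast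
          then show ?thesis using ext by (intro exI[of _ l]) simp
        qed
        ultimately show ?thesis using IH by presburger
      next
        case fk: False
        from IH show ?thesis
        proof
          assume A: "(\<Sum>j<k. f j) = f p \<and> (\<exists>l<k. f l = f p \<and> (\<forall>j. l < j \<and> j < k \<longrightarrow> f j = 0))"
          then obtain l where l: "l < k" "f l = f p" "\<forall>j. l < j \<and> j < k \<longrightarrow> f j = 0" by blast
          have fk': "f k = - f p" using alt[of l k] l fk p Suc.prems by simp
          then have "(\<Sum>j<Suc k. f j) = 0" using A by simp
          moreover have "\<exists>l<Suc k. f l = - f p \<and> (\<forall>j. l < j \<and> j < Suc k \<longrightarrow> f j = 0)"
            using fk' by (intro exI[of _ k]) simp
          ultimately show ?thesis by blast
        next
          assume A: "(\<Sum>j<k. f j) = 0 \<and> (\<exists>l<k. f l = - f p \<and> (\<forall>j. l < j \<and> j < k \<longrightarrow> f j = 0))"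
          then obtain l where l: "l < k" "f l = - f p" "\<forall>j. l < j \<and> j < k \<longrightarrow> f j = 0" by blast
          have fk': "f k = f p" using alt[of l k] l fk p Suc.prems by simp
          then have "(\<Sum>j<Suc k. f j) = f p" using A by simp
          moreover have "\<exists>l<Suc k. f l = f p \<and> (\<forall>j. l < j \<and> j < Suc k \<longrightarrow> f j = 0)"
            using fk' by (intro exI[of _ k]) simp
          ultimately show ?thesis by blast
        qed
      qed
    qed
  qed
  \<comment> \<open>The total is \<open>f p\<close> or \<open>0\<close> by the invariant and
    \<open>1\<close> by assumption.\<close>
  have fp: "f p = 1" using inv[of m] p L by auto
  have "(\<Sum>j<k. f j) \<in> {0, 1}" if "k \<le> m" for k
  proof (cases "p < k")
    case True
    then show ?thesis using inv[of k] that fp by auto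
  next
    case False
    then have "(\<Sum>j<k. f j) = 0" using before by (intro sum.neutral) auto
    then show ?thesis by simp
  qed
  then show ?R using L by (simp add: asmseq_def)
qed

lemma alternating_sign_matrix_asmseq:
  "alternating_sign_matrix m M \<longleftrightarrow> M \<in> carrier_mat m m \<and>
     (\<forall>i<m. asmseq m (\<lambda>j. M $$ (i, j))) \<and> (\<forall>j<m. asmseq m (\<lambda>i. M $$ (i, j)))"
proof -
  have r: "(\<forall>i<m. asmseq m (F i)) \<longleftrightarrow> (\<forall>i<m. \<forall>j<m. F i j \<in> {-1, 0, 1}) \<and> (\<forall>i<m. (\<Sum>j<m. F i j) = 1) \<and>
      (\<forall>i<m. \<forall>j<m. \<forall>j'<m. j < j' \<and> F i j \<noteq> 0 \<and> F i j' \<noteq> 0 \<and> (\<forall>l. j < l \<and> l < j' \<longrightarrow> F i l = 0) \<longrightarrow> F i j' = - F i j)"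
    for F :: "nat \<Rightarrow> nat \<Rightarrow> int"
    unfolding alternating_iff_asmseq[symmetric] by (simp only: imp_conjR all_conj_distrib)
  have swap: "(\<forall>i<m. \<forall>j<m. M $$ (i, j) \<in> {-1, 0, 1}) \<longleftrightarrow> (\<forall>j<m. \<forall>i<m. M $$ (i, j) \<in> {-1, 0, 1})" by blast
  show ?thesis
    unfolding alternating_sign_matrix_def r[of "\<lambda>i j. M $$ (i, j)"] r[of "\<lambda>j i. M $$ (i, j)"]
    using swap by argo
qed

lemma sum_mirror:
  fixes g :: "nat \<Rightarrow> int"
  assumes "\<And>j. j \<le> 2 * n \<Longrightarrow> g (2 * n - j) = g j" "k \<le> 2 * n + 1"
  shows "(\<Sum>j<2 * n + 1 - k. g j) = (\<Sum>j<2 * n + 1. g j) - (\<Sum>j<k. g j)"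
  using assms(2)
proof (induction k)
  case (Suc k)
  have "2 * n + 1 - k = Suc (2 * n + 1 - Suc k)" "2 * n + 1 - Suc k = 2 * n - k" using Suc.prems by auto
  then have "(\<Sum>j<2 * n + 1 - k. g j) = (\<Sum>j<2 * n + 1 - Suc k. g j) + g k"
    using assms(1)[of k] Suc.prems by simp
  then show ?case using Suc by simp
qed simp

text \<open>Beyond the axis a prefix sum is the total minus a prefix sum of the left half, so only
  the left half is constrained, and total 1 fixes the middle entry.\<close>

lemma asmseq_mirror:
  fixes g :: "nat \<Rightarrow> int"
  assumes g: "\<And>j. j \<le> 2 * n \<Longrightarrow> g (2 * n - j) = g j"
  shows "asmseq (2 * n + 1) g \<longleftrightarrow> (\<forall>k\<le>n. (\<Sum>j<k. g j) \<in> {0, 1}) \<and> g n = 1 - 2 * (\<Sum>j<n. g j)"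
proof -
  have mid: "(\<Sum>j<2 * n + 1. g j) = 2 * (\<Sum>j<n. g j) + g n"
    using sum_mirror[of n g n, OF g] by simp
  show ?thesis
  proof
    assume "asmseq (2 * n + 1) g"
    then show "(\<forall>k\<le>n. (\<Sum>j<k. g j) \<in> {0, 1}) \<and> g n = 1 - 2 * (\<Sum>j<n. g j)"
      using mid unfolding asmseq_def by (auto simp del: sum.lessThan_Suc)
  next
    assume A: "(\<forall>k\<le>n. (\<Sum>j<k. g j) \<in> {0, 1}) \<and> g n = 1 - 2 * (\<Sum>j<n. g j)"
    then have tot: "(\<Sum>j<2 * n + 1. g j) = 1" using mid by simp
    have "(\<Sum>j<k. g j) \<in> {0, 1}" if "k \<le> 2 * n + 1" for k
    proof (cases "k \<le> n")
      case False
      define k' where "k' = 2 * n + 1 - k"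
      have k': "k' \<le> n" "k = 2 * n + 1 - k'" using that False by (auto simp: k'_def)
      have "(\<Sum>j<k. g j) = 1 - (\<Sum>j<k'. g j)"
        unfolding k'(2) using sum_mirror[of n g k', OF g] k'(1) tot by simp
      moreover have "(\<Sum>j<k'. g j) \<in> {0, 1}" using A k'(1) by blast
      ultimately show ?thesis by auto
    qed (use A in auto)
    then show "asmseq (2 * n + 1) g" using tot by (simp add: asmseq_def)
  qed
qed

text \<open>The prefix sums stay in \<open>{0, 1}\<close> and have to change at every step.\<close>

lemma asmseq_all_nonzero:
  assumes "asmseq m f" "\<And>j. j < m \<Longrightarrow> f j \<noteq> 0" "j < m"
  shows "f j = (- 1) ^ j"
proof -
  have S: "(\<Sum>j<k. f j) = int (k mod 2)" if "k \<le> m" for k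
    using that
  proof (induction k)
    case (Suc k)
    have "(\<Sum>j<Suc k. f j) \<in> {0, 1}" "f k \<noteq> 0" using assms Suc.prems by (auto simp: asmseq_def simp del: sum.lessThan_Suc)
    moreover have "k mod 2 = 0 \<or> k mod 2 = 1" by auto
    ultimately show ?case using Suc by (auto simp: mod_Suc)
  qed simp
  have "f j = (\<Sum>j<Suc j. f j) - (\<Sum>j<j. f j)" by simp
  also have "\<dots> = int (Suc j mod 2) - int (j mod 2)" using S[of "Suc j"] S[of j] assms(3) by simp
  finally show ?thesis by (cases "even j") (auto simp: mod_Suc even_iff_mod_2_eq_zero odd_iff_mod_2_eq_one)
qed

lemma asmseq_alternating_powers: "asmseq (2 * n + 1) (\<lambda>i. (- 1) ^ i)"
proof -
  have "(\<Sum>j<k. (- 1) ^ j) = int (k mod 2)" for k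
    by (induction k) (auto simp: mod_Suc minus_one_power_iff even_iff_mod_2_eq_zero)
  then show ?thesis by (auto simp: asmseq_def)
qed

lemma sum_reversed_block:
  fixes g :: "nat \<Rightarrow> int"
  shows "m \<le> n \<Longrightarrow> (\<Sum>k<m. g (n - 1 - k)) = (\<Sum>j<n. g j) - (\<Sum>j<n - m. g j)"
proof (induction m)
  case (Suc m)
  then have "n - m = Suc (n - Suc m)" "n - 1 - m = n - Suc m" by auto
  then have "(\<Sum>j<n - m. g j) = (\<Sum>j<n - Suc m. g j) + g (n - 1 - m)" by simp
  then show ?case using Suc by simp
qed simp

text \<open>\<open>v\<close> lists the partial row sums up to and including a column
  \<open>c\<close>, so \<open>v - c\<close> are those before it; \<open>a\<close> is the sum that
  column \<open>c\<close> has already accumulated above the rows listed.\<close>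

definition asm_cols :: "int \<Rightarrow> int list \<Rightarrow> int list set" where
  "asm_cols a v = {c. length c = length v \<and> (\<forall>i<length v. v ! i - c ! i \<in> {0, 1}) \<and>
     (\<forall>k\<le>length v. a + (\<Sum>i<k. c ! i) \<in> {0, 1}) \<and> a + (\<Sum>i<length v. c ! i) = 1}"

lemma asm_cols_Cons:
  assumes "x \<in> {0, 1}"
  shows "asm_cols a (x # v) = (\<Union>d\<in>{d\<in>{-1, 0, 1}. x - d \<in> {0, 1} \<and> a \<in> {0, 1}}. (#) d ` asm_cols (a + d) v)"
proof (intro equalityI subsetI)
  fix c assume c: "c \<in> asm_cols a (x # v)"
  then obtain d c' where dc: "c = d # c'" by (cases c) (auto simp: asm_cols_def)
  have 0: "x - d \<in> {0, 1}" "a \<in> {0, 1}" using c by (auto simp: asm_cols_def dc)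
  have "c' \<in> asm_cols (a + d) v"
    unfolding asm_cols_def
  proof (intro CollectI conjI allI impI)
    show "length c' = length v" using c by (simp add: asm_cols_def dc)
    show "v ! i - c' ! i \<in> {0, 1}" if "i < length v" for i
      using c that by (auto simp: asm_cols_def dc dest: spec[of _ "Suc i"])
    have shift: "a + (\<Sum>i<Suc k. c ! i) = a + d + (\<Sum>i<k. c' ! i)" for k
      unfolding sum.lessThan_Suc_shift by (simp add: dc)
    show "a + d + (\<Sum>i<k. c' ! i) \<in> {0, 1}" if "k \<le> length v" for k
      using c that unfolding shift[symmetric] by (auto simp: asm_cols_def simp del: sum.lessThan_Suc)
    show "a + d + (\<Sum>i<length v. c' ! i) = 1"
      using c unfolding shift[symmetric] by (auto simp: asm_cols_def simp del: sum.lessThan_Suc)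
  qed
  moreover have "d \<in> {-1, 0, 1}" using 0 assms by auto
  ultimately show "c \<in> (\<Union>d\<in>{d\<in>{-1, 0, 1}. x - d \<in> {0, 1} \<and> a \<in> {0, 1}}. (#) d ` asm_cols (a + d) v)"
    using 0 dc by blast
next
  fix c assume "c \<in> (\<Union>d\<in>{d\<in>{-1, 0, 1}. x - d \<in> {0, 1} \<and> a \<in> {0, 1}}. (#) d ` asm_cols (a + d) v)"
  then obtain d c' where dc: "c = d # c'" and 0: "x - d \<in> {0, 1}" "a \<in> {0, 1}" and c': "c' \<in> asm_cols (a + d) v" by auto
  have shift: "a + (\<Sum>i<Suc k. c ! i) = a + d + (\<Sum>i<k. c' ! i)" for k
    unfolding sum.lessThan_Suc_shift by (simp add: dc)
  show "c \<in> asm_cols a (x # v)"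
    unfolding asm_cols_def
  proof (intro CollectI conjI allI impI)
    show "length c = length (x # v)" using c' by (simp add: asm_cols_def dc)
    show "(x # v) ! i - c ! i \<in> {0, 1}" if "i < length (x # v)" for i
      using c' 0 that by (cases i) (auto simp: asm_cols_def dc)
    show "a + (\<Sum>i<k. c ! i) \<in> {0, 1}" if "k \<le> length (x # v)" for k
    proof (cases k)
      case (Suc k')
      then show ?thesis unfolding Suc shift using c' that Suc by (auto simp: asm_cols_def)
    qed (use 0 in auto)
    show "a + (\<Sum>i<length (x # v). c ! i) = 1"
      using c' by (simp add: shift asm_cols_def del: sum.lessThan_Suc)
  qed
qed

lemma finite_asm_cols: "set v \<subseteq> {0, 1} \<Longrightarrow> finite (asm_cols a v)"
proof (induction v arbitrary: a)
  case Nil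
  have "asm_cols a [] \<subseteq> {[]}" by (auto simp: asm_cols_def)
  then show ?case using finite_subset by blast
next
  case (Cons x v)
  then show ?case by (subst asm_cols_Cons) auto
qed

definition spin_of :: "int \<Rightarrow> spin_one" where "spin_of v = (if v = 1 then Zero else UUp)"
definition aux_of :: "int \<Rightarrow> spin_half" where "aux_of a = (if a = 1 then Up else Dn)"

definition negs :: "int list \<Rightarrow> nat" where "negs c = length (filter (\<lambda>d. d = - 1) c)"

lemma negs_simps [simp]: "negs [] = 0" "negs (d # c) = (if d = - 1 then Suc (negs c) else negs c)"
  by (simp_all add: negs_def)

lemma sum_Cons_image:
  "(\<Sum>c\<in>(#) d ` A. F c) = (\<Sum>c\<in>A. F (d # c) :: 'a::comm_monoid_add)"
  by (subst sum.reindex) (auto simp: inj_on_def)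

text \<open>The auxiliary state is the running column sum and the site state a partial row sum. An
  entry \<open>d\<close> changes both, so \<open>d = 1\<close> is the raising vertex,
  \<open>d = -1\<close> the lowering vertex of weight \<open>t\<close>, and \<open>d = 0\<close> a
  diagonal vertex of weight 1.\<close>

lemma rowop_sixv_cols:
  assumes "set v \<subseteq> {0, 1}" "a \<in> {0, 1}"
  shows "rowop (sixv.wt t 1) Up (map spin_of v) (aux_of a) R
    = (\<Sum>c\<in>asm_cols a v. t ^ negs c * R (map spin_of (map2 (-) v c)))"
  using assms
proof (induction v arbitrary: a R)
  case Nil
  have "asm_cols a [] = (if a = 1 then {[]} else {})" by (auto simp: asm_cols_def)
  then show ?case using Nil by (auto simp: aux_of_def)
next
  case (Cons x v)
  have x: "x \<in> {0, 1}" and v: "set v \<subseteq> {0, 1}" using Cons.prems by auto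
  have IH0: "rowop (sixv.wt t 1) Up (map spin_of v) Dn R = (\<Sum>c\<in>asm_cols 0 v. t ^ negs c * R (map spin_of (map2 (-) v c)))" for R
    using Cons.IH[OF v, of 0 R] by (simp add: aux_of_def)
  have IH1: "rowop (sixv.wt t 1) Up (map spin_of v) Up R = (\<Sum>c\<in>asm_cols 1 v. t ^ negs c * R (map spin_of (map2 (-) v c)))" for R
    using Cons.IH[OF v, of 1 R] by (simp add: aux_of_def)
  have K: "vK t 1 = t" by (simp add: vK_def)
  \<comment> \<open>A running sum outside \<open>{0, 1}\<close> already violates the condition on
    the empty prefix, which rules out the entries without a vertex.\<close>
  have empty: "asm_cols (-1) v = {}" "asm_cols 2 v = {}" by (auto simp: asm_cols_def dest: spec[of _ 0])
  have sp: "spin_of 0 = UUp" "spin_of 1 = Zero" by (simp_all add: spin_of_def)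
  have disj: "d \<noteq> d' \<Longrightarrow> ((#) d ` A) \<inter> ((#) d' ` A') = {}" for d d' :: int and A A' by auto
  have ax: "aux_of 0 = Dn" "aux_of 1 = Up" by (simp_all add: aux_of_def)
  note fc = finite_asm_cols[OF v]
  note rw = list.map sp ax sixv.rowop_wt IH0 IH1
  have image: "(\<Sum>c\<in>(#) d ` A. t ^ negs c * R (map spin_of (map2 (-) (x # v) c)))
      = (\<Sum>c\<in>A. t ^ negs (d # c) * R (spin_of (x - d) # map spin_of (map2 (-) v c)))" for d A
    by (simp add: sum_Cons_image)
  consider "x = 0" "a = 0" | "x = 0" "a = 1" | "x = 1" "a = 0" | "x = 1" "a = 1"
    using x Cons.prems(2) by auto
  then show ?case
  proof cases
    case 1
    have "{d\<in>{-1, 0, 1}. x - d \<in> {0, 1} \<and> a \<in> {0, 1}} = {-1, 0}" using 1 by auto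
    then have c: "asm_cols a (x # v) = (#) 0 ` asm_cols 0 v"
      unfolding asm_cols_Cons[OF x] using 1 empty by simp
    show ?thesis unfolding c image unfolding 1 rw by (simp add: sp K del: map_map)
  next
    case 2
    have "{d\<in>{-1, 0, 1}. x - d \<in> {0, 1} \<and> a \<in> {0, 1}} = {-1, 0}" using 2 by auto
    then have c: "asm_cols a (x # v) = (#) 0 ` asm_cols 1 v \<union> (#) (-1) ` asm_cols 0 v"
      unfolding asm_cols_Cons[OF x] using 2 by auto
    have "0 \<noteq> (-1 :: int)" by simp
    note un = sum.union_disjoint[OF finite_imageI[OF fc] finite_imageI[OF fc] disj[OF this]]
    show ?thesis unfolding c un image unfolding 2 rw by (simp add: sp K sum_distrib_left mult.assoc del: map_map)
  next
    case 3
    have "{d\<in>{-1, 0, 1}. x - d \<in> {0, 1} \<and> a \<in> {0, 1}} = {0, 1}" using 3 by auto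
    then have c: "asm_cols a (x # v) = (#) 0 ` asm_cols 0 v \<union> (#) 1 ` asm_cols 1 v"
      unfolding asm_cols_Cons[OF x] using 3 by auto
    have "0 \<noteq> (1 :: int)" by simp
    note un = sum.union_disjoint[OF finite_imageI[OF fc] finite_imageI[OF fc] disj[OF this]]
    show ?thesis unfolding c un image unfolding 3 rw by (simp add: sp K del: map_map)
  next
    case 4
    have "{d\<in>{-1, 0, 1}. x - d \<in> {0, 1} \<and> a \<in> {0, 1}} = {0, 1}" using 4 by auto
    then have c: "asm_cols a (x # v) = (#) 0 ` asm_cols 1 v"
      unfolding asm_cols_Cons[OF x] using 4 empty by simp
    show ?thesis unfolding c image unfolding 4 rw by (simp add: sp K del: map_map)
  qed
qed

text \<open>One column is peeled per row of the vertex model, starting with the one next to the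
  axis, until all partial row sums are 0 at the left border.\<close>

primrec paths :: "nat \<Rightarrow> int list \<Rightarrow> int list list set" where
  "paths 0 v = (if set v \<subseteq> {0} then {[]} else {})"
| "paths (Suc n) v = (\<Union>c\<in>asm_cols 0 v. (#) c ` paths n (map2 (-) v c))"

lemma asm_cols_diff: "c \<in> asm_cols a v \<Longrightarrow> set (map2 (-) v c) \<subseteq> {0, 1}"
  by (auto simp: asm_cols_def set_zip)

lemma finite_paths: "set v \<subseteq> {0, 1} \<Longrightarrow> finite (paths n v)"
proof (induction n arbitrary: v)
  case (Suc n)
  then show ?case unfolding paths.simps
    by (intro finite_UN_I finite_imageI finite_asm_cols Suc.IH asm_cols_diff)
qed simp

lemma vrow_paths:
  assumes "set v \<subseteq> {0, 1}"
  shows "(vrow t 1 ^^ n) vac (map spin_of v) = (\<Sum>cs\<in>paths n v. t ^ (\<Sum>c\<leftarrow>cs. negs c))"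
  using assms
proof (induction n arbitrary: v)
  case 0
  have "map spin_of v = replicate (length v) UUp \<longleftrightarrow> set v \<subseteq> {0}"
  proof -
    have "map spin_of v = replicate (length v) UUp \<longleftrightarrow> (\<forall>x\<in>set v. spin_of x = UUp)"
      by (induction v) auto
    also have "\<dots> \<longleftrightarrow> set v \<subseteq> {0}" using 0 by (auto simp: spin_of_def)
    finally show ?thesis .
  qed
  then show ?case by (simp add: vac_def)
next
  case (Suc n)
  have "(vrow t 1 ^^ Suc n) vac (map spin_of v)
     = rowop (sixv.wt t 1) Up (map spin_of v) (aux_of 0) ((vrow t 1 ^^ n) vac)"
    by (simp add: vrow_def aux_of_def)
  also have "\<dots> = (\<Sum>c\<in>asm_cols 0 v. t ^ negs c * (vrow t 1 ^^ n) vac (map spin_of (map2 (-) v c)))"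
    by (rule rowop_sixv_cols) (use Suc.prems in auto)
  also have "\<dots> = (\<Sum>c\<in>asm_cols 0 v. \<Sum>cs\<in>(#) c ` paths n (map2 (-) v c). t ^ (\<Sum>c\<leftarrow>cs. negs c))"
    by (intro sum.cong refl)
      (simp add: Suc.IH[OF asm_cols_diff] sum_Cons_image sum_distrib_left power_add del: map_map)
  also have "\<dots> = (\<Sum>cs\<in>paths (Suc n) v. t ^ (\<Sum>c\<leftarrow>cs. negs c))"
    unfolding paths.simps
    by (rule sum.UNION_disjoint[symmetric])
      (use Suc.prems in \<open>auto intro!: finite_asm_cols finite_paths asm_cols_diff simp del: map_map\<close>)
  finally show ?case .
qed

text \<open>After \<open>m\<close> peelings the remaining partial row sums are \<open>v\<close>
  minus the first \<open>m\<close> columns, so the nested conditions become conditions on prefixes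
  of \<open>cs\<close>.\<close>

lemma paths_iff:
  assumes "set v \<subseteq> {0, 1}"
  shows "cs \<in> paths n v \<longleftrightarrow> length cs = n \<and> (\<forall>c\<in>set cs. length c = length v \<and> asmseq (length v) ((!) c)) \<and>
    (\<forall>i<length v. (\<forall>m\<le>n. v ! i - (\<Sum>k<m. cs ! k ! i) \<in> {0, 1}) \<and> v ! i = (\<Sum>k<n. cs ! k ! i))"
  using assms
proof (induction n arbitrary: v cs)
  case 0
  have "set v \<subseteq> {0} \<longleftrightarrow> (\<forall>i<length v. v ! i = 0)" by (auto simp: set_conv_nth)
  then show ?case by auto
next
  case (Suc n)
  show ?case
  proof (cases cs)
    case Nil
    then show ?thesis by auto
  next
    case (Cons c cs')
    let ?w = "map2 (-) v c"
    have shift: "(\<Sum>k<Suc m. cs ! k ! i) = c ! i + (\<Sum>k<m. cs' ! k ! i)" for m i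
      unfolding sum.lessThan_Suc_shift by (simp add: Cons)
    have all_Suc: "(\<forall>m\<le>Suc n. P m) \<longleftrightarrow> P 0 \<and> (\<forall>m\<le>n. P (Suc m))" for P :: "nat \<Rightarrow> bool"
      by (metis Suc_le_mono le0 not0_implies_Suc)
    have vi: "v ! i \<in> {0, 1}" if "i < length v" for i using Suc.prems that nth_mem by blast
    show ?thesis
    proof (cases "length c = length v")
      case False
      then show ?thesis using Cons by (auto simp: asm_cols_def)
    next
      case len: True
      have w: "length ?w = length v" "\<And>i. i < length v \<Longrightarrow> ?w ! i = v ! i - c ! i" using len by auto
      have c: "c \<in> asm_cols 0 v \<longleftrightarrow> asmseq (length v) ((!) c) \<and> (\<forall>i<length v. v ! i - c ! i \<in> {0, 1})"
        using len by (auto simp: asm_cols_def asmseq_def)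
      have wc: "set ?w \<subseteq> {0, 1}" if "\<forall>i<length v. v ! i - c ! i \<in> {0, 1}"
        using that len by (auto simp: set_zip)
      have "cs \<in> paths (Suc n) v \<longleftrightarrow> c \<in> asm_cols 0 v \<and> cs' \<in> paths n ?w"
        by (auto simp: Cons)
      also have "\<dots> \<longleftrightarrow> asmseq (length v) ((!) c) \<and> (\<forall>i<length v. v ! i - c ! i \<in> {0, 1}) \<and>
          length cs' = n \<and> (\<forall>c\<in>set cs'. length c = length v \<and> asmseq (length v) ((!) c)) \<and>
         (\<forall>i<length v. (\<forall>m\<le>n. v ! i - c ! i - (\<Sum>k<m. cs' ! k ! i) \<in> {0, 1}) \<and> v ! i - c ! i = (\<Sum>k<n. cs' ! k ! i))"
      proof (cases "\<forall>i<length v. v ! i - c ! i \<in> {0, 1}")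
        case True
        have "cs' \<in> paths n ?w \<longleftrightarrow> length cs' = n \<and> (\<forall>c\<in>set cs'. length c = length v \<and> asmseq (length v) ((!) c)) \<and>
          (\<forall>i<length v. (\<forall>m\<le>n. ?w ! i - (\<Sum>k<m. cs' ! k ! i) \<in> {0, 1}) \<and> ?w ! i = (\<Sum>k<n. cs' ! k ! i))"
          using Suc.IH[OF wc[OF True], of cs'] unfolding w(1) .
        also have "\<dots> \<longleftrightarrow> length cs' = n \<and> (\<forall>c\<in>set cs'. length c = length v \<and> asmseq (length v) ((!) c)) \<and>
          (\<forall>i<length v. (\<forall>m\<le>n. v ! i - c ! i - (\<Sum>k<m. cs' ! k ! i) \<in> {0, 1}) \<and> v ! i - c ! i = (\<Sum>k<n. cs' ! k ! i))"
          using w(2) by (simp cong: conj_cong)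
        finally show ?thesis unfolding c using True by blast
      next
        case False
        then show ?thesis unfolding c by blast
      qed
      also have "\<dots> \<longleftrightarrow> asmseq (length v) ((!) c) \<and>
          length cs' = n \<and> (\<forall>c\<in>set cs'. length c = length v \<and> asmseq (length v) ((!) c)) \<and>
         (\<forall>i<length v. (\<forall>m\<le>Suc n. v ! i - (\<Sum>k<m. cs ! k ! i) \<in> {0, 1}) \<and> v ! i = (\<Sum>k<Suc n. cs ! k ! i))"
      proof -
        have "(v ! i - c ! i \<in> {0, 1} \<and> (\<forall>m\<le>n. v ! i - c ! i - (\<Sum>k<m. cs' ! k ! i) \<in> {0, 1}) \<and> v ! i - c ! i = (\<Sum>k<n. cs' ! k ! i))
          \<longleftrightarrow> (\<forall>m\<le>Suc n. v ! i - (\<Sum>k<m. cs ! k ! i) \<in> {0, 1}) \<and> v ! i = (\<Sum>k<Suc n. cs ! k ! i)" if "i < length v" for i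
        proof -
          have "v ! i - c ! i \<in> {0, 1}" if "\<forall>m\<le>n. v ! i - c ! i - (\<Sum>k<m. cs' ! k ! i) \<in> {0, 1}"
            using spec[OF that, of 0] by simp
          then show ?thesis unfolding all_Suc shift using vi[OF that] by (auto simp: diff_diff_eq)
        qed
        then show ?thesis by blast
      qed
      finally show ?thesis using len by (auto simp: Cons)
    qed
  qed
qed

section \<open>Path lists and vertically symmetric matrices\<close>

definition parity :: "nat \<Rightarrow> int list" where
  "parity n = map (\<lambda>i. int (i mod 2)) [0..<2 * n + 1]"

lemma length_parity: "length (parity n) = 2 * n + 1"
  and nth_parity: "i < 2 * n + 1 \<Longrightarrow> parity n ! i = int (i mod 2)"
  and set_parity: "set (parity n) \<subseteq> {0, 1}"
  by (auto simp: parity_def simp del: upt_Suc)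

lemma alt_state_parity: "alt_state n = map spin_of (parity n)"
proof -
  define f where "f i = spin_of (int (i mod 2))" for i
  have "map f [0..<2 * n + 1] = alt_state n"
  proof (induction n)
    case 0
    then show ?case by (simp add: f_def spin_of_def alt_state_def)
  next
    case (Suc n)
    have "map f [0..<2 * Suc n + 1] = f 0 # f 1 # map (\<lambda>i. f (Suc (Suc i))) [0..<2 * n + 1]"
      by (simp add: map_upt_Suc del: upt_Suc)
    also have "(\<lambda>i. f (Suc (Suc i))) = f" by (simp add: f_def fun_eq_iff)
    finally show ?case using Suc by (simp add: alt_state_def f_def spin_of_def del: upt_Suc)
  qed
  moreover have "f = spin_of \<circ> (\<lambda>i. int (i mod 2))" by (simp add: f_def fun_eq_iff)
  ultimately show ?thesis unfolding parity_def map_map by simp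
qed

definition vsasm :: "nat \<Rightarrow> int mat set" where
  "vsasm n = {M. alternating_sign_matrix (2 * n + 1) M \<and> vertically_symmetric (2 * n + 1) M}"

text \<open>The list runs outwards from the axis, hence the index \<open>n - 1 - j\<close> on the
  left and its mirror image \<open>j - n - 1\<close> on the right.\<close>

definition of_path :: "nat \<Rightarrow> int list list \<Rightarrow> int mat" where
  "of_path n cs = mat (2 * n + 1) (2 * n + 1) (\<lambda>(i, j).
     if j < n then cs ! (n - 1 - j) ! i else if j = n then (- 1) ^ i else cs ! (j - n - 1) ! i)"

definition to_path :: "nat \<Rightarrow> int mat \<Rightarrow> int list list" where
  "to_path n M = map (\<lambda>k. map (\<lambda>i. M $$ (i, n - 1 - k)) [0..<2 * n + 1]) [0..<n]"

text \<open>By \<open>asmseq_mirror\<close> each entry of the middle column is odd, hence non-zero,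
  so that column alternates as \<open>(- 1) ^ i\<close>; this in turn fixes the sum of each left
  half-row to \<open>i mod 2\<close>. The columns on the right are copies by symmetry.\<close>

lemma vsasm_iff:
  "M \<in> vsasm n \<longleftrightarrow> M \<in> carrier_mat (2 * n + 1) (2 * n + 1) \<and>
    (\<forall>i<2 * n + 1. \<forall>j\<le>2 * n. M $$ (i, 2 * n - j) = M $$ (i, j)) \<and>
    (\<forall>j<n. asmseq (2 * n + 1) (\<lambda>i. M $$ (i, j))) \<and> (\<forall>i<2 * n + 1. M $$ (i, n) = (- 1) ^ i) \<and>
    (\<forall>i<2 * n + 1. (\<forall>k\<le>n. (\<Sum>j<k. M $$ (i, j)) \<in> {0, 1}) \<and> (\<Sum>j<n. M $$ (i, j)) = int (i mod 2))" (is "?L \<longleftrightarrow> ?R")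
proof -
  have sym: "vertically_symmetric (2 * n + 1) M \<longleftrightarrow> (\<forall>i<2 * n + 1. \<forall>j\<le>2 * n. M $$ (i, 2 * n - j) = M $$ (i, j))"
    by (auto simp: vertically_symmetric_def less_Suc_eq_le)
  have par: "(- 1) ^ i = 1 - 2 * int (i mod 2)" for i
    by (auto simp: minus_one_power_iff even_iff_mod_2_eq_zero odd_iff_mod_2_eq_one)
  show ?thesis
  proof
    assume L: ?L
    then have M: "M \<in> carrier_mat (2 * n + 1) (2 * n + 1)" and S: "\<forall>i<2 * n + 1. \<forall>j\<le>2 * n. M $$ (i, 2 * n - j) = M $$ (i, j)"
      and rows: "\<And>i. i < 2 * n + 1 \<Longrightarrow> asmseq (2 * n + 1) (\<lambda>j. M $$ (i, j))"
      and columns: "\<And>j. j < 2 * n + 1 \<Longrightarrow> asmseq (2 * n + 1) (\<lambda>i. M $$ (i, j))"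
      unfolding vsasm_def mem_Collect_eq sym alternating_sign_matrix_asmseq by blast+
    have row: "(\<forall>k\<le>n. (\<Sum>j<k. M $$ (i, j)) \<in> {0, 1}) \<and> M $$ (i, n) = 1 - 2 * (\<Sum>j<n. M $$ (i, j))" if "i < 2 * n + 1" for i
      using asmseq_mirror[of n "\<lambda>j. M $$ (i, j)"] rows[OF that] S that by simp
    have nz: "M $$ (i, n) \<noteq> 0" if "i < 2 * n + 1" for i
      using row[OF that] by presburger
    have mid: "M $$ (i, n) = (- 1) ^ i" if "i < 2 * n + 1" for i
      using asmseq_all_nonzero[OF columns[of n] nz that] by simp
    have "(\<Sum>j<n. M $$ (i, j)) = int (i mod 2)" if "i < 2 * n + 1" for i
      using row[OF that] mid[OF that] par[of i] by simp
    then show ?R using M S columns row mid by auto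
  next
    assume R: ?R
    have rows: "asmseq (2 * n + 1) (\<lambda>j. M $$ (i, j))" if "i < 2 * n + 1" for i
      using R that par[of i] by (subst asmseq_mirror) auto
    have columns: "asmseq (2 * n + 1) (\<lambda>i. M $$ (i, j))" if "j < 2 * n + 1" for j
    proof -
      consider "j < n" | "j = n" | "n < j" by linarith
      then show ?thesis
      proof cases
        case 1
        then show ?thesis using R by blast
      next
        case 2
        have "asmseq (2 * n + 1) (\<lambda>i. M $$ (i, n)) = asmseq (2 * n + 1) (\<lambda>i. (- 1) ^ i)"
          unfolding asmseq_def using R by (intro arg_cong2[of _ _ _ _ "(\<and>)"] all_cong arg_cong2[of _ _ _ _ "(\<in>)"] arg_cong2[of _ _ _ _ "(=)"] sum.cong) auto
        then show ?thesis using 2 asmseq_alternating_powers by simp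
      next
        case 3
        define j' where "j' = 2 * n - j"
        have j': "j' < n" "j = 2 * n - j'" "j' \<le> 2 * n" using 3 that by (auto simp: j'_def)
        have "asmseq (2 * n + 1) (\<lambda>i. M $$ (i, j)) = asmseq (2 * n + 1) (\<lambda>i. M $$ (i, j'))"
          unfolding asmseq_def j'(2) using R j'(3) by (intro arg_cong2[of _ _ _ _ "(\<and>)"] all_cong arg_cong2[of _ _ _ _ "(\<in>)"] arg_cong2[of _ _ _ _ "(=)"] sum.cong) auto
        then show ?thesis using R j'(1) by blast
      qed
    qed
    show ?L unfolding vsasm_def mem_Collect_eq sym alternating_sign_matrix_asmseq
      using R rows columns by blast
  qed
qed

lemma asmseq_cong: "(\<And>i. i < m \<Longrightarrow> f i = g i) \<Longrightarrow> asmseq m f = asmseq m g"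
  unfolding asmseq_def by (intro arg_cong2[of _ _ _ _ "(\<and>)"] all_cong arg_cong2[of _ _ _ _ "(\<in>)"] arg_cong2[of _ _ _ _ "(=)"] sum.cong) auto

lemma paths_parity_iff:
  "cs \<in> paths n (parity n) \<longleftrightarrow> length cs = n \<and> (\<forall>k<n. length (cs ! k) = 2 * n + 1 \<and> asmseq (2 * n + 1) ((!) (cs ! k))) \<and>
    (\<forall>i<2 * n + 1. (\<forall>m\<le>n. int (i mod 2) - (\<Sum>k<m. cs ! k ! i) \<in> {0, 1}) \<and> int (i mod 2) = (\<Sum>k<n. cs ! k ! i))"
  unfolding paths_iff[OF set_parity] length_parity
  by (intro conj_cong refl) (auto simp: all_set_conv_all_nth nth_parity)

lemma sum_of_path:
  assumes "k \<le> n" "length cs = n" "i < 2 * n + 1"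
  shows "(\<Sum>j<k. of_path n cs $$ (i, j)) = (\<Sum>l<n. cs ! l ! i) - (\<Sum>l<n - k. cs ! l ! i)"
proof -
  have "(\<Sum>j<k. of_path n cs $$ (i, j)) = (\<Sum>j<k. cs ! (n - 1 - j) ! i)"
    using assms by (intro sum.cong refl) (simp add: of_path_def)
  then show ?thesis using sum_reversed_block[OF assms(1), of "\<lambda>l. cs ! l ! i"] by simp
qed

lemma of_path_in_vsasm:
  assumes "cs \<in> paths n (parity n)" shows "of_path n cs \<in> vsasm n"
proof -
  note cs = assms[unfolded paths_parity_iff]
  have len: "length cs = n" using cs by blast
  show ?thesis
    unfolding vsasm_iff
  proof (intro conjI allI impI)
    show "of_path n cs \<in> carrier_mat (2 * n + 1) (2 * n + 1)" by (simp add: of_path_def)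
    show "of_path n cs $$ (i, 2 * n - j) = of_path n cs $$ (i, j)" if "i < 2 * n + 1" "j \<le> 2 * n" for i j
    proof -
      consider "j < n" | "j = n" | "n < j" by linarith
      then show ?thesis
      proof cases
        case 1
        then have "2 * n - j - n - 1 = n - 1 - j" "\<not> 2 * n - j < n" "2 * n - j \<noteq> n" by auto
        then show ?thesis using 1 that by (simp add: of_path_def)
      next
        case 3
        then have "n - 1 - (2 * n - j) = j - n - 1" "2 * n - j < n" using that by auto
        then show ?thesis using 3 that by (simp add: of_path_def)
      qed (use that in \<open>simp add: of_path_def\<close>)
    qed
    show "asmseq (2 * n + 1) (\<lambda>i. of_path n cs $$ (i, j))" if "j < n" for j
    proof -
      have "asmseq (2 * n + 1) (\<lambda>i. of_path n cs $$ (i, j)) = asmseq (2 * n + 1) ((!) (cs ! (n - 1 - j)))"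
        using that by (intro asmseq_cong) (simp add: of_path_def)
      then show ?thesis using cs that by simp
    qed
    show "of_path n cs $$ (i, n) = (- 1) ^ i" if "i < 2 * n + 1" for i
      using that by (simp add: of_path_def)
    show "(\<Sum>j<k. of_path n cs $$ (i, j)) \<in> {0, 1}" if "i < 2 * n + 1" "k \<le> n" for i k
    proof -
      have e1: "int (i mod 2) - (\<Sum>l<n - k. cs ! l ! i) \<in> {0, 1}" and e2: "int (i mod 2) = (\<Sum>l<n. cs ! l ! i)"
        using cs that(1) by (meson diff_le_self, blast)
      show ?thesis unfolding sum_of_path[OF that(2) len that(1)] e2[symmetric] by (rule e1)
    qed
    show "(\<Sum>j<n. of_path n cs $$ (i, j)) = int (i mod 2)" if "i < 2 * n + 1" for i
      using sum_of_path[OF order.refl len that] cs that by simp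
  qed
qed

lemma to_path_in_paths:
  assumes "M \<in> vsasm n" shows "to_path n M \<in> paths n (parity n)"
proof -
  note M = assms[unfolded vsasm_iff]
  have nth: "to_path n M ! k ! i = M $$ (i, n - 1 - k)" if "k < n" "i < 2 * n + 1" for k i
    using that by (simp add: to_path_def del: upt_Suc)
  have sum: "(\<Sum>k<m. to_path n M ! k ! i) = (\<Sum>j<n. M $$ (i, j)) - (\<Sum>j<n - m. M $$ (i, j))" if "m \<le> n" "i < 2 * n + 1" for m i
  proof -
    have "(\<Sum>k<m. to_path n M ! k ! i) = (\<Sum>k<m. M $$ (i, n - 1 - k))"
      using that by (intro sum.cong refl) (simp add: nth)
    then show ?thesis using sum_reversed_block[OF that(1), of "\<lambda>j. M $$ (i, j)"] by simp
  qed
  show ?thesis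
    unfolding paths_parity_iff
  proof (intro conjI allI impI)
    show "length (to_path n M) = n" by (simp add: to_path_def)
    fix k assume k: "k < n"
    show "length (to_path n M ! k) = 2 * n + 1" using k by (simp add: to_path_def)
    have "asmseq (2 * n + 1) ((!) (to_path n M ! k)) = asmseq (2 * n + 1) (\<lambda>i. M $$ (i, n - 1 - k))"
      using k by (intro asmseq_cong) (simp add: nth)
    then show "asmseq (2 * n + 1) ((!) (to_path n M ! k))" using M k by simp
  next
    fix i m assume i: "i < 2 * n + 1" and m: "m \<le> n"
    have "(\<Sum>j<n - m. M $$ (i, j)) \<in> {0, 1}" "(\<Sum>j<n. M $$ (i, j)) = int (i mod 2)"
      using M i by (meson diff_le_self, blast)
    then show "int (i mod 2) - (\<Sum>k<m. to_path n M ! k ! i) \<in> {0, 1}" unfolding sum[OF m i] by simp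
  next
    fix i assume i: "i < 2 * n + 1"
    then show "int (i mod 2) = (\<Sum>k<n. to_path n M ! k ! i)" using sum[OF order.refl i] M by simp
  qed
qed

lemma of_path_to_path:
  assumes "M \<in> vsasm n" shows "of_path n (to_path n M) = M"
proof (rule eq_matI)
  note M = assms[unfolded vsasm_iff]
  then have car: "M \<in> carrier_mat (2 * n + 1) (2 * n + 1)" by blast
  then show "dim_row (of_path n (to_path n M)) = dim_row M" "dim_col (of_path n (to_path n M)) = dim_col M"
    by (auto simp: of_path_def)
  fix i j assume "i < dim_row M" "j < dim_col M"
  then have ij: "i < 2 * n + 1" "j < 2 * n + 1" using car by auto
  consider "j < n" | "j = n" | "n < j" by linarith
  then show "of_path n (to_path n M) $$ (i, j) = M $$ (i, j)"
  proof cases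
    case 3
    define j' where "j' = 2 * n - j"
    have j': "j' < n" "j = 2 * n - j'" "j' \<le> 2 * n" "n - 1 - (j - n - 1) = j'" using 3 ij by (auto simp: j'_def)
    have "M $$ (i, j) = M $$ (i, j')" unfolding j'(2) using M ij(1) j'(3) by blast
    moreover have "of_path n (to_path n M) $$ (i, j) = M $$ (i, j')"
      using ij 3 j'(4) by (simp add: of_path_def to_path_def del: upt_Suc)
    ultimately show ?thesis by simp
  qed (use ij M in \<open>simp_all add: of_path_def to_path_def del: upt_Suc\<close>)
qed

lemma to_path_of_path:
  assumes "cs \<in> paths n (parity n)" shows "to_path n (of_path n cs) = cs"
proof (rule nth_equalityI)
  note cs = assms[unfolded paths_parity_iff]
  show "length (to_path n (of_path n cs)) = length cs" using cs by (simp add: to_path_def)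
  fix k assume "k < length (to_path n (of_path n cs))"
  then have k: "k < n" by (simp add: to_path_def)
  show "to_path n (of_path n cs) ! k = cs ! k"
    by (rule nth_equalityI) (use cs k in \<open>auto simp: to_path_def of_path_def simp del: upt_Suc\<close>)
qed

lemma negs_card: "negs c = card {i. i < length c \<and> c ! i = - 1}"
  unfolding negs_def by (rule length_filter_conv_card)

lemma num_neg_left_path:
  assumes "cs \<in> paths n (parity n)"
  shows "num_neg_left (2 * n + 1) (of_path n cs) = (\<Sum>c\<leftarrow>cs. negs c)"
proof -
  note cs = assms[unfolded paths_parity_iff]
  have len: "length cs = n" using cs by blast
  have "{(i, j). i < 2 * n + 1 \<and> j < (2 * n + 1) div 2 \<and> of_path n cs $$ (i, j) = - 1}
    = (\<lambda>(j, i). (i, j)) ` (SIGMA j:{..<n}. {i. i < 2 * n + 1 \<and> cs ! (n - 1 - j) ! i = - 1})"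
    by (auto simp: of_path_def image_iff)
  then have "num_neg_left (2 * n + 1) (of_path n cs)
    = card (SIGMA j:{..<n}. {i. i < 2 * n + 1 \<and> cs ! (n - 1 - j) ! i = - 1})"
    unfolding num_neg_left_def by (simp only:) (rule card_image, auto simp: inj_on_def)
  also have "\<dots> = (\<Sum>j<n. card {i. i < 2 * n + 1 \<and> cs ! (n - 1 - j) ! i = - 1})"
    by (subst card_SigmaI) auto
  also have "\<dots> = (\<Sum>j<n. negs (cs ! (n - Suc j)))"
    using cs by (intro sum.cong refl) (simp add: negs_card)
  also have "\<dots> = (\<Sum>k<n. negs (cs ! k))" by (rule sum.nat_diff_reindex)
  also have "\<dots> = (\<Sum>c\<leftarrow>cs. negs c)"
    using len by (simp add: sum_list_sum_nth atLeast0LessThan)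
  finally show ?thesis .
qed

theorem A_V_rows: "A_V (2 * n + 1) t = (vrow t 1 ^^ n) vac (alt_state n)"
proof -
  have "(vrow t 1 ^^ n) vac (alt_state n) = (\<Sum>cs\<in>paths n (parity n). t ^ (\<Sum>c\<leftarrow>cs. negs c))"
    unfolding alt_state_parity by (rule vrow_paths[OF set_parity])
  also have "\<dots> = (\<Sum>M\<in>vsasm n. t ^ num_neg_left (2 * n + 1) M)"
    by (rule sum.reindex_bij_witness[of _ "to_path n" "of_path n"])
      (simp_all only: to_path_in_paths of_path_in_vsasm of_path_to_path to_path_of_path num_neg_left_path)
  finally show ?thesis by (simp add: A_V_def vsasm_def)
qed

text \<open>Both sides are polynomials in \<open>t\<close>, so the value at \<open>t = 0\<close>,
  which \<open>sixv_component\<close> excludes, follows by continuity.\<close>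

lemma A_V_eq_asm_det: "A_V (2 * n + 1) t = asm_det n (t :: complex)"
proof (cases "t = 0")
  case False
  then show ?thesis using A_V_rows sixv_component by simp
next
  case True
  have id: "((\<lambda>t. t) \<longlongrightarrow> (0::complex)) (at 0)" by (rule tendsto_ident_at)
  have A: "((\<lambda>t. A_V (2 * n + 1) t) \<longlongrightarrow> A_V (2 * n + 1) (0::complex)) (at 0)"
    unfolding A_V_def by (intro tendsto_intros id)
  have D: "((\<lambda>t. asm_det n t) \<longlongrightarrow> asm_det n (0::complex)) (at 0)"
    by (rule asm_det_tendsto[OF id])
  have "\<forall>\<^sub>F t in at 0. A_V (2 * n + 1) t = asm_det n (t :: complex)"
    using eventually_neq_at_within[of 0 0 UNIV] by eventually_elim (rule trans[OF A_V_rows sixv_component])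
  with A have "((\<lambda>t. asm_det n t) \<longlongrightarrow> A_V (2 * n + 1) (0::complex)) (at 0)"
    by (rule Lim_transform_eventually)
  then show ?thesis unfolding True by (rule tendsto_unique[OF at_neq_bot _ D])
qed

theorem theorem2p12:
  fixes n :: nat and x :: real and q :: complex and r :: "complex \<Rightarrow> complex"
  assumes "n \<ge> 1"
    and "q \<noteq> 0"
    and "of_real x = q + inverse q"
    and "\<And>p. p \<noteq> 0 \<Longrightarrow> (r p)^2 = qbr p * qbr (p^2)"
  shows "phi_D r q (2 * n) (concat (replicate n [UUp, DDn]))
           = A_V (2 * n + 1) ((of_real x)^2) \<and>
         phi_D r q (2 * n + 1) (replicate (2 * n + 1) Zero)
           = (of_real x)^n * A_V (2 * n + 1) ((of_real x)^2) \<and>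
         (\<forall>t :: complex. A_V (2 * n + 1) t =
           Determinant.det (Matrix.mat n n (\<lambda>(i, j). \<Sum>k<n.
             of_nat ((i + j + 1) choose (i + k + 1)) * of_nat ((i + k + 1) choose (2 * k + 1)) * t ^ k)))"
proof (intro conjI allI)
  note components = phi_D_components[OF assms(2), of r n, OF assms(4) assms(1)]
  show "phi_D r q (2 * n) (concat (replicate n [UUp, DDn])) = A_V (2 * n + 1) ((of_real x)^2)"
    unfolding A_V_eq_asm_det assms(3) by (rule components(1))
  show "phi_D r q (2 * n + 1) (replicate (2 * n + 1) Zero) = (of_real x)^n * A_V (2 * n + 1) ((of_real x)^2)"
    unfolding A_V_eq_asm_det assms(3) by (rule components(2))
  show "A_V (2 * n + 1) t = Determinant.det (Matrix.mat n n (\<lambda>(i, j). \<Sum>k<n.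
      of_nat ((i + j + 1) choose (i + k + 1)) * of_nat ((i + k + 1) choose (2 * k + 1)) * t ^ k))" for t :: complex
    unfolding A_V_eq_asm_det asm_det_def ..
qed

end
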